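(* Let $n\ge 2$ be an integer, and let $\ell_1(n)=\#\{p \text{ odd prime}: p^2\le n\}$ and $\ell_2(n)=\ell_1(n)+1$. Then there is a polynomial $q_n(t)=\sum_{i=0}^{\ell_2(n)}h_i(n)t^i$ such that the Poincaré--Betti series of the residue field $K$ over $A_n=\Gamma_n$ is $$P^{A_n}_K(t)=-\frac{(1+t)^{\ell_1(n)}}{q_n(t)},$$ and: (1) $q_n(-1)\ne 0$; (2) the exponent in the numerator is $\ell_1(n)=\#\{p\text{ odd prime}:p^2\le n\}$; (3) the degree of $q_n$ is $\ell_2(n)=\ell_1(n)+1$; (4) $h_0(n)=-1$; (5) $h_1(n)=\pi(n)-\ell_1(n)$; (6) $h_{\ell_2(n)}(n)=C_{n,1}=\lceil n/2\rceil$. (At $n=1$ the statement degenerates: $r=0$, $D_1=1$, and clause (3) fails, since $\deg q_1=0\neq 1=\ell_2(1)$.)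
   Context: $p_1=2<p_2=3<\cdots$ are the primes and $\pi(x)$ is the number of primes $\le x$. $K$ is a field containing $\mathbb{Q}$. For a positive integer $n$ put $r=\pi(n)$ and $S=K[x_1,\dots,x_r]$. The weight of a monomial $m=x_1^{a_1}\cdots x_r^{a_r}$ is $w(m)=\prod_i p_i^{a_i}$. $I_n\subset S$ is the monomial ideal generated by all monomials of weight $>n$, and $G(I_n)$ is its minimal monomial generating set. $\Gamma_n$ is the ring of functions $\{1,\dots,n\}\to K$ under (truncated) Dirichlet convolution; $\Gamma_n\cong S/I_n$. For a monomial $m\neq1$, $\min(m)$ is the least index $i$ with $a_i>0$, and $C_{n,v}=\#\{m\in G(I_n):\min(m)=v\}$. The Poincaré--Betti series is $P^{A_n}_K(t)=\sum_{i\ge0}\dim_K\operatorname{Tor}^{A_n}_i(K,K)\,t^i$. It is a known earlier result (Eliahou--Kervaire resolution together with the Golod property) that $P^{A_n}_K(t)=(1+t)^r/D_n(t)$ with $D_n(t)=1-t^2\sum_{j=1}^{r}(1+t)^{r-j}C_{n,j}$; the theorem describes the reduced form of this fraction. *)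

theory Defs
  imports
    "HOL-Library.Poly_Mapping"
    "HOL-Library.Infinite_Set"
    "HOL-Computational_Algebra.Computational_Algebra"
    "Jordan_Normal_Form.VS_Connect"
    "HOL-Algebra.Ideal"
begin

section \<open>Primes\<close>

definition prime_count :: "nat \<Rightarrow> nat" where
  "prime_count n = card {p::nat. prime p \<and> p \<le> n}"

text \<open>The primes are numbered from 1, so \<open>nth_prime 1 = 2\<close>; the value at 0 is never used.\<close>

definition nth_prime :: "nat \<Rightarrow> nat" where
  "nth_prime i = enumerate {p. prime p} (i - 1)"

definition ell1 :: "nat \<Rightarrow> nat" where
  "ell1 n = card {p::nat. prime p \<and> odd p \<and> p\<^sup>2 \<le> n}"

definition ell2 :: "nat \<Rightarrow> nat" where
  "ell2 n = ell1 n + 1"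


section \<open>The monomial ideal and its minimal generators\<close>

text \<open>
  A monomial is given by its exponent vector, of type \<open>nat \<Rightarrow>\<^sub>0 nat\<close>, and a polynomial by its
  finitely supported coefficient function on monomials. Variables are indexed from 1 to \<open>r\<close>.
\<close>

definition polynomial_ring :: "nat \<Rightarrow> ((nat \<Rightarrow>\<^sub>0 nat) \<Rightarrow>\<^sub>0 'k::field) ring" where
  "polynomial_ring r =
     class_ring\<lparr>carrier := {f. \<forall>m \<in> Poly_Mapping.keys f. Poly_Mapping.keys m \<subseteq> {1..r}}\<rparr>"

definition monomial :: "(nat \<Rightarrow>\<^sub>0 nat) \<Rightarrow> ((nat \<Rightarrow>\<^sub>0 nat) \<Rightarrow>\<^sub>0 'k::field)" where
  "monomial m = Poly_Mapping.single m 1"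

definition weight :: "(nat \<Rightarrow>\<^sub>0 nat) \<Rightarrow> nat" where
  "weight m = (\<Prod>i \<in> Poly_Mapping.keys m. nth_prime i ^ Poly_Mapping.lookup m i)"

definition weight_ideal :: "nat \<Rightarrow> ((nat \<Rightarrow>\<^sub>0 nat) \<Rightarrow>\<^sub>0 'k::field) set" where
  "weight_ideal n =
     Idl\<^bsub>polynomial_ring (prime_count n)\<^esub>
       {monomial m | m. Poly_Mapping.keys m \<subseteq> {1..prime_count n} \<and> weight m > n}"

text \<open>
  The minimal monomial generators of a monomial ideal are the monomials in it that are
  minimal with respect to divisibility; divisibility of monomials is additive in the exponents.
\<close>

definition min_monomial_gens :: "((nat \<Rightarrow>\<^sub>0 nat) \<Rightarrow>\<^sub>0 'k::field) set \<Rightarrow> (nat \<Rightarrow>\<^sub>0 nat) set" where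
  "min_monomial_gens I =
     {m. monomial m \<in> I \<and> (\<forall>m'. monomial m' \<in> I \<and> (\<exists>d. m = m' + d) \<longrightarrow> m' = m)}"

definition min_index :: "(nat \<Rightarrow>\<^sub>0 nat) \<Rightarrow> nat" where
  "min_index m = Min (Poly_Mapping.keys m)"

definition gen_count :: "'k::field itself \<Rightarrow> nat \<Rightarrow> nat \<Rightarrow> nat" where
  "gen_count _ n v =
     card {m \<in> min_monomial_gens (weight_ideal n :: ((nat \<Rightarrow>\<^sub>0 nat) \<Rightarrow>\<^sub>0 'k) set). min_index m = v}"


section \<open>The ring of functions on \<open>{1..n}\<close> under truncated Dirichlet convolution\<close>

text \<open>Functions on \<open>{1..n}\<close> are extended by zero.\<close>

definition dirichlet_ring :: "nat \<Rightarrow> (nat \<Rightarrow> 'k::field) ring" where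
  "dirichlet_ring n =
     \<lparr> carrier = {f. \<forall>m. m \<notin> {1..n} \<longrightarrow> f m = 0},
       mult = (\<lambda>f g m. if m \<in> {1..n} then \<Sum>d | d dvd m. f d * g (m div d) else 0),
       one = (\<lambda>m. if m = 1 then 1 else 0),
       zero = (\<lambda>_. 0),
       add = (\<lambda>f g m. f m + g m) \<rparr>"

text \<open>
  The structure map of the \<open>K\<close>-algebra \<open>dirichlet_ring n\<close>, and \<open>K\<close> as a module over it:
  evaluation at 1 is the quotient map onto the residue field.
\<close>

definition scalar :: "'k::field \<Rightarrow> nat \<Rightarrow> 'k" where
  "scalar c = (\<lambda>m. if m = 1 then c else 0)"

definition residue_module :: "(nat \<Rightarrow> 'k::field, 'k) module" where
  "residue_module =
     \<lparr> carrier = UNIV, mult = (*), one = 1, zero = 0, add = (+), smult = (\<lambda>f c. f 1 * c) \<rparr>"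


section \<open>Tor\<close>

definition regular_module :: "('a, 'm) ring_scheme \<Rightarrow> ('a, 'a) module" where
  "regular_module R =
     \<lparr> carrier = carrier R, mult = mult R, one = one R, zero = zero R, add = add R,
       smult = mult R \<rparr>"

text \<open>
  The record of modules extends that of rings; multiplication and unit play no role in a module
  and are left unspecified below.
\<close>

definition power_module :: "('a, 'b, 'm) module_scheme \<Rightarrow> nat \<Rightarrow> ('a, nat \<Rightarrow> 'b) module" where
  "power_module N b =
     \<lparr> carrier = {..<b} \<rightarrow>\<^sub>E carrier N, mult = undefined, one = undefined,
       zero = (\<lambda>i\<in>{..<b}. \<zero>\<^bsub>N\<^esub>),
       add = (\<lambda>v w. \<lambda>i\<in>{..<b}. v i \<oplus>\<^bsub>N\<^esub> w i),
       smult = (\<lambda>a v. \<lambda>i\<in>{..<b}. a \<odot>\<^bsub>N\<^esub> v i) \<rparr>"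

definition quotient_module ::
    "('a, 'm) ring_scheme \<Rightarrow> ('a, 'b, 'p) module_scheme \<Rightarrow> 'b set \<Rightarrow> ('a, 'b set) module" where
  "quotient_module R M B =
     \<lparr> carrier = a_rcosets\<^bsub>M\<^esub> B, mult = undefined, one = undefined,
       zero = B,
       add = set_add M,
       smult = (\<lambda>a X. \<Union>x\<in>X. B +>\<^bsub>M\<^esub> (a \<odot>\<^bsub>M\<^esub> x)) \<rparr>"

text \<open>
  A complex \<open>\<dots> \<rightarrow> R\<^bsup>b 2\<^esup> \<rightarrow> R\<^bsup>b 1\<^esup> \<rightarrow> R\<^bsup>b 0\<^esup>\<close> of finitely generated free modules is given by its
  ranks \<open>b\<close> and by matrices \<open>D k\<close> of size \<open>b k \<times> b (k + 1)\<close> for the maps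
  \<open>R\<^bsup>b (k + 1)\<^esup> \<rightarrow> R\<^bsup>b k\<^esup>\<close>. Tensoring it over \<open>R\<close> with a module \<open>N\<close> gives
  \<open>N\<^bsup>b k\<^esup> = R\<^bsup>b k\<^esup> \<otimes> N\<close>, with maps given by the same matrices; the complex itself is the case
  \<open>N = R\<close>.
\<close>

definition differential ::
    "('a, 'b, 'm) module_scheme \<Rightarrow> (nat \<Rightarrow> nat) \<Rightarrow> (nat \<Rightarrow> nat \<Rightarrow> nat \<Rightarrow> 'a) \<Rightarrow> nat
      \<Rightarrow> (nat \<Rightarrow> 'b) \<Rightarrow> nat \<Rightarrow> 'b" where
  "differential N b D k v =
     (\<lambda>i\<in>{..<b k}. \<Oplus>\<^bsub>N\<^esub>j\<in>{..<b (Suc k)}. D k i j \<odot>\<^bsub>N\<^esub> v j)"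

definition cycles ::
    "('a, 'b, 'm) module_scheme \<Rightarrow> (nat \<Rightarrow> nat) \<Rightarrow> (nat \<Rightarrow> nat \<Rightarrow> nat \<Rightarrow> 'a) \<Rightarrow> nat
      \<Rightarrow> (nat \<Rightarrow> 'b) set" where
  "cycles N b D i =
     (case i of
        0 \<Rightarrow> carrier (power_module N (b 0))
      | Suc k \<Rightarrow> {v \<in> carrier (power_module N (b (Suc k))).
                   differential N b D k v = \<zero>\<^bsub>power_module N (b k)\<^esub>})"

definition boundaries ::
    "('a, 'b, 'm) module_scheme \<Rightarrow> (nat \<Rightarrow> nat) \<Rightarrow> (nat \<Rightarrow> nat \<Rightarrow> nat \<Rightarrow> 'a) \<Rightarrow> nat
      \<Rightarrow> (nat \<Rightarrow> 'b) set" where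
  "boundaries N b D i = differential N b D i ` carrier (power_module N (b (Suc i)))"

definition homology_module ::
    "('a, 'm) ring_scheme \<Rightarrow> ('a, 'b, 'p) module_scheme
      \<Rightarrow> (nat \<Rightarrow> nat) \<Rightarrow> (nat \<Rightarrow> nat \<Rightarrow> nat \<Rightarrow> 'a) \<Rightarrow> nat \<Rightarrow> ('a, (nat \<Rightarrow> 'b) set) module" where
  "homology_module R N b D i =
     quotient_module R ((power_module N (b i))\<lparr>carrier := cycles N b D i\<rparr>) (boundaries N b D i)"

text \<open>The augmentation \<open>R\<^bsup>b 0\<^esup> \<rightarrow> M\<close> sends the \<open>j\<close>-th basis vector to \<open>e j\<close>.\<close>

definition augmentation ::
    "('a, 'b, 'm) module_scheme \<Rightarrow> (nat \<Rightarrow> nat) \<Rightarrow> (nat \<Rightarrow> 'b) \<Rightarrow> (nat \<Rightarrow> 'a) \<Rightarrow> 'b" where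
  "augmentation M b e v = (\<Oplus>\<^bsub>M\<^esub>j\<in>{..<b 0}. v j \<odot>\<^bsub>M\<^esub> e j)"

definition is_free_resolution ::
    "('a, 'm) ring_scheme \<Rightarrow> ('a, 'b, 'p) module_scheme
      \<Rightarrow> (nat \<Rightarrow> nat) \<Rightarrow> (nat \<Rightarrow> nat \<Rightarrow> nat \<Rightarrow> 'a) \<Rightarrow> (nat \<Rightarrow> 'b) \<Rightarrow> bool" where
  "is_free_resolution R M b D e \<longleftrightarrow>
     (\<forall>k. \<forall>i<b k. \<forall>j<b (Suc k). D k i j \<in> carrier R) \<and>
     (\<forall>j<b 0. e j \<in> carrier M) \<and>
     augmentation M b e ` carrier (power_module (regular_module R) (b 0)) = carrier M \<and>
     {v \<in> carrier (power_module (regular_module R) (b 0)). augmentation M b e v = \<zero>\<^bsub>M\<^esub>}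
       = boundaries (regular_module R) b D 0 \<and>
     (\<forall>k. cycles (regular_module R) b D (Suc k) = boundaries (regular_module R) b D (Suc k))"

text \<open>
  \<open>Tor\<^sub>i(M, N)\<close> is the \<open>i\<close>-th homology of \<open>F \<otimes> N\<close> for a free resolution \<open>F\<close> of \<open>M\<close>, and does not
  depend on \<open>F\<close> up to isomorphism. Resolutions by finitely generated free modules exist for
  finitely generated modules over a Noetherian ring, and only in such cases is \<open>tor\<close> meaningful.
\<close>

definition tor ::
    "('a, 'm) ring_scheme \<Rightarrow> ('a, 'b, 'p) module_scheme \<Rightarrow> ('a, 'c, 'q) module_scheme
      \<Rightarrow> nat \<Rightarrow> ('a, (nat \<Rightarrow> 'c) set) module" where
  "tor R M N i =
     (let (b, D) = (SOME (b, D). \<exists>e. is_free_resolution R M b D e)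
      in homology_module R N b D i)"

definition restrict_scalars ::
    "('s \<Rightarrow> 'a) \<Rightarrow> ('a, 'b, 'm) module_scheme \<Rightarrow> ('s, 'b) module" where
  "restrict_scalars \<phi> M =
     \<lparr> carrier = carrier M, mult = mult M, one = one M, zero = zero M, add = add M,
       smult = (\<lambda>c. smult M (\<phi> c)) \<rparr>"

definition tor_dim :: "'k::field itself \<Rightarrow> nat \<Rightarrow> nat \<Rightarrow> nat" where
  "tor_dim _ n i =
     vectorspace.dim (class_ring :: 'k ring)
       (restrict_scalars scalar (tor (dirichlet_ring n) residue_module residue_module i))"

definition poincare_betti :: "'k::field itself \<Rightarrow> nat \<Rightarrow> rat fps" where
  "poincare_betti K n = Abs_fps (\<lambda>i. of_nat (tor_dim K n i))"

end

(*
  The standard basis a = 1, ..., n of A = dirichlet_ring n multiplies like the integers, products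
  above n being 0; the primes p <= n generate the maximal ideal.  On the Koszul complex, with basis
  a e_S (S a set of primes), matching a e_S with (a/q) e_{S + q}, where q is the least prime
  dividing a or lying in S, is a contraction up to the cycles z = m e_T such that every prime factor
  of m is >= min T and m <= n < m min T.  These cycles represent a basis of the Koszul homology,
  and the product of any two of them is 0, because m m' > n.  Hence Koszul * (tensor algebra on
  the z) with differential d(k|z1|z2|...) = dk|z1|z2|... + (k z1)|z2|... is a complex; an induction
  on the degree shows that it resolves K, and it is visibly minimal.  Its ranks give
  P (1 - t^2 sum_p c_p (1+t)^{#primes > p}) = (1+t)^r, where c_p counts the m belonging to
  min T = p.  Dividing m by its p-part shows that c_p is also the number of b <= n all of whose
  prime factors exceed p.  If the prime after p has square > n, then c_p = 1 + #(primes > p), and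
  these terms add up to a telescoping sum, which produces the cancelled power of 1 + t.
*)

theory Submission
  imports Defs "HOL-Library.Function_Algebras"
begin

section \<open>The Koszul complex\<close>

text \<open>\<open>tor\<close> uses an arbitrarily chosen resolution, so a minimal one gives the
  answer only after comparison with every other; maps, homotopies and exactness are therefore
  phrased with matrices over A. A pair (m, T) with p = min T is an Eliahou-Kervaire symbol: m p is
  the weight of a minimal generator of I_n with least prime p, the rest of T any set of larger
  primes. So c_p is C_{n,v} for p = p_v. The differential touches only the letter next to the Koszul
  factor, so chains split along the head of their words into chains of lower degree. These are exact
  by induction except for the class of 1, and that obstruction dies because no nonzero combination
  of the z is a Koszul boundary. Put u = 1 + t and M = pi(n) - ell_1(n). The last M primes
  contribute the sum of (k+1)(u-1)^2 u^k over k < M, which is 1 - (M+1)u^M + M u^(M+1). Subtracting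
  it from 1 leaves -u^M (M t - 1): the origin of h_0, of h_1 and of the cancelled power. At t = -1
  the quotient is -1-M plus, if earlier primes exist, c_p for the last of them; there c_p is at
  least M+2, as a square is counted.\<close>

definition sgn_in :: "nat \<Rightarrow> nat set \<Rightarrow> 'k::comm_ring_1" where
  "sgn_in p S = (-1) ^ card {s \<in> S. s < p}"

text \<open>The factors \<open>sgn_in s T\<close> count the pairs t < s, that is, the inversions
  that sort e_S e_T. The extra minus sign for every s produces the twist (-1)^|S|.\<close>

definition shuffle_sgn :: "nat set \<Rightarrow> nat set \<Rightarrow> 'k::comm_ring_1" where
  "shuffle_sgn S T = (\<Prod>s\<in>S. - sgn_in s T)"

lemma sgn_in_insert:
  assumes "finite S" "q \<notin> S"
  shows "sgn_in p (insert q S) = (if q < p then - sgn_in p S else sgn_in p S)"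
proof -
  have "{s \<in> insert q S. s < p} = (if q < p then insert q {s \<in> S. s < p} else {s \<in> S. s < p})"
    by auto
  then show ?thesis
    using assms by (simp add: sgn_in_def)
qed

lemma sgn_in_Un:
  assumes "finite S" "finite T" "S \<inter> T = {}"
  shows "sgn_in p (S \<union> T) = sgn_in p S * sgn_in p T"
proof -
  have eq: "{s \<in> S \<union> T. s < p} = {s \<in> S. s < p} \<union> {s \<in> T. s < p}" by auto
  have "card {s \<in> S \<union> T. s < p} = card {s \<in> S. s < p} + card {s \<in> T. s < p}"
    unfolding eq using assms by (intro card_Un_disjoint) auto
  then show ?thesis by (simp add: sgn_in_def power_add)
qed

lemma sgn_in_least: "(\<And>s. s \<in> S \<Longrightarrow> p \<le> s) \<Longrightarrow> sgn_in p S = 1"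
proof -
  assume "\<And>s. s \<in> S \<Longrightarrow> p \<le> s"
  then have "{s \<in> S. s < p} = {}" by (auto simp: not_less)
  then show ?thesis
    unfolding sgn_in_def by (simp only: card.empty power_0)
qed

lemma shuffle_sgn_insert:
  "finite S \<Longrightarrow> p \<notin> S \<Longrightarrow> shuffle_sgn (insert p S) T = - sgn_in p T * shuffle_sgn S T"
  by (simp add: shuffle_sgn_def)

context
  fixes n :: nat
begin

definition primes_le :: "nat set" where
  "primes_le = {p. prime p \<and> p \<le> n}"

definition golod_gens :: "(nat \<times> nat set) set" where
  "golod_gens = {(m, T). T \<noteq> {} \<and> T \<subseteq> primes_le \<and> m \<in> {1..n} \<and>
     (\<forall>q. prime q \<and> q dvd m \<longrightarrow> Min T \<le> q) \<and> n < m * Min T}"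

text \<open>A chain \<open>f\<close> stands for \<open>\<Sum> f S a \<cdot> a e\<^sub>S\<close>, and \<open>(m, T) \<in> golod_gens\<close> for the Koszul cycle \<open>m e\<^sub>T\<close>;
  \<open>cycle_mult\<close> is right multiplication by this cycle, twisted by the sign \<open>(-1)\<^sup>|\<^sup>S\<^sup>|\<close> on \<open>e\<^sub>S\<close> that makes
  it anticommute with \<open>koszul_d\<close>.\<close>

definition koszul_d :: "(nat set \<Rightarrow> nat \<Rightarrow> 'k::field_char_0) \<Rightarrow> nat set \<Rightarrow> nat \<Rightarrow> 'k" where
  "koszul_d f S a = (if a \<le> n then
     (\<Sum>p \<in> {p \<in> primes_le. p \<notin> S \<and> p dvd a}. sgn_in p S * f (insert p S) (a div p)) else 0)"

definition cycle_mult :: "nat \<times> nat set \<Rightarrow> (nat set \<Rightarrow> nat \<Rightarrow> 'k::field_char_0) \<Rightarrow> nat set \<Rightarrow> nat \<Rightarrow> 'k" where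
  "cycle_mult w f S a = (if a \<le> n \<and> snd w \<subseteq> S \<and> fst w dvd a
     then shuffle_sgn (S - snd w) (snd w) * f (S - snd w) (a div fst w) else 0)"

text \<open>In terms of cells, (b Min U) e_{U - Min U} is sent to b e_U. The side conditions say
  that Min U is the least prime of the source cell and that this cell is not truncated away.\<close>

definition contract :: "(nat set \<Rightarrow> nat \<Rightarrow> 'k::field_char_0) \<Rightarrow> nat set \<Rightarrow> nat \<Rightarrow> 'k" where
  "contract f U b = (if U \<noteq> {} \<and> U \<subseteq> primes_le \<and> b * Min U \<le> n \<and> (\<forall>q. prime q \<and> q dvd b \<longrightarrow> Min U \<le> q)
     then f (U - {Min U}) (b * Min U) else 0)"

definition ksupp :: "(nat set \<Rightarrow> nat \<Rightarrow> 'k::field_char_0) \<Rightarrow> bool" where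
  "ksupp f \<longleftrightarrow> (\<forall>S a. f S a \<noteq> 0 \<longrightarrow> S \<subseteq> primes_le \<and> a \<in> {1..n})"

definition gsupp :: "(nat set \<Rightarrow> nat \<Rightarrow> 'k::field_char_0) \<Rightarrow> bool" where
  "gsupp f \<longleftrightarrow> (\<forall>S a. f S a \<noteq> 0 \<longrightarrow> (a, S) \<in> golod_gens)"

section \<open>Size estimates for the Golod generators\<close>

lemma finite_primes_le [simp, intro]: "finite primes_le"
  by (rule finite_subset[of _ "{..n}"]) (auto simp: primes_le_def)

lemma finite_golod_gens [simp, intro]: "finite golod_gens"
  by (rule finite_subset[of _ "{1..n} \<times> Pow primes_le"]) (auto simp: golod_gens_def)

lemma golod_gensD:
  assumes "(m, T) \<in> golod_gens"
  shows "finite T" "Min T \<in> T" "T \<subseteq> primes_le" "1 \<le> m" "m \<le> n" "T \<noteq> {}" "n < m * Min T"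
    "\<And>q. prime q \<Longrightarrow> q dvd m \<Longrightarrow> Min T \<le> q" "1 < m"
proof -
  show *: "T \<subseteq> primes_le" "1 \<le> m" "m \<le> n" "T \<noteq> {}" "n < m * Min T"
    "\<And>q. prime q \<Longrightarrow> q dvd m \<Longrightarrow> Min T \<le> q"
    using assms by (auto simp: golod_gens_def)
  show fin: "finite T" by (rule finite_subset[OF *(1)]) auto
  show Min: "Min T \<in> T" by (rule Min_in) (use fin * in auto)
  then have "Min T \<le> n"
    using * by (auto simp: primes_le_def)
  then show "1 < m"
    using * by (cases "m = 1") auto
qed

lemma golod_mult_gt:
  assumes "(m, T) \<in> golod_gens" "p \<in> T"
  shows "n < m * p"
proof -
  have "Min T \<le> p"
    using golod_gensD(1)[OF assms(1)] assms(2) by auto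
  then show ?thesis
    using golod_gensD(7)[OF assms(1)] by (meson less_le_trans mult_le_mono2)
qed

text \<open>Order the two pairs so that Min X \<le> Min Y. A prime factor of y is at least Min Y, so
  y \<ge> Min X and x y \<ge> x Min X > n. This is the vanishing of products on which the Golod
  construction rests.\<close>

lemma golod_gens_mult_gt:
  assumes "(m, T) \<in> golod_gens" "(m', T') \<in> golod_gens"
  shows "n < m * m'"
proof -
  have *: "n < x * y" if x: "(x, X) \<in> golod_gens" and y: "(y, Y) \<in> golod_gens" and le: "Min X \<le> Min Y"
    for x y X Y
  proof -
    have "1 < y" by (rule golod_gensD(9)[OF y])
    then obtain q where q: "prime q" "q dvd y"
      using prime_factor_nat[of y] by auto
    then have "Min X \<le> y"
      using golod_gensD(8)[OF y q] le dvd_imp_le[OF q(2)] \<open>1 < y\<close> by linarith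
    then show ?thesis
      using golod_gensD(7)[OF x] by (meson less_le_trans mult_le_mono2)
  qed
  show ?thesis
    using *[OF assms] *[OF assms(2,1)] by (cases "Min T \<le> Min T'") (auto simp: mult.commute)
qed

section \<open>Linearity of the operators; the Koszul differential squares to zero\<close>

lemma koszul_d_add: "koszul_d (f + g) = koszul_d f + koszul_d g"
  by (auto simp: fun_eq_iff koszul_d_def distrib_left sum.distrib)

lemma koszul_d_diff: "koszul_d (f - g) = koszul_d f - koszul_d g"
  by (auto simp: fun_eq_iff koszul_d_def right_diff_distrib sum_subtractf)

lemma koszul_d_zero [simp]: "koszul_d 0 = 0" "koszul_d (\<lambda>S a. 0) = 0"
  by (auto simp: fun_eq_iff koszul_d_def)

lemma koszul_d_at_1: "koszul_d f S 1 = 0"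
proof -
  have "{p \<in> primes_le. p \<notin> S \<and> p dvd 1} = {}" by (auto simp: primes_le_def)
  then show ?thesis
    unfolding koszul_d_def by (simp only: sum.empty if_cancel)
qed

lemma cycle_mult_add: "cycle_mult w (f + g) = cycle_mult w f + cycle_mult w g"
  by (auto simp: fun_eq_iff cycle_mult_def distrib_left)

lemma cycle_mult_diff: "cycle_mult w (f - g) = cycle_mult w f - cycle_mult w g"
  by (auto simp: fun_eq_iff cycle_mult_def right_diff_distrib)

lemma cycle_mult_zero [simp]: "cycle_mult w 0 = 0" "cycle_mult w (\<lambda>S a. 0) = 0"
  by (auto simp: fun_eq_iff cycle_mult_def)

lemma contract_zero [simp]: "contract 0 = 0" by (auto simp: fun_eq_iff contract_def)

lemma sum_swap_antisym:
  fixes F :: "'a \<Rightarrow> 'a \<Rightarrow> 'k::field_char_0"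
  assumes "\<And>p q. p \<in> A \<Longrightarrow> q \<in> A \<Longrightarrow> F p q = - F q p"
  shows "(\<Sum>p\<in>A. \<Sum>q\<in>A. F p q) = 0"
proof -
  have "(\<Sum>p\<in>A. \<Sum>q\<in>A. F p q) = (\<Sum>p\<in>A. \<Sum>q\<in>A. - F q p)"
    by (intro sum.cong refl assms)
  also have "\<dots> = - (\<Sum>p\<in>A. \<Sum>q\<in>A. F q p)" by (simp add: sum_negf)
  also have "(\<Sum>p\<in>A. \<Sum>q\<in>A. F q p) = (\<Sum>p\<in>A. \<Sum>q\<in>A. F p q)"
    by (rule sum.swap)
  finally show ?thesis by simp
qed

lemma koszul_d_koszul_d: 
  assumes "finite S" 
  shows "koszul_d (koszul_d f) S a = 0"
proof (cases "a \<le> n")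
  case True
  define B where "B = {p \<in> primes_le. p \<notin> S \<and> p dvd a}"
  \<comment> \<open>Extension by zero to all of B \<times> B makes the double sum antisymmetric:
    inserting p and q in the other order changes the sign.\<close>
  define F where "F p q = (if p \<noteq> q \<and> p * q dvd a
     then sgn_in p S * (sgn_in q (insert p S) * f (insert q (insert p S)) (a div (p * q))) else 0)" for p q
  have finB: "finite B"
    unfolding B_def by (rule finite_subset[of _ primes_le]) auto
  have "koszul_d (koszul_d f) S a = (\<Sum>p\<in>B. sgn_in p S * koszul_d f (insert p S) (a div p))"
    using True by (simp add: koszul_d_def B_def)
  also have "\<dots> = (\<Sum>p\<in>B. \<Sum>q\<in>B. F p q)"
  proof (rule sum.cong[OF refl])
    fix p assume p: "p \<in> B"
    then have pp: "p dvd a" "p > 0" by (auto simp: B_def primes_le_def prime_gt_0_nat)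
    have le: "a div p \<le> n"
      using True by (meson div_le_dividend order_trans)
    have eq: "{q \<in> primes_le. q \<notin> insert p S \<and> q dvd a div p} = {q \<in> B. p \<noteq> q \<and> p * q dvd a}"
      using pp by (auto simp: B_def dvd_div_iff_mult mult.commute intro: dvd_mult_left dvd_mult_right)
    have "sgn_in p S * koszul_d f (insert p S) (a div p) = (\<Sum>q \<in> {q \<in> B. p \<noteq> q \<and> p * q dvd a}.
        sgn_in p S * (sgn_in q (insert p S) * f (insert q (insert p S)) (a div (p * q))))"
      using le eq by (simp add: koszul_d_def sum_distrib_left div_mult2_eq)
    also have "\<dots> = (\<Sum>q \<in> B. F p q)"
      unfolding F_def using finB by (rule sum.inter_filter)
    finally show "sgn_in p S * koszul_d f (insert p S) (a div p) = (\<Sum>q \<in> B. F p q)" .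
  qed
  also have "\<dots> = 0"
  proof (rule sum_swap_antisym)
    fix p q assume "p \<in> B" "q \<in> B"
    then have "p \<notin> S" "q \<notin> S" by (auto simp: B_def)
    then show "F p q = - F q p"
      using assms by (auto simp: F_def sgn_in_insert mult.commute insert_commute)
  qed
  finally show ?thesis .
qed (auto simp: koszul_d_def)

lemma finite_primes_le_subset: "S \<subseteq> primes_le \<Longrightarrow> finite S"
  by (rule finite_subset) auto

lemma ksupp_koszul_d: "ksupp f \<Longrightarrow> ksupp (koszul_d f)"
  unfolding ksupp_def
proof safe
  fix S a x
  assume f: "\<forall>S a. f S a \<noteq> 0 \<longrightarrow> S \<subseteq> primes_le \<and> a \<in> {1..n}" and nz: "koszul_d f S a \<noteq> 0"
  then obtain p where p: "p \<in> primes_le" "p dvd a" "f (insert p S) (a div p) \<noteq> 0" "a \<le> n"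
    by (auto simp: koszul_d_def split: if_splits elim!: sum.not_neutral_contains_not_neutral)
  then have *: "insert p S \<subseteq> primes_le" "a div p \<in> {1..n}"
    using f by blast+
  then show "x \<in> S \<Longrightarrow> x \<in> primes_le" by auto
  show "a \<in> {1..n}"
    using * p by (cases a) auto
qed

lemma koszul_d_koszul_d_supp:
  assumes "ksupp f"
  shows "koszul_d (koszul_d f) = 0"
proof (intro ext)
  fix S a
  show "koszul_d (koszul_d f) S a = 0 S a"
  proof (cases "finite S")
    case True
    then show ?thesis by (simp add: koszul_d_koszul_d)
  next
    case False
    then have "\<not> S \<subseteq> primes_le"
      using finite_primes_le_subset by blast
    then show ?thesis
      using ksupp_koszul_d[OF ksupp_koszul_d[OF assms]] by (auto simp: ksupp_def)
  qed
qed

text \<open>The differential of m e_T has coefficients m p with p in T, and all of these exceed n by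
  \<open>golod_mult_gt\<close>.\<close>

lemma koszul_d_gsupp:
  assumes "gsupp f"
  shows "koszul_d f = 0"
proof (intro ext)
  fix S a
  show "koszul_d f S a = 0 S a"
  proof (rule ccontr)
    assume "koszul_d f S a \<noteq> 0 S a"
    then obtain p where p: "p \<in> primes_le" "p dvd a" "f (insert p S) (a div p) \<noteq> 0" "a \<le> n"
      by (auto simp: koszul_d_def split: if_splits elim!: sum.not_neutral_contains_not_neutral)
    then have "(a div p, insert p S) \<in> golod_gens"
      using assms by (auto simp: gsupp_def)
    then have "n < a div p * p" by (rule golod_mult_gt) auto
    then show False
      using p by simp
  qed
qed

text \<open>A Golod cell that is a source of the matching would have the form (b q, U - {q}) with q
  = Min U. As q divides b q, the roughness condition gives Min (U - {q}) \<le> q, although all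
  elements of U - {q} exceed q.\<close>

lemma contract_gsupp:
  assumes "gsupp f"
  shows "contract f = 0"
proof (intro ext)
  fix U b
  show "contract f U b = 0 U b"
  proof (rule ccontr)
    assume "contract f U b \<noteq> 0 U b"
    then have U: "U \<noteq> {}" "U \<subseteq> primes_le" "f (U - {Min U}) (b * Min U) \<noteq> 0"
      by (auto simp: contract_def split: if_splits)
    then have W: "(b * Min U, U - {Min U}) \<in> golod_gens"
      using assms by (auto simp: gsupp_def)
    have finU: "finite U"
      using U finite_primes_le_subset by blast
    have "Min U \<in> U"
      using U finU by auto
    then have "prime (Min U)"
      using U by (auto simp: primes_le_def)
    then have le: "Min (U - {Min U}) \<le> Min U"
      using golod_gensD(8)[OF W] by auto
    have "Min (U - {Min U}) \<in> U - {Min U}"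
      using golod_gensD(2)[OF W] .
    then have "Min U \<le> Min (U - {Min U})" "Min (U - {Min U}) \<noteq> Min U"
      using finU by (blast intro: Min_le, blast)
    then show False
      using le by simp
  qed
qed

section \<open>The contraction as a homotopy\<close>

lemma ksupp_contract: "ksupp f \<Longrightarrow> ksupp (contract f)"
  unfolding ksupp_def
proof (intro allI impI conjI)
  fix S a
  assume f: "\<forall>S a. f S a \<noteq> 0 \<longrightarrow> S \<subseteq> primes_le \<and> a \<in> {1..n}" and nz: "contract f S a \<noteq> 0"
  then have *: "S \<noteq> {}" "S \<subseteq> primes_le" "a * Min S \<le> n" "f (S - {Min S}) (a * Min S) \<noteq> 0"
    by (auto simp: contract_def split: if_splits)
  then show "S \<subseteq> primes_le" by simp
  have "a * Min S \<in> {1..n}"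
    using f * by blast
  then show "a \<in> {1..n}" by (cases a; cases "Min S") auto
qed

text \<open>A nonzero value would require Min S to be at most every prime divisor of a, in
  particular at most q.\<close>

lemma contract_least_notin:
  assumes "prime q" "q dvd a" "\<And>s. s \<in> S \<Longrightarrow> q < s"
  shows "contract f S a = 0"
proof (cases "S \<noteq> {} \<and> S \<subseteq> primes_le")
  case True
  then have "Min S \<in> S"
    using finite_primes_le_subset by auto
  then have "\<not> Min S \<le> q"
    using assms(3) by fastforce
  then show ?thesis
    using assms by (auto simp: contract_def)
qed (auto simp: contract_def)

text \<open>The matching removes the least prime dividing \<open>a\<close> or lying in \<open>S\<close> from one side and adds
  it to the other; it is undefined exactly on the unit cell and on \<open>golod_gens\<close>.\<close>

lemma contract_homotopy:
  assumes f: "ksupp f" and a: "a \<in> {1..n}" and S: "S \<subseteq> primes_le"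
    and nW: "(a, S) \<notin> golod_gens" and nunit: "(a, S) \<noteq> (1, {})"
  shows "koszul_d (contract f) S a + contract (koszul_d f) S a = f S a"
proof -
  have finS: "finite S"
    using S finite_primes_le_subset by blast
  have a_le: "a \<le> n" "a > 0"
    using a by auto
  define Q where "Q = {q. prime q \<and> q dvd a} \<union> S"
  have finQ: "finite Q"
    unfolding Q_def using finS a_le finite_prime_divisors[of a] by auto
  have Q_ne: "Q \<noteq> {}"
  proof (cases "S = {}")
    case True
    then have "a \<noteq> 1"
      using nunit by auto
    then show ?thesis
      using prime_factor_nat by (auto simp: Q_def)
  qed (auto simp: Q_def)
  define q where "q = Min Q"
  have qQ: "q \<in> Q"
    unfolding q_def using finQ Q_ne by simp
  have q_le: "\<And>x. x \<in> Q \<Longrightarrow> q \<le> x"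
    unfolding q_def using finQ by simp
  have pq: "prime q"
    using qQ S by (auto simp: Q_def primes_le_def)
  have q_div: "\<And>p. prime p \<Longrightarrow> p dvd a \<Longrightarrow> q \<le> p" and q_S: "\<And>s. s \<in> S \<Longrightarrow> q \<le> s"
    using q_le by (auto simp: Q_def)
  have P_q: "q \<in> primes_le"
    using qQ S a_le by (auto simp: Q_def primes_le_def dest: dvd_imp_le)
  define B where "B = {p \<in> primes_le. p \<notin> S \<and> p dvd a}"
  have finB: "finite B"
    unfolding B_def by (rule finite_subset[of _ primes_le]) auto
  have kdB: "koszul_d g S a = (\<Sum>p\<in>B. sgn_in p S * g (insert p S) (a div p))" for g :: "nat set \<Rightarrow> nat \<Rightarrow> 'a"
    using a_le by (simp add: koszul_d_def B_def)
  show ?thesis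
  proof (cases "q \<in> S")
    case False
    then have q_dvd: "q dvd a"
      using qQ by (auto simp: Q_def)
    \<comment> \<open>Here (a, S) is a source of the matching and not a target. In the other
      composite only p = q survives: for p \<noteq> q the prime q still divides
      \<open>a div p\<close> and lies below \<open>insert p S\<close>.\<close>
    have "contract (koszul_d f) S a = 0"
      by (rule contract_least_notin[OF pq q_dvd]) (use q_S False in \<open>metis le_neq_implies_less\<close>)
    moreover have "koszul_d (contract f) S a = (\<Sum>p\<in>{q}. sgn_in p S * contract f (insert p S) (a div p))"
      unfolding kdB
    proof (rule sum.mono_neutral_right[OF finB])
      show "{q} \<subseteq> B"
        using P_q False q_dvd by (auto simp: B_def)
      show "\<forall>p\<in>B - {q}. sgn_in p S * contract f (insert p S) (a div p) = 0"
      proof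
        fix p assume p: "p \<in> B - {q}"
        then have pp: "prime p" "p dvd a" "p \<noteq> q" by (auto simp: B_def primes_le_def)
        have "q dvd p * (a div p)"
          using pp q_dvd by simp
        moreover have "\<not> q dvd p"
          using pp pq primes_dvd_imp_eq by blast
        ultimately have "q dvd a div p"
          using pq by (simp add: prime_dvd_mult_iff)
        moreover have "q < s" if "s \<in> insert p S" for s
          using that q_S[of s] q_div[OF pp(1,2)] pp(3) False by (cases "s = q") auto
        ultimately have "contract f (insert p S) (a div p) = 0"
          by (intro contract_least_notin[OF pq])
        then show "sgn_in p S * contract f (insert p S) (a div p) = 0" by simp
      qed
    qed
    moreover have "contract f (insert q S) (a div q) = f S a"
    proof -
      have Min: "Min (insert q S) = q"
        using finS q_S by (intro Min_eqI) auto
      have "\<forall>p. prime p \<and> p dvd a div q \<longrightarrow> q \<le> p"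
        using q_div q_dvd by (metis dvd_div_mult_self dvd_mult2)
      then show ?thesis
        using Min q_dvd a_le False P_q S by (simp add: contract_def)
    qed
    moreover have "sgn_in q S = (1 :: 'a)"
      using q_S by (rule sgn_in_least)
    ultimately show ?thesis by simp
  next
    case True
    have Min: "Min S = q"
      using finS q_S True by (intro Min_eqI) auto
    define S' where "S' = S - {q}"
    have S': "S = insert q S'" "q \<notin> S'" "finite S'"
      using True finS by (auto simp: S'_def)
    \<comment> \<open>All other conditions for (a, S) to be a Golod cell hold, with q = Min S, so
      \<open>nW\<close> can only mean that this inequality is true.\<close>
    have "a * q \<le> n"
      using nW True S a q_div Min by (auto simp: golod_gens_def not_less)
    then have "contract (koszul_d f) S a = koszul_d f S' (a * q)"
      using True S q_div Min by (auto simp: contract_def S'_def)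
    also have "\<dots> = (\<Sum>p\<in>{p \<in> primes_le. p \<notin> S' \<and> p dvd a * q}. sgn_in p S' * f (insert p S') (a * q div p))"
      using \<open>a * q \<le> n\<close> by (simp add: koszul_d_def)
    also have "{p \<in> primes_le. p \<notin> S' \<and> p dvd a * q} = insert q B"
      using S' pq P_q by (auto simp: B_def prime_dvd_mult_iff primes_le_def dest: primes_dvd_imp_eq)
    also have "(\<Sum>p\<in>insert q B. sgn_in p S' * f (insert p S') (a * q div p)) =
        sgn_in q S' * f S a + (\<Sum>p\<in>B. sgn_in p S' * f (insert p S') (a * q div p))"
    proof -
      have "q \<notin> B"
        using True by (auto simp: B_def)
      then show ?thesis
        using finB pq S' by (simp add: prime_gt_0_nat)
    qed
    also have "sgn_in q S' = (1 :: 'a)"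
      using q_S by (intro sgn_in_least) (auto simp: S'_def)
    \<comment> \<open>The remaining sum cancels against \<open>koszul_d (contract f)\<close>: since
      q < p, counting q among the elements of S below p reverses the sign.\<close>
    finally have 1: "contract (koszul_d f) S a = f S a + (\<Sum>p\<in>B. sgn_in p S' * f (insert p S') (a * q div p))"
      by simp
    have "koszul_d (contract f) S a = (\<Sum>p\<in>B. - sgn_in p S' * f (insert p S') (a * q div p))"
      unfolding kdB
    proof (rule sum.cong[OF refl])
      fix p assume p: "p \<in> B"
      then have pp: "prime p" "p dvd a" "p \<notin> S" "p \<in> primes_le"
        by (auto simp: B_def primes_le_def)
      have "q < p"
        using q_div[OF pp(1,2)] pp(3) True by (cases "p = q") auto
      then have sg: "sgn_in p S = (- sgn_in p S' :: 'a)"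
        using S' by (simp add: sgn_in_insert)
      have Minp: "Min (insert p S) = q"
        using finS q_S True \<open>q < p\<close> by (intro Min_eqI) auto
      have le: "a div p * q \<le> n"
        using \<open>a * q \<le> n\<close> by (meson div_le_dividend mult_le_mono1 order_trans)
      have "\<forall>r. prime r \<and> r dvd a div p \<longrightarrow> q \<le> r"
        using q_div pp(2) by (metis dvd_div_mult_self dvd_mult2)
      then have "contract f (insert p S) (a div p) = f (insert p S - {q}) (a div p * q)"
        using Minp le pp S by (simp add: contract_def)
      also have "insert p S - {q} = insert p S'"
        using \<open>q < p\<close> by (auto simp: S'_def)
      also have "a div p * q = a * q div p"
        using pp by (metis div_mult_swap mult.commute)
      finally show "sgn_in p S * contract f (insert p S) (a div p)
          = - sgn_in p S' * f (insert p S') (a * q div p)" by (simp add: sg)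
    qed
    then show ?thesis
      unfolding 1 by (simp add: sum_negf)
  qed
qed

text \<open>Up to the homotopy every chain is a combination of Golod cycles, so these span the
  Koszul homology apart from the class of 1; \<open>f1\<close> excludes that class.\<close>

lemma gsupp_residue:
  assumes f: "ksupp f" and f1: "f {} 1 = 0"
  shows "gsupp (f - koszul_d (contract f) - contract (koszul_d f))"
  unfolding gsupp_def
proof (intro allI impI)
  fix S a
  assume nz: "(f - koszul_d (contract f) - contract (koszul_d f)) S a \<noteq> 0"
  have supp: "ksupp (koszul_d (contract f))" "ksupp (contract (koszul_d f))"
    using f ksupp_koszul_d ksupp_contract by blast+
  have in_supp: "S \<subseteq> primes_le \<and> a \<in> {1..n}"
  proof (rule ccontr)
    assume "\<not> (S \<subseteq> primes_le \<and> a \<in> {1..n})"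
    then have "f S a = 0" "koszul_d (contract f) S a = 0" "contract (koszul_d f) S a = 0"
      using f supp unfolding ksupp_def by blast+
    then show False
      using nz by simp
  qed
  show "(a, S) \<in> golod_gens"
  proof (rule ccontr)
    assume nW: "(a, S) \<notin> golod_gens"
    show False
    proof (cases "(a, S) = (1, {})")
      case True
      have "koszul_d (contract f) {} 1 = 0" by (rule koszul_d_at_1)
      moreover have "contract (koszul_d f) {} 1 = 0" by (simp add: contract_def)
      ultimately show False
        using nz f1 True by simp
    next
      case False
      then show False
        using contract_homotopy[OF f _ _ nW False] in_supp nz by (simp add: algebra_simps)
    qed
  qed
qed

text \<open>Independence of the Golod cycles in homology. With h the contraction, h g = 0, so f - d
  h f is a combination of cycles by \<open>gsupp_residue\<close>. Applying d to it gives 0, and also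
  d f = g because d d = 0.\<close>

lemma golod_koszul_d_boundary_zero:
  assumes f: "ksupp f" and g: "gsupp g" and eq: "koszul_d f = g" and f1: "f {} 1 = 0"
  shows "g = 0"
proof -
  have "gsupp (f - koszul_d (contract f) - contract (koszul_d f))" by (rule gsupp_residue[OF f f1])
  then have "koszul_d (f - koszul_d (contract f) - contract (koszul_d f)) = 0"
    by (rule koszul_d_gsupp)
  moreover have "contract (koszul_d f) = 0"
    unfolding eq by (rule contract_gsupp[OF g])
  moreover have "koszul_d (koszul_d (contract f)) = 0"
    by (rule koszul_d_koszul_d_supp[OF ksupp_contract[OF f]])
  ultimately show ?thesis
    using eq by (simp add: koszul_d_diff)
qed

end


section \<open>The Golod complex\<close>

lemma sum_fun_apply: "(\<Sum>i\<in>A. f i) x = (\<Sum>i\<in>A. f i x)"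
  by (induction A rule: infinite_finite_induct) auto

text \<open>The Koszul degree of m e_T is |T|; a letter of the tensor algebra is shifted up by
  one.\<close>

definition gen_degree :: "nat \<times> nat set \<Rightarrow> nat" where
  "gen_degree w = Suc (card (snd w))"

definition kunit :: "'k::field_char_0 \<Rightarrow> nat set \<Rightarrow> nat \<Rightarrow> 'k" where
  "kunit c S a = (if S = {} \<and> a = 1 then c else 0)"

lemma kunit_zero [simp]: "kunit 0 = 0" by (simp add: fun_eq_iff kunit_def)

context
  fixes n :: nat
begin

definition kchain :: "nat \<Rightarrow> (nat set \<Rightarrow> nat \<Rightarrow> 'k::field_char_0) \<Rightarrow> bool" where
  "kchain e f \<longleftrightarrow> (\<forall>S a. f S a \<noteq> 0 \<longrightarrow> S \<subseteq> primes_le n \<and> a \<in> {1..n} \<and> card S = e)"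

text \<open>\<open>g ws\<close> is the Koszul factor of the word \<open>ws\<close> of cycles. The last letter of \<open>ws\<close> is the one
  next to the Koszul factor, so the differential leaves the head of \<open>ws\<close> alone.\<close>

definition golod_d :: "((nat \<times> nat set) list \<Rightarrow> nat set \<Rightarrow> nat \<Rightarrow> 'k::field_char_0)
    \<Rightarrow> (nat \<times> nat set) list \<Rightarrow> nat set \<Rightarrow> nat \<Rightarrow> 'k" where
  "golod_d g ws = koszul_d n (g ws) + (\<Sum>w\<in>golod_gens n. cycle_mult n w (g (ws @ [w])))"

text \<open>The A-basis of the Golod complex in degree e: a word of cycles together with a Koszul
  basis element e_S.\<close>

definition cells :: "nat \<Rightarrow> ((nat \<times> nat set) list \<times> nat set) set" where
  "cells e = {(ws, S). ws \<in> lists (golod_gens n) \<and> S \<subseteq> primes_le n \<and>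
     card S + sum_list (map gen_degree ws) = e}"

definition gchain :: "nat \<Rightarrow> ((nat \<times> nat set) list \<Rightarrow> nat set \<Rightarrow> nat \<Rightarrow> 'k::field_char_0) \<Rightarrow> bool" where
  "gchain e g \<longleftrightarrow> (\<forall>ws S a. g ws S a \<noteq> 0 \<longrightarrow> (ws, S) \<in> cells e \<and> a \<in> {1..n})"

lemma gchainD: "gchain e g \<Longrightarrow> g ws S a \<noteq> 0 \<Longrightarrow> (ws, S) \<in> cells e \<and> a \<in> {1..n}"
  unfolding gchain_def by blast

lemma gchain_ksupp: "gchain e g \<Longrightarrow> ksupp n (g ws)"
  unfolding gchain_def ksupp_def cells_def by blast

section \<open>Supports and degrees\<close>

lemma koszul_d_nonzeroE:
  assumes "koszul_d n f S a \<noteq> 0"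
  obtains p where "p \<in> primes_le n" "p \<notin> S" "p dvd a" "f (insert p S) (a div p) \<noteq> 0" "a \<le> n"
proof -
  have le: "a \<le> n"
    using assms by (auto simp: koszul_d_def split: if_splits)
  have "(\<Sum>p \<in> {p \<in> primes_le n. p \<notin> S \<and> p dvd a}. sgn_in p S * f (insert p S) (a div p)) \<noteq> 0"
    using assms le by (simp add: koszul_d_def)
  then obtain p where "p \<in> {p \<in> primes_le n. p \<notin> S \<and> p dvd a}" "sgn_in p S * f (insert p S) (a div p) \<noteq> 0"
    by (rule sum.not_neutral_contains_not_neutral)
  then show thesis
    using le by (intro that[of p]) auto
qed

lemma cycle_mult_nonzeroE:
  assumes "cycle_mult n (m, T) f S a \<noteq> 0"
  shows "a \<le> n" "T \<subseteq> S" "m dvd a" "f (S - T) (a div m) \<noteq> 0"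
  using assms by (auto simp: cycle_mult_def split: if_splits)

lemma kchain_koszul_d: "kchain (Suc e) f \<Longrightarrow> kchain e (koszul_d n f)"
  unfolding kchain_def
proof (intro allI impI)
  fix S a
  assume f: "\<forall>S a. f S a \<noteq> 0 \<longrightarrow> S \<subseteq> primes_le n \<and> a \<in> {1..n} \<and> card S = Suc e"
    and nz: "koszul_d n f S a \<noteq> 0"
  from nz obtain p where p: "p \<in> primes_le n" "p \<notin> S" "p dvd a" "f (insert p S) (a div p) \<noteq> 0" "a \<le> n"
    by (rule koszul_d_nonzeroE)
  then have *: "insert p S \<subseteq> primes_le n" "a div p \<in> {1..n}" "card (insert p S) = Suc e"
    using f by blast+
  then have "finite S"
    using finite_primes_le_subset by blast
  then show "S \<subseteq> primes_le n \<and> a \<in> {1..n} \<and> card S = e"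
    using * p by (cases a) auto
qed

lemma kchain_contract: "kchain e f \<Longrightarrow> kchain (Suc e) (contract n f)"
  unfolding kchain_def
proof (intro allI impI)
  fix S a
  assume f: "\<forall>S a. f S a \<noteq> 0 \<longrightarrow> S \<subseteq> primes_le n \<and> a \<in> {1..n} \<and> card S = e" and nz: "contract n f S a \<noteq> 0"
  then have *: "S \<noteq> {}" "S \<subseteq> primes_le n" "a * Min S \<le> n" "f (S - {Min S}) (a * Min S) \<noteq> 0"
    by (auto simp: contract_def split: if_splits)
  have fin: "finite S"
    using * finite_primes_le_subset by blast
  have "a * Min S \<in> {1..n}" "card (S - {Min S}) = e"
    using f * by blast+
  moreover have "card S = Suc (card (S - {Min S}))"
    using fin * by (metis Min_in card.remove)
  ultimately show "S \<subseteq> primes_le n \<and> a \<in> {1..n} \<and> card S = Suc e"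
    using * by (cases a; cases "Min S") auto
qed

lemma kchain_diff: "kchain e f \<Longrightarrow> kchain e g \<Longrightarrow> kchain e (f - g)"
  unfolding kchain_def by (metis (no_types, lifting) diff_zero fun_diff_def)

lemma koszul_d_sum: "koszul_d n (\<Sum>i\<in>A. f i) = (\<Sum>i\<in>A. koszul_d n (f i))"
proof (induction A rule: infinite_finite_induct)
  case (insert x A)
  show ?case
    unfolding sum.insert[OF insert(1,2)] koszul_d_add insert(3) ..
qed (simp_all only: sum.infinite sum.empty koszul_d_zero not_False_eq_True)

lemma cycle_mult_sum: "cycle_mult n w (\<Sum>i\<in>A. f i) = (\<Sum>i\<in>A. cycle_mult n w (f i))"
proof (induction A rule: infinite_finite_induct)
  case (insert x A)
  show ?case
    unfolding sum.insert[OF insert(1,2)] cycle_mult_add insert(3) ..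
qed (simp_all only: sum.infinite sum.empty cycle_mult_zero not_False_eq_True)

lemma cycle_mult_cycle_mult:
  assumes w: "w \<in> golod_gens n" "w' \<in> golod_gens n" and f: "ksupp n f"
  shows "cycle_mult n w (cycle_mult n w' f) = 0"
proof (intro ext)
  fix S a
  obtain m T m' T' where [simp]: "w = (m, T)" "w' = (m', T')" by (metis surj_pair)
  show "cycle_mult n w (cycle_mult n w' f) S a = 0 S a"
  proof (rule ccontr)
    assume "cycle_mult n w (cycle_mult n w' f) S a \<noteq> 0 S a"
    then have *: "a \<le> n" "m dvd a" "m' dvd a div m" "f (S - T - T') (a div m div m') \<noteq> 0"
      by (auto simp: cycle_mult_def split: if_splits)
    then have "m * m' dvd a"
      using w golod_gensD(4)[of m T n] by (simp add: dvd_div_iff_mult mult.commute)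
    moreover have "a > 0"
      using * f unfolding ksupp_def by (cases a) auto
    ultimately have "m * m' \<le> a" by (rule dvd_imp_le)
    then have "m * m' \<le> n"
      using *(1) by (rule order_trans)
    then show False
      using golod_gens_mult_gt[of m T n m' T'] w by simp
  qed
qed

text \<open>The Leibniz rule for k z: the term with dz drops out because z is a cycle, and the twist
  by (-1)^|S| turns commutation of d with z into anticommutation.\<close>

lemma koszul_d_cycle_mult:
  assumes w: "w \<in> golod_gens n" and f: "ksupp n f"
  shows "koszul_d n (cycle_mult n w f) = - cycle_mult n w (koszul_d n f)"
proof (intro ext)
  fix S a
  obtain m T where [simp]: "w = (m, T)" by (metis surj_pair)
  note W = golod_gensD[OF w[unfolded \<open>w = (m, T)\<close>]]
  show "koszul_d n (cycle_mult n w f) S a = (- cycle_mult n w (koszul_d n f)) S a"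
  proof (cases "a \<le> n \<and> a > 0 \<and> S \<subseteq> primes_le n")
    case False
    have "koszul_d n (cycle_mult n w f) S a = 0"
    proof (rule ccontr)
      assume "koszul_d n (cycle_mult n w f) S a \<noteq> 0"
      then obtain p where p: "p \<in> primes_le n" "cycle_mult n w f (insert p S) (a div p) \<noteq> 0" "a \<le> n"
        by (rule koszul_d_nonzeroE)
      then have "f (insert p S - T) (a div p div m) \<noteq> 0" "T \<subseteq> insert p S"
        using cycle_mult_nonzeroE[of m T f "insert p S" "a div p"] by simp_all
      then have "insert p S - T \<subseteq> primes_le n" "a div p div m \<in> {1..n}"
        using f unfolding ksupp_def by blast+
      then show False
        using False p W(3) \<open>T \<subseteq> insert p S\<close> by (cases a) auto
    qed
    moreover have "cycle_mult n w (koszul_d n f) S a = 0"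
    proof (rule ccontr)
      assume "cycle_mult n w (koszul_d n f) S a \<noteq> 0"
      then have *: "koszul_d n f (S - T) (a div m) \<noteq> 0" "a \<le> n" "T \<subseteq> S"
        using cycle_mult_nonzeroE[of m T "koszul_d n f" S a] by simp_all
      then have "S - T \<subseteq> primes_le n" "a div m \<in> {1..n}"
        using ksupp_koszul_d[OF f] unfolding ksupp_def by blast+
      then show False
        using False * W(3) by (cases a) auto
    qed
    ultimately show ?thesis by simp
  next
    case True
    then have a: "a \<le> n" "a > 0" and S: "S \<subseteq> primes_le n" "finite S"
      using finite_primes_le_subset by blast+
    define B where "B = {p \<in> primes_le n. p \<notin> S \<and> T \<subseteq> S \<and> m * p dvd a}"
    define F where "F p = sgn_in p S * (shuffle_sgn (insert p S - T) T * f (insert p S - T) (a div p div m))" for p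
    \<comment> \<open>Terms in which p comes from T belong to dz; they are truncated because m p >
      n.\<close>
    have not_in_T: "p \<notin> T" if "m * p dvd a" for p
    proof
      assume "p \<in> T"
      then have "n < m * p"
        using golod_mult_gt[of m T n p] w by simp
      moreover have "m * p \<le> a" by (rule dvd_imp_le[OF that a(2)])
      ultimately show False
        using a by simp
    qed
    have "koszul_d n (cycle_mult n w f) S a
        = (\<Sum>p \<in> {p \<in> primes_le n. p \<notin> S \<and> p dvd a}. sgn_in p S * cycle_mult n w f (insert p S) (a div p))"
      using a by (simp add: koszul_d_def)
    also have "\<dots> = (\<Sum>p \<in> B. F p)"
    proof (rule sum.mono_neutral_cong_right)
      show "finite {p \<in> primes_le n. p \<notin> S \<and> p dvd a}"
        by (rule finite_subset[of _ "primes_le n"]) auto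
      show "B \<subseteq> {p \<in> primes_le n. p \<notin> S \<and> p dvd a}"
        by (auto simp: B_def intro: dvd_mult_right)
      show "\<forall>p\<in>{p \<in> primes_le n. p \<notin> S \<and> p dvd a} - B. sgn_in p S * cycle_mult n w f (insert p S) (a div p) = 0"
      proof
        fix p assume p: "p \<in> {p \<in> primes_le n. p \<notin> S \<and> p dvd a} - B"
        have "cycle_mult n w f (insert p S) (a div p) = 0"
        proof (rule ccontr)
          assume "cycle_mult n w f (insert p S) (a div p) \<noteq> 0"
          then have *: "T \<subseteq> insert p S" "m dvd a div p"
            using cycle_mult_nonzeroE[of m T f "insert p S" "a div p"] by simp_all
          have "p > 0"
            using p by (auto simp: primes_le_def prime_gt_0_nat)
          then have "m * p dvd a"
            using p * by (simp add: dvd_div_iff_mult)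
          then show False
            using p * not_in_T[of p] by (auto simp: B_def)
        qed
        then show "sgn_in p S * cycle_mult n w f (insert p S) (a div p) = 0" by simp
      qed
      show "sgn_in p S * cycle_mult n w f (insert p S) (a div p) = F p" if "p \<in> B" for p
      proof -
        have "p > 0"
          using that by (auto simp: B_def primes_le_def prime_gt_0_nat)
        then have "m dvd a div p"
          using that by (auto simp: B_def intro: dvd_mult_right simp: dvd_div_iff_mult)
        moreover have "a div p \<le> n"
          using a by (meson div_le_dividend order_trans)
        ultimately show ?thesis
          using that by (auto simp: B_def F_def cycle_mult_def)
      qed
    qed
    finally have L: "koszul_d n (cycle_mult n w f) S a = (\<Sum>p \<in> B. F p)" .
    have R: "cycle_mult n w (koszul_d n f) S a = (\<Sum>p \<in> B. - F p)"
    proof (cases "T \<subseteq> S \<and> m dvd a")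
      case False
      then have "B = {}" by (auto simp: B_def intro: dvd_mult_left)
      then show ?thesis
        using False by (auto simp: cycle_mult_def)
    next
      case True
      have le: "a div m \<le> n"
        using a by (meson div_le_dividend order_trans)
      have eq: "{p \<in> primes_le n. p \<notin> S - T \<and> p dvd a div m} = B"
        using True W(4) not_in_T by (auto simp: B_def dvd_div_iff_mult mult.commute)
      have "cycle_mult n w (koszul_d n f) S a = (\<Sum>p \<in> B. shuffle_sgn (S - T) T *
          (sgn_in p (S - T) * f (insert p (S - T)) (a div m div p)))"
        using True a le eq by (simp add: cycle_mult_def koszul_d_def sum_distrib_left)
      also have "\<dots> = (\<Sum>p \<in> B. - F p)"
      proof (rule sum.cong[OF refl])
        fix p assume p: "p \<in> B"
        then have pT: "p \<notin> T" "p \<notin> S"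
          using not_in_T by (auto simp: B_def)
        have ins: "insert p S - T = insert p (S - T)"
          using pT by auto
        have "sgn_in p S = (sgn_in p (S - T) * sgn_in p T :: 'a)"
          using sgn_in_Un[of "S - T" T p, where 'a = 'a] S W(1) True
          by (metis Diff_disjoint Diff_partition Int_commute Un_commute finite_Diff)
        \<comment> \<open>A sign is its own inverse, so \<open>sgn_in p T\<close> can be moved to
          the other side; the minus sign of the claim comes from
          \<open>shuffle_sgn_insert\<close>.\<close>
        moreover have "sgn_in p T * sgn_in p T = (1 :: 'a)"
          by (simp add: sgn_in_def flip: power_add mult_2)
        ultimately have "sgn_in p S * sgn_in p T = (sgn_in p (S - T) :: 'a)"
          by (simp add: mult.assoc)
        moreover have "shuffle_sgn (insert p (S - T)) T = (- sgn_in p T * shuffle_sgn (S - T) T :: 'a)"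
          using S pT by (intro shuffle_sgn_insert) auto
        ultimately show "shuffle_sgn (S - T) T * (sgn_in p (S - T) * f (insert p (S - T)) (a div m div p)) = - F p"
          unfolding F_def ins by (simp add: ac_simps flip: div_mult2_eq)
      qed
      finally show ?thesis .
    qed
    show ?thesis
      unfolding L using R by (simp add: sum_negf)
  qed
qed

lemma golod_d_diff: "golod_d (f - g) = golod_d f - golod_d g"
  by (intro ext) (simp add: golod_d_def koszul_d_diff cycle_mult_diff sum_subtractf sum_fun_apply)

lemma golod_d_add: "golod_d (f + g) = golod_d f + golod_d g"
  by (intro ext) (simp add: golod_d_def koszul_d_add cycle_mult_add sum.distrib sum_fun_apply)

lemma golod_d_Cons: "golod_d g (w # ws) = golod_d (\<lambda>ws. g (w # ws)) ws"
  by (simp add: golod_d_def)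

lemma golod_d_zero [simp]: "golod_d 0 = 0" by (intro ext) (simp add: golod_d_def sum_fun_apply)

text \<open>The two mixed sums cancel by anticommutation, and two letters removed in succession
  multiply to zero.\<close>

lemma golod_d_golod_d:
  assumes "gchain e g"
  shows "golod_d (golod_d g) = 0"
proof
  fix ws
  let ?W = "golod_gens n"
  note ks = gchain_ksupp[OF assms]
  have "golod_d (golod_d g) ws = koszul_d n (koszul_d n (g ws)) + (\<Sum>w\<in>?W. koszul_d n (cycle_mult n w (g (ws @ [w])))) +
      ((\<Sum>w\<in>?W. cycle_mult n w (koszul_d n (g (ws @ [w])))) +
       (\<Sum>w\<in>?W. \<Sum>w'\<in>?W. cycle_mult n w (cycle_mult n w' (g ((ws @ [w]) @ [w'])))))"
    by (simp add: golod_d_def koszul_d_add koszul_d_sum cycle_mult_add cycle_mult_sum sum.distrib)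
  also have "(\<Sum>w\<in>?W. \<Sum>w'\<in>?W. cycle_mult n w (cycle_mult n w' (g ((ws @ [w]) @ [w'])))) = 0"
    by (intro sum.neutral ballI) (auto simp: cycle_mult_cycle_mult ks)
  also have "(\<Sum>w\<in>?W. koszul_d n (cycle_mult n w (g (ws @ [w])))) = (\<Sum>w\<in>?W. - cycle_mult n w (koszul_d n (g (ws @ [w]))))"
    by (intro sum.cong refl koszul_d_cycle_mult ks)
  finally show "golod_d (golod_d g) ws = 0 ws"
    by (simp add: koszul_d_koszul_d_supp ks sum_negf fun_eq_iff)
qed

lemma cells_finite: "(ws, S) \<in> cells e \<Longrightarrow> finite S"
  by (auto simp: cells_def intro: finite_primes_le_subset)

lemma gchain_golod_d: 
  assumes "gchain (Suc e) g"
  shows "gchain e (golod_d g)"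
  unfolding gchain_def
proof (intro allI impI)
  fix ws S a
  assume nz: "golod_d g ws S a \<noteq> 0"
  from nz consider "koszul_d n (g ws) S a \<noteq> 0" | "(\<Sum>w\<in>golod_gens n. cycle_mult n w (g (ws @ [w])) S a) \<noteq> 0"
    by (cases "koszul_d n (g ws) S a = 0") (auto simp: golod_d_def sum_fun_apply)
  then show "(ws, S) \<in> cells e \<and> a \<in> {1..n}"
  proof cases
    case 1
    then obtain p where p: "p \<in> primes_le n" "p \<notin> S" "p dvd a" "g ws (insert p S) (a div p) \<noteq> 0" "a \<le> n"
      by (rule koszul_d_nonzeroE)
    then have *: "(ws, insert p S) \<in> cells (Suc e)" "a div p \<in> {1..n}"
      using gchainD[OF assms] by blast+
    then have "finite S"
      using cells_finite[OF *(1)] by simp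
    then show ?thesis
      using * p by (cases a) (auto simp: cells_def)
  next
    case 2
    then obtain w where w: "w \<in> golod_gens n" "cycle_mult n w (g (ws @ [w])) S a \<noteq> 0"
      by (rule sum.not_neutral_contains_not_neutral)
    obtain m T where mT [simp]: "w = (m, T)" by (metis surj_pair)
    have *: "a \<le> n" "T \<subseteq> S" "m dvd a" "g (ws @ [w]) (S - T) (a div m) \<noteq> 0"
      using w cycle_mult_nonzeroE[of m T "g (ws @ [w])" S a] by simp_all
    then have c: "(ws @ [w], S - T) \<in> cells (Suc e)" "a div m \<in> {1..n}"
      using gchainD[OF assms] by blast+
    have T: "finite T" "T \<subseteq> primes_le n"
      using golod_gensD[of m T n] w by auto
    have "finite S"
      using cells_finite[OF c(1)] T by auto
    then have "card S = card (S - T) + card T"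
      using * T by (metis card_Diff_subset card_mono le_add_diff_inverse2)
    then show ?thesis
      using c * T by (cases a) (auto simp: cells_def gen_degree_def)
  qed
qed

lemma gchain_add: "gchain e f \<Longrightarrow> gchain e g \<Longrightarrow> gchain e (f + g)"
  and gchain_diff: "gchain e f \<Longrightarrow> gchain e g \<Longrightarrow> gchain e (f - g)"
  unfolding gchain_def
  by (metis (no_types, lifting) add.right_neutral plus_fun_apply) (metis (no_types, lifting) diff_zero fun_diff_def)

lemma koszul_d_kunit [simp]: "koszul_d n (kunit c) = 0"
  by (auto simp: fun_eq_iff koszul_d_def kunit_def)

lemma cycle_mult_kunit:
  assumes "(m, T) \<in> golod_gens n"
  shows "cycle_mult n (m, T) (kunit c) S a = (if a = m \<and> S = T then c else 0)"
proof -
  have "a \<le> n \<and> T \<subseteq> S \<and> m dvd a \<and> S - T = {} \<and> a div m = 1 \<longleftrightarrow> a = m \<and> S = T"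
    using golod_gensD[OF assms] by auto
  then show ?thesis by (auto simp: cycle_mult_def kunit_def shuffle_sgn_def)
qed

lemma sum_cycle_mult_kunit:
  "(\<Sum>w\<in>golod_gens n. cycle_mult n w (kunit (c w))) S a = (if (a, S) \<in> golod_gens n then c (a, S) else 0)"
proof -
  have "(\<Sum>w\<in>golod_gens n. cycle_mult n w (kunit (c w)) S a) = (\<Sum>w\<in>golod_gens n. if (a, S) = w then c w else 0)"
    by (intro sum.cong refl) (auto simp: cycle_mult_kunit split_paired_all)
  then show ?thesis by (simp add: sum_fun_apply)
qed

text \<open>Every matrix entry of the differential lies in the maximal ideal: primes and the m of
  Golod pairs exceed 1. This yields minimality, and it shows that boundaries have augmentation
  0.\<close>

lemma golod_d_at_1: "golod_d g ws S 1 = 0"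
proof -
  have "cycle_mult n w (g (ws @ [w])) S 1 = 0" if "w \<in> golod_gens n" for w
    using golod_gensD(9)[of "fst w" "snd w" n] that by (auto simp: cycle_mult_def)
  then show ?thesis by (simp add: golod_d_def koszul_d_at_1 sum_fun_apply del: One_nat_def)
qed

text \<open>Strong induction, cutting off the head w of each word: \<open>golod_d\<close> ignores
  the head, and \<open>gen_degree w\<close> \<ge> 1 lowers the degree. After subtracting its
  coefficient \<open>c w\<close> of 1, each tail chain is a boundary. What remains lives on the
  empty word and on single letters, and is settled by the Koszul homology.\<close>

lemma golod_d_exact:
  "gchain e g \<Longrightarrow> golod_d g = 0 \<Longrightarrow> g [] {} 1 = 0 \<Longrightarrow> \<exists>h. gchain (Suc e) h \<and> golod_d h = g"
proof (induction e arbitrary: g rule: less_induct)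
  case (less e)
  let ?W = "golod_gens n"
  \<comment> \<open>The multiples of the generator in degree 0: the cycles that the third premise of
    the induction hypothesis keeps out.\<close>
  define u where "u c = (\<lambda>ws :: (nat \<times> nat set) list. if ws = [] then kunit c else 0)" for c :: 'a
  have gd_u: "golod_d (u c) = 0" for c by (intro ext) (auto simp: golod_d_def u_def sum_fun_apply)
  define c where "c w = g [w] {} 1" for w
  define g' where "g' w = (\<lambda>ws. g (w # ws)) - u (c w)" for w
  have gd_g': "golod_d (g' w) = 0" for w
  proof -
    have "golod_d (\<lambda>ws. g (w # ws)) = 0"
      by (intro ext) (metis golod_d_Cons less.prems(2) zero_fun_apply)
    then show ?thesis by (simp add: g'_def golod_d_diff gd_u)
  qed
  have g'_eq: "g' w ws S a = (if ws = [] \<and> S = {} \<and> a = 1 then 0 else g (w # ws) S a)" for w ws S a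
    by (auto simp: g'_def u_def c_def kunit_def)
  have cells_Cons: "(w # ws, S) \<in> cells e' \<longleftrightarrow> w \<in> ?W \<and> gen_degree w \<le> e' \<and> (ws, S) \<in> cells (e' - gen_degree w)"
    for w ws S e' by (auto simp: cells_def)
  have "\<exists>h. golod_d h = g' w \<and> (\<forall>ws S a. h ws S a \<noteq> 0 \<longrightarrow> (w # ws, S) \<in> cells (Suc e) \<and> a \<in> {1..n})" for w
  proof (cases "w \<in> ?W \<and> gen_degree w \<le> e")
    case True
    have "gchain (e - gen_degree w) (g' w)"
      unfolding gchain_def
    proof (intro allI impI)
      fix ws S a assume "g' w ws S a \<noteq> 0"
      then have "g (w # ws) S a \<noteq> 0" by (auto simp: g'_eq split: if_splits)
      then show "(ws, S) \<in> cells (e - gen_degree w) \<and> a \<in> {1..n}"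
        using gchainD[OF less.prems(1), of "w # ws" S a] by (simp add: cells_Cons)
    qed
    moreover have "e - gen_degree w < e"
      using True by (simp add: gen_degree_def)
    ultimately obtain h where h: "gchain (Suc (e - gen_degree w)) h" "golod_d h = g' w"
      using less.IH[of "e - gen_degree w" "g' w", OF _ _ gd_g'] g'_eq[of w "[]" "{}" 1] by auto
    show ?thesis
      using h True by (auto intro!: exI[of _ h] simp: cells_Cons Suc_diff_le dest: gchainD)
  next
    case False
    have "g' w = 0"
    proof (intro ext)
      fix ws S a
      show "g' w ws S a = 0 ws S a"
        using gchainD[OF less.prems(1), of "w # ws" S a] False by (auto simp: g'_eq cells_Cons)
    qed
    then show ?thesis by (intro exI[of _ 0]) auto
  qed
  then obtain hw where hw: "\<And>w. golod_d (hw w) = g' w"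
    "\<And>w ws S a. hw w ws S a \<noteq> 0 \<Longrightarrow> (w # ws, S) \<in> cells (Suc e) \<and> a \<in> {1..n}"
    by metis
  define h1 where "h1 ws = (case ws of [] \<Rightarrow> 0 | w # ws \<Rightarrow> hw w ws)" for ws
  have h1: "gchain (Suc e) h1"
    unfolding gchain_def
  proof (intro allI impI)
    fix ws S a assume "h1 ws S a \<noteq> 0"
    then show "(ws, S) \<in> cells (Suc e) \<and> a \<in> {1..n}"
      using hw(2) by (cases ws) (auto simp: h1_def)
  qed
  \<comment> \<open>Subtracting the boundary of \<open>h1\<close> leaves a Koszul chain on the empty
    word and the scalars \<open>c w\<close> on the one-letter words.\<close>
  define r where "r = g - golod_d h1"
  have r: "gchain e r"
    unfolding r_def by (intro gchain_diff less.prems gchain_golod_d h1)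
  have gd_r: "golod_d r = 0"
    by (simp add: r_def golod_d_diff less.prems golod_d_golod_d[OF h1] fun_eq_iff)
  have r_Cons: "r (w # ws) = u (c w) ws" for w ws
  proof -
    have "golod_d h1 (w # ws) = golod_d (hw w) ws" by (simp add: golod_d_Cons h1_def)
    then show ?thesis by (simp add: r_def hw g'_def)
  qed
  define k where "k = r []"
  have k: "ksupp n k"
    unfolding k_def by (rule gchain_ksupp[OF r])
  have kc: "kchain e k"
    using r unfolding k_def kchain_def gchain_def cells_def by fastforce
  have k1: "k {} 1 = 0"
    using less.prems(3) golod_d_at_1[of h1 "[]" "{}"] by (simp add: k_def r_def)
  \<comment> \<open>At the empty word the equation \<open>golod_d r = 0\<close> says that the
    combination z of Golod cycles is, up to sign, a Koszul boundary. Independence then forces all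
    \<open>c w\<close> to vanish.\<close>
  define z where "z = (\<Sum>w\<in>?W. cycle_mult n w (kunit (c w)))"
  have "golod_d r [] = koszul_d n k + z" by (simp add: golod_d_def k_def r_Cons u_def z_def)
  then have kz: "koszul_d n k = - z"
    using gd_r by (simp add: eq_neg_iff_add_eq_0)
  have "gsupp n (- z)"
    unfolding gsupp_def z_def by (simp add: sum_cycle_mult_kunit)
  then have "- z = 0" by (rule golod_koszul_d_boundary_zero[OF k _ kz k1])
  then have z0: "z = 0" by simp
  have c0: "c w = 0" for w
  proof (cases "w \<in> ?W")
    case True
    then show ?thesis
      using sum_cycle_mult_kunit[of c "snd w" "fst w"] z0 by (simp add: z_def)
  next
    case False
    then show ?thesis
      using gchainD[OF less.prems(1), of "[w]" "{}" 1] by (auto simp: c_def cells_def)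
  qed
  then have r_Cons0: "r (w # ws) = 0" for w ws by (simp add: r_Cons u_def)
  have kdk: "koszul_d n k = 0"
    using kz z0 by simp
  define y where "y = k - koszul_d n (contract n k)"
  have y: "gsupp n y"
    using gsupp_residue[OF k k1] by (simp add: kdk y_def)
  have yc: "kchain e y"
    unfolding y_def by (intro kchain_diff kc kchain_koszul_d kchain_contract)
  \<comment> \<open>The contraction accounts for k up to a combination y of Golod cycles, and each
    cycle w is itself the differential of the word [w] with Koszul factor 1.\<close>
  define h2 where "h2 ws = (case ws of [] \<Rightarrow> contract n k
    | w # ws' \<Rightarrow> if ws' = [] then kunit (y (snd w) (fst w)) else 0)" for ws
  have h2: "gchain (Suc e) h2"
    unfolding gchain_def
  proof (intro allI impI)
    fix ws S a assume nz: "h2 ws S a \<noteq> 0"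
    show "(ws, S) \<in> cells (Suc e) \<and> a \<in> {1..n}"
    proof (cases ws)
      case Nil
      then show ?thesis
        using nz kchain_contract[OF kc] by (auto simp: h2_def kchain_def cells_def)
    next
      case (Cons w ws')
      then have *: "ws' = []" "y (snd w) (fst w) \<noteq> 0" "S = {}" "a = 1"
        using nz by (auto simp: h2_def kunit_def split: if_splits)
      then have w: "w \<in> ?W" "card (snd w) = e"
        using y yc unfolding gsupp_def kchain_def by (metis prod.collapse, blast)
      then have "1 \<le> n"
        using golod_gensD[of "fst w" "snd w" n] by simp
      then show ?thesis
        using * w Cons by (auto simp: cells_def gen_degree_def)
    qed
  qed
  have "golod_d h2 = r"
  proof
    fix ws
    show "golod_d h2 ws = r ws"
    proof (cases ws)
      case Nil
      have "(\<Sum>w\<in>?W. cycle_mult n w (kunit (y (snd w) (fst w)))) = y"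
      proof (intro ext)
        fix S a
        show "(\<Sum>w\<in>?W. cycle_mult n w (kunit (y (snd w) (fst w)))) S a = y S a"
          using y by (subst sum_cycle_mult_kunit) (auto simp: gsupp_def)
      qed
      then show ?thesis
        using Nil by (simp add: golod_d_def h2_def y_def k_def)
    next
      case (Cons w ws')
      then show ?thesis by (simp add: golod_d_def h2_def r_Cons0)
    qed
  qed
  then have "golod_d (h1 + h2) = g" by (simp add: golod_d_add r_def)
  then show ?case
    using gchain_add[OF h1 h2] by blast
qed

end


section \<open>Matrices over the convolution ring\<close>

definition dconv :: "nat \<Rightarrow> (nat \<Rightarrow> 'k::field_char_0) \<Rightarrow> (nat \<Rightarrow> 'k) \<Rightarrow> nat \<Rightarrow> 'k" where
  "dconv n f g m = (if m \<in> {1..n} then \<Sum>d | d dvd m. f d * g (m div d) else 0)"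

definition dring :: "nat \<Rightarrow> (nat \<Rightarrow> 'k::field_char_0) set" where
  "dring n = {f. \<forall>m. m \<notin> {1..n} \<longrightarrow> f m = 0}"

definition dunit :: "nat \<Rightarrow> 'k::field_char_0" where
  "dunit m = (if m = 1 then 1 else 0)"

section \<open>Algebra of the truncated convolution\<close>

lemma dconv_dring [simp]: "dconv n f g \<in> dring n" by (simp add: dconv_def dring_def)

lemma dring_zero [simp]: "0 \<in> dring n" "(\<lambda>_. 0) \<in> dring n"
  by (simp_all add: dring_def)

lemma dring_add: "f \<in> dring n \<Longrightarrow> g \<in> dring n \<Longrightarrow> f + g \<in> dring n"
  by (simp add: dring_def)

lemma dring_diff: "f \<in> dring n \<Longrightarrow> g \<in> dring n \<Longrightarrow> f - g \<in> dring n"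
  by (simp add: dring_def)

lemma dring_sum: "(\<And>i. i \<in> A \<Longrightarrow> f i \<in> dring n) \<Longrightarrow> (\<Sum>i\<in>A. f i) \<in> dring n"
  by (induction A rule: infinite_finite_induct) (simp_all add: dring_add)

lemma dunit_dring [simp]: "1 \<le> n \<Longrightarrow> dunit \<in> dring n"
  by (auto simp: dring_def dunit_def)

lemma dconv_comm: "dconv n f g = dconv n g f"
proof
  fix m
  show "dconv n f g m = dconv n g f m"
  proof (cases "m \<in> {1..n}")
    case True
    then have "(\<Sum>d | d dvd m. f d * g (m div d)) = (\<Sum>d | d dvd m. g d * f (m div d))"
      by (intro sum.reindex_bij_witness[of _ "\<lambda>d. m div d" "\<lambda>d. m div d"]) (auto simp: div_div_eq_right)
    then show ?thesis by (simp add: dconv_def)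
  qed (auto simp: dconv_def)
qed

lemma dconv_assoc: "dconv n (dconv n f g) h = dconv n f (dconv n g h)"
proof
  fix m
  show "dconv n (dconv n f g) h m = dconv n f (dconv n g h) m"
  proof (cases "m \<in> {1..n}")
    case True
    then have m: "m > 0" "m \<le> n" by auto
    have dvd_in: "d \<in> {1..n}" if "d dvd m" for d
      using that m dvd_imp_le[OF that] by (cases d) auto
    have fin: "finite {d. d dvd m}"
      using m by simp
    have fin': "finite {d'. d' dvd d}" if "d dvd m" for d
      using that m by (intro finite_divisors_nat) (auto intro: dvd_pos_nat)
    have "dconv n (dconv n f g) h m = (\<Sum>d | d dvd m. \<Sum>d' | d' dvd d. f d' * g (d div d') * h (m div d))"
      using True dvd_in by (auto simp: dconv_def sum_distrib_right intro!: sum.cong)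
    also have "\<dots> = (\<Sum>(d, d') \<in> (SIGMA d:{d. d dvd m}. {d'. d' dvd d}). f d' * g (d div d') * h (m div d))"
      using fin fin' by (subst sum.Sigma) auto
    \<comment> \<open>Both index sets enumerate the factorizations of m into three factors; on the
      left these are d', \<open>d div d'\<close> and \<open>m div d\<close>.\<close>
    also have "\<dots> = (\<Sum>(d, d') \<in> (SIGMA d:{d. d dvd m}. {d'. d' dvd m div d}). f d * (g d' * h (m div d div d')))"
      using m by (intro sum.reindex_bij_witness[of _ "\<lambda>(a, b). (a * b, a)" "\<lambda>(d, d'). (d', d div d')"])
        (auto simp: div_mult2_eq mult.assoc intro: dvd_trans elim!: dvdE)
    also have "\<dots> = (\<Sum>d | d dvd m. \<Sum>d' | d' dvd m div d. f d * (g d' * h (m div d div d')))"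
    proof (subst sum.Sigma)
      show "\<forall>d\<in>{d. d dvd m}. finite {d'. d' dvd m div d}"
        using m by (auto intro!: finite_divisors_nat elim!: dvdE)
    qed (use fin in auto)
    also have "\<dots> = dconv n f (dconv n g h) m"
    proof -
      have "m div d \<in> {1..n}" if "d dvd m" for d
        using dvd_in[of "m div d"] that by auto
      then show ?thesis
        using True by (auto simp: dconv_def sum_distrib_left intro!: sum.cong)
    qed
    finally show ?thesis .
  qed (auto simp: dconv_def)
qed

lemma dconv_add_left: "dconv n (f + f') g = dconv n f g + dconv n f' g"
  by (auto simp: fun_eq_iff dconv_def distrib_right sum.distrib)

lemma dconv_add_right: "dconv n f (g + g') = dconv n f g + dconv n f g'"
  by (auto simp: fun_eq_iff dconv_def distrib_left sum.distrib)

lemma dconv_diff_left: "dconv n (f - f') g = dconv n f g - dconv n f' g"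
  by (auto simp: fun_eq_iff dconv_def left_diff_distrib sum_subtractf)

lemma dconv_diff_right: "dconv n f (g - g') = dconv n f g - dconv n f g'"
  by (auto simp: fun_eq_iff dconv_def right_diff_distrib sum_subtractf)

lemma dconv_zero [simp]: "dconv n 0 g = 0" "dconv n f 0 = 0" "dconv n (\<lambda>_. 0) g = (\<lambda>_. 0)" "dconv n f (\<lambda>_. 0) = (\<lambda>_. 0)"
  by (auto simp: fun_eq_iff dconv_def)

lemma dconv_sum_left: "dconv n (\<Sum>i\<in>A. f i) g = (\<Sum>i\<in>A. dconv n (f i) g)"
proof (induction A rule: infinite_finite_induct)
  case (insert x A)
  show ?case
    unfolding sum.insert[OF insert(1,2)] dconv_add_left insert(3) ..
qed (simp_all only: sum.infinite sum.empty dconv_zero not_False_eq_True)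

lemma dconv_sum_right: "dconv n f (\<Sum>i\<in>A. g i) = (\<Sum>i\<in>A. dconv n f (g i))"
  by (subst (1 2) dconv_comm) (rule dconv_sum_left)

lemma dconv_one: 
  assumes "f \<in> dring n"
  shows "dconv n dunit f = f"
proof
  fix m
  show "dconv n dunit f m = f m"
  proof (cases "m \<in> {1..n}")
    case True
    then have "(\<Sum>d | d dvd m. dunit d * f (m div d)) = (\<Sum>d \<in> {1}. dunit d * f (m div d))"
      by (intro sum.mono_neutral_right) (auto simp: dunit_def)
    then show ?thesis
      using True by (simp add: dconv_def dunit_def)
  qed (use assms in \<open>auto simp: dconv_def dring_def\<close>)
qed

lemma dconv_at_1: "1 \<le> n \<Longrightarrow> dconv n f g 1 = f 1 * g 1"
proof -
  have "{d :: nat. d dvd 1} = {1}" by auto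
  then show "1 \<le> n \<Longrightarrow> dconv n f g 1 = f 1 * g 1"
    unfolding dconv_def by simp
qed

type_synonym 'k mtx = "nat \<Rightarrow> nat \<Rightarrow> nat \<Rightarrow> 'k"

definition mmult :: "nat \<Rightarrow> nat \<Rightarrow> 'k::field_char_0 mtx \<Rightarrow> 'k mtx \<Rightarrow> 'k mtx" where
  "mmult n c X Y i j = (\<Sum>l<c. dconv n (X i l) (Y l j))"

text \<open>Padding by 0 outside the r by c block makes equality of matrices plain equality of
  functions. The inner dimension is passed to \<open>mmult\<close> explicitly.\<close>

definition mats :: "nat \<Rightarrow> nat \<Rightarrow> nat \<Rightarrow> 'k::field_char_0 mtx set" where
  "mats n r c = {X. \<forall>i j. X i j \<in> dring n \<and> (\<not> (i < r \<and> j < c) \<longrightarrow> X i j = 0)}"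

definition mone :: "nat \<Rightarrow> 'k::field_char_0 mtx" where
  "mone r i j = (if i < r \<and> i = j then dunit else 0)"

lemma matsD: "X \<in> mats n r c \<Longrightarrow> X i j \<in> dring n" "X \<in> mats n r c \<Longrightarrow> \<not> (i < r \<and> j < c) \<Longrightarrow> X i j = 0"
  by (auto simp: mats_def)

lemma mmult_assoc: "mmult n d (mmult n c X Y) Z = mmult n c X (mmult n d Y Z)"
proof (intro ext)
  fix i j m
  have "(\<Sum>l<d. dconv n (\<Sum>l'<c. dconv n (X i l') (Y l' l)) (Z l j))
      = (\<Sum>l<d. \<Sum>l'<c. dconv n (X i l') (dconv n (Y l' l) (Z l j)))"
    by (simp only: dconv_sum_left dconv_assoc)
  also have "\<dots> = (\<Sum>l'<c. \<Sum>l<d. dconv n (X i l') (dconv n (Y l' l) (Z l j)))"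
    by (rule sum.swap)
  also have "\<dots> = (\<Sum>l'<c. dconv n (X i l') (\<Sum>l<d. dconv n (Y l' l) (Z l j)))"
    by (simp only: dconv_sum_right)
  finally show "mmult n d (mmult n c X Y) Z i j m = mmult n c X (mmult n d Y Z) i j m"
    by (simp only: mmult_def)
qed

lemma mmult_mats: 
  assumes "X \<in> mats n r c" "Y \<in> mats n c s" 
  shows "mmult n c X Y \<in> mats n r s"
  unfolding mats_def mem_Collect_eq
proof (intro allI conjI impI)
  fix i j
  show "mmult n c X Y i j \<in> dring n"
    unfolding mmult_def by (rule dring_sum) simp
  assume "\<not> (i < r \<and> j < s)"
  then have "X i l = 0 \<or> Y l j = 0" for l
    using matsD(2)[OF assms(1), of i l] matsD(2)[OF assms(2), of l j] by auto
  then have "dconv n (X i l) (Y l j) = 0" for l by (metis dconv_zero(1,2))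
  then show "mmult n c X Y i j = 0"
    unfolding mmult_def by (intro sum.neutral) auto
qed

lemma mmult_diff_left: "mmult n c (X - X') Y = mmult n c X Y - mmult n c X' Y"
  by (intro ext) (simp add: mmult_def dconv_diff_left sum_subtractf sum_fun_apply)

lemma mmult_diff_right: "mmult n c X (Y - Y') = mmult n c X Y - mmult n c X Y'"
  by (intro ext) (simp add: mmult_def dconv_diff_right sum_subtractf sum_fun_apply)

lemma mmult_zero [simp]: "mmult n c 0 Y = 0" "mmult n c X 0 = 0"
  by (intro ext, simp add: mmult_def sum_fun_apply dconv_def)+

lemma mmult_one_left: 
  assumes "X \<in> mats n r c" 
  shows "mmult n r (mone r) X = X"
proof (intro ext)
  fix i j m
  have "(\<Sum>l<r. dconv n (mone r i l) (X l j)) = (\<Sum>l<r. if i = l then X l j else 0)"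
  proof (rule sum.cong[OF refl])
    fix l assume "l \<in> {..<r}"
    then show "dconv n (mone r i l) (X l j) = (if i = l then X l j else 0)"
      using dconv_one[OF matsD(1)[OF assms]] by (auto simp: mone_def)
  qed
  also have "\<dots> = X i j"
    using matsD(2)[OF assms, of i j] by (cases "i < r") auto
  finally show "mmult n r (mone r) X i j m = X i j m" by (simp add: mmult_def)
qed

lemma mmult_one_right: 
  assumes "X \<in> mats n r c" 
  shows "mmult n c X (mone c) = X"
proof (intro ext)
  fix i j m
  have "(\<Sum>l<c. dconv n (X i l) (mone c l j)) = (\<Sum>l<c. if j = l then X i l else 0)"
  proof (rule sum.cong[OF refl])
    fix l assume "l \<in> {..<c}"
    then show "dconv n (X i l) (mone c l j) = (if j = l then X i l else 0)"
      using dconv_one[OF matsD(1)[OF assms, of i l]] by (auto simp: mone_def dconv_comm[of n "X i l"])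
  qed
  also have "\<dots> = X i j"
    using matsD(2)[OF assms, of i j] by (cases "j < c") auto
  finally show "mmult n c X (mone c) i j m = X i j m" by (simp add: mmult_def)
qed

lemma mone_mats: "1 \<le> n \<Longrightarrow> mone r \<in> mats n r r"
  by (auto simp: mats_def mone_def)

lemma mats_diff: "X \<in> mats n r c \<Longrightarrow> Y \<in> mats n r c \<Longrightarrow> X - Y \<in> mats n r c"
  by (simp add: mats_def dring_diff fun_eq_iff)

lemma mmult_at_1: "1 \<le> n \<Longrightarrow> mmult n c X Y i j 1 = (\<Sum>l<c. X i l 1 * Y l j 1)"
  by (simp only: mmult_def sum_fun_apply dconv_at_1)

text \<open>The composite of \<open>X\<close> with the map out of the \<open>k\<close>-th module, the augmentation if \<open>k = 0\<close>,
  vanishes.\<close>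

definition killed :: "nat \<Rightarrow> (nat \<Rightarrow> nat) \<Rightarrow> (nat \<Rightarrow> 'k::field_char_0 mtx) \<Rightarrow> (nat \<Rightarrow> 'k) \<Rightarrow> nat \<Rightarrow> 'k mtx \<Rightarrow> bool" where
  "killed n b D e k X \<longleftrightarrow>
     (case k of 0 \<Rightarrow> \<forall>j. (\<Sum>i<b 0. X i j 1 * e i) = 0 | Suc k' \<Rightarrow> mmult n (b k) (D k') X = 0)"

text \<open>Exactness is required for matrices with any number c of columns, so that a lifting step
  for a whole chain map is a single instance. The augmentation maps onto the field K, where
  surjectivity amounts to one nonzero \<open>e j\<close>.\<close>

definition mresolution :: "nat \<Rightarrow> (nat \<Rightarrow> nat) \<Rightarrow> (nat \<Rightarrow> 'k::field_char_0 mtx) \<Rightarrow> (nat \<Rightarrow> 'k) \<Rightarrow> bool" where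
  "mresolution n b D e \<longleftrightarrow>
     (\<forall>k. D k \<in> mats n (b k) (b (Suc k)) \<and> killed n b D e k (D k)) \<and>
     (\<exists>j<b 0. e j \<noteq> 0) \<and>
     (\<forall>k c X. X \<in> mats n (b k) c \<longrightarrow> killed n b D e k X \<longrightarrow>
        (\<exists>Y \<in> mats n (b (Suc k)) c. X = mmult n (b (Suc k)) (D k) Y))"

section \<open>Comparison of resolutions\<close>

lemma mresolutionD:
  assumes "mresolution n b D e"
  shows "D k \<in> mats n (b k) (b (Suc k))" "killed n b D e k (D k)" "\<exists>j<b 0. e j \<noteq> 0"
    "X \<in> mats n (b k) c \<Longrightarrow> killed n b D e k X \<Longrightarrow>
        \<exists>Y \<in> mats n (b (Suc k)) c. X = mmult n (b (Suc k)) (D k) Y"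
  using assms by (auto simp: mresolution_def)

lemma killed_mmult:
  assumes "1 \<le> n" "killed n b D e k X"
  shows "killed n b D e k (mmult n c X Y)"
proof (cases k)
  case 0
  have "(\<Sum>i<b 0. mmult n c X Y i j 1 * e i) = (\<Sum>l<c. (\<Sum>i<b 0. X i l 1 * e i) * Y l j 1)" for j
    unfolding mmult_at_1[OF assms(1)] sum_distrib_right by (subst sum.swap) (simp add: ac_simps)
  then show ?thesis
    using assms(2) 0 by (simp add: killed_def)
next
  case (Suc k')
  then show ?thesis
    using assms(2) by (simp add: killed_def flip: mmult_assoc)
qed

text \<open>The usual lifting, by dependent choice. \<open>P\<close> records that X D is killed in
  the target resolution, which is what exactness there needs to supply the next component;
  \<open>Q\<close> is the commuting square.\<close>

lemma comparison_map:
  assumes n: "1 \<le> n" and F: "mresolution n b D e" and G: "mresolution n b' D' e'"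
  obtains \<phi> where "\<And>k. \<phi> k \<in> mats n (b' k) (b k)"
    "\<And>j. (\<Sum>i<b' 0. \<phi> 0 i j 1 * e' i) = (if j < b 0 then e j else 0)"
    "\<And>k. mmult n (b' (Suc k)) (D' k) (\<phi> (Suc k)) = mmult n (b k) (\<phi> k) (D k)"
proof -
  note F = mresolutionD[OF F] and G = mresolutionD[OF G]
  define P where "P k X \<longleftrightarrow> X \<in> mats n (b' k) (b k) \<and> killed n b' D' e' k (mmult n (b k) X (D k)) \<and>
     (k = 0 \<longrightarrow> (\<forall>j. (\<Sum>i<b' 0. X i j 1 * e' i) = (if j < b 0 then e j else 0)))" for k X
  define Q where "Q k X Y \<longleftrightarrow> mmult n (b' (Suc k)) (D' k) Y = mmult n (b k) X (D k)" for k X Y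
  obtain j0 where j0: "j0 < b' 0" "e' j0 \<noteq> 0"
    using G(3) by blast
  \<comment> \<open>Scalars in the single row j0, where the target augmentation is invertible; the
    division gives column j the augmentation \<open>e j\<close>.\<close>
  define X0 :: "'a mtx" where
    "X0 i j m = (if i = j0 \<and> j < b 0 \<and> m = 1 then e j / e' j0 else 0)" for i j m
  have aug: "(\<Sum>i<b' 0. X0 i j 1 * e' i) = (if j < b 0 then e j else 0)" for j
  proof -
    have "(\<Sum>i<b' 0. X0 i j 1 * e' i) = (\<Sum>i<b' 0. if i = j0 then (if j < b 0 then e j else 0) else 0)"
      using j0 by (intro sum.cong) (auto simp: X0_def)
    then show ?thesis
      using j0 by simp
  qed
  have "P 0 X0"
    unfolding P_def
  proof (intro conjI impI allI aug)
    show "X0 \<in> mats n (b' 0) (b 0)"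
      using j0 n by (auto simp: mats_def X0_def dring_def fun_eq_iff)
    have "(\<Sum>i<b' 0. mmult n (b 0) X0 (D 0) i j 1 * e' i) = 0" for j
    proof -
      have "(\<Sum>i<b' 0. mmult n (b 0) X0 (D 0) i j 1 * e' i)
          = (\<Sum>l<b 0. (\<Sum>i<b' 0. X0 i l 1 * e' i) * D 0 l j 1)"
        unfolding mmult_at_1[OF n] sum_distrib_right by (subst sum.swap) (simp add: ac_simps)
      also have "\<dots> = (\<Sum>l<b 0. D 0 l j 1 * e l)"
        by (intro sum.cong refl, subst aug) (simp add: mult.commute)
      also have "\<dots> = 0"
        using F(2)[of 0] by (simp add: killed_def)
      finally show ?thesis .
    qed
    then show "killed n b' D' e' 0 (mmult n (b 0) X0 (D 0))" by (simp add: killed_def)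
  qed
  moreover have "\<exists>Y. P (Suc k) Y \<and> Q k X Y" if PX: "P k X" for k X
  proof -
    have "mmult n (b k) X (D k) \<in> mats n (b' k) (b (Suc k))"
      using that F(1) by (auto simp: P_def intro: mmult_mats)
    then obtain Y where Y: "Y \<in> mats n (b' (Suc k)) (b (Suc k))" "mmult n (b k) X (D k) = mmult n (b' (Suc k)) (D' k) Y"
      using G(4)[of "mmult n (b k) X (D k)" k "b (Suc k)"] PX by (auto simp: P_def)
    have "mmult n (b' (Suc k)) (D' k) (mmult n (b (Suc k)) Y (D (Suc k)))
        = mmult n (b k) X (mmult n (b (Suc k)) (D k) (D (Suc k)))"
      using Y(2) by (metis mmult_assoc)
    also have "\<dots> = 0"
      using F(2)[of "Suc k"] by (simp add: killed_def)
    finally have "P (Suc k) Y"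
      using Y by (simp add: P_def killed_def)
    then show ?thesis
      using Y(2) by (auto simp: Q_def)
  qed
  ultimately obtain \<phi> where "\<And>k. P k (\<phi> k)" "\<And>k. Q k (\<phi> k) (\<phi> (Suc k))"
    using dependent_nat_choice[of P Q] by metis
  then show thesis by (intro that[of \<phi>]) (auto simp: P_def Q_def)
qed

text \<open>The invariant in \<open>P\<close> is that the defect T_k - D_k h_k annihilates D_k.
  Since T is a chain map, D_k then kills T_{k+1} - h_k D_k, so exactness provides h_{k+1}.\<close>

lemma null_homotopy:
  assumes n: "1 \<le> n" and F: "mresolution n b D e"
    and T: "\<And>k. T k \<in> mats n (b k) (b k)" "killed n b D e 0 (T 0)"
    "\<And>k. mmult n (b (Suc k)) (D k) (T (Suc k)) = mmult n (b k) (T k) (D k)"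
  obtains h where "\<And>k. h k \<in> mats n (b (Suc k)) (b k)" "T 0 = mmult n (b 1) (D 0) (h 0)"
    "\<And>k. T (Suc k) = mmult n (b (Suc (Suc k))) (D (Suc k)) (h (Suc k)) + mmult n (b k) (h k) (D k)"
proof -
  note F = mresolutionD[OF F]
  define P where "P k X \<longleftrightarrow> X \<in> mats n (b (Suc k)) (b k) \<and>
     mmult n (b k) (T k - mmult n (b (Suc k)) (D k) X) (D k) = 0 \<and>
     (k = 0 \<longrightarrow> T 0 = mmult n (b 1) (D 0) X)" for k X
  define Q where "Q k X Y \<longleftrightarrow>
     T (Suc k) = mmult n (b (Suc (Suc k))) (D (Suc k)) Y + mmult n (b k) X (D k)" for k X Y
  obtain X0 where "X0 \<in> mats n (b 1) (b 0)" "T 0 = mmult n (b 1) (D 0) X0"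
    using F(4)[OF T(1,2)] by auto
  then have "P 0 X0" by (simp add: P_def)
  moreover have "\<exists>Y. P (Suc k) Y \<and> Q k X Y" if PX: "P k X" for k X
  proof -
    have X: "X \<in> mats n (b (Suc k)) (b k)" and
      X0: "mmult n (b k) (T k - mmult n (b (Suc k)) (D k) X) (D k) = 0"
      using that by (auto simp: P_def)
    let ?Z = "T (Suc k) - mmult n (b k) X (D k)"
    have "?Z \<in> mats n (b (Suc k)) (b (Suc k))" by (intro mats_diff T mmult_mats[OF X] F)
    moreover have "killed n b D e (Suc k) ?Z"
    proof -
      have "mmult n (b (Suc k)) (D k) ?Z = mmult n (b k) (T k) (D k) - mmult n (b k) (mmult n (b (Suc k)) (D k) X) (D k)"
        by (simp only: mmult_diff_right T(3) mmult_assoc)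
      also have "\<dots> = 0"
        using X0 by (simp only: mmult_diff_left)
      finally show ?thesis by (simp add: killed_def)
    qed
    ultimately obtain Y where Y: "Y \<in> mats n (b (Suc (Suc k))) (b (Suc k))"
      "?Z = mmult n (b (Suc (Suc k))) (D (Suc k)) Y"
      using F(4) by blast
    have eq: "T (Suc k) = mmult n (b (Suc (Suc k))) (D (Suc k)) Y + mmult n (b k) X (D k)"
      unfolding Y(2)[symmetric] by (simp add: fun_eq_iff)
    then have "T (Suc k) - mmult n (b (Suc (Suc k))) (D (Suc k)) Y = mmult n (b k) X (D k)"
      by (simp add: fun_eq_iff)
    moreover have "mmult n (b k) X (mmult n (b (Suc k)) (D k) (D (Suc k))) = 0"
      using F(2)[of "Suc k"] by (simp add: killed_def)
    ultimately have "P (Suc k) Y"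
      using Y(1) by (simp add: P_def mmult_assoc)
    then show ?thesis
      using eq by (auto simp: Q_def)
  qed
  ultimately obtain h where "\<And>k. P k (h k)" "\<And>k. Q k (h k) (h (Suc k))"
    using dependent_nat_choice[of P Q] by metis
  then show thesis by (intro that[of h]) (auto simp: P_def Q_def)
qed

lemma composite_map:
  assumes n: "1 \<le> n" and F: "mresolution n b D e" and G: "mresolution n b' D' e'"
    and \<phi>: "\<And>k. \<phi> k \<in> mats n (b' k) (b k)"
    "\<And>j. (\<Sum>i<b' 0. \<phi> 0 i j 1 * e' i) = (if j < b 0 then e j else 0)"
    "\<And>k. mmult n (b' (Suc k)) (D' k) (\<phi> (Suc k)) = mmult n (b k) (\<phi> k) (D k)"
    and \<psi>: "\<And>k. \<psi> k \<in> mats n (b k) (b' k)"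
    "\<And>j. (\<Sum>i<b 0. \<psi> 0 i j 1 * e i) = (if j < b' 0 then e' j else 0)"
    "\<And>k. mmult n (b (Suc k)) (D k) (\<psi> (Suc k)) = mmult n (b' k) (\<psi> k) (D' k)"
  obtains h where "mone (b 0) - mmult n (b' 0) (\<psi> 0) (\<phi> 0) = mmult n (b 1) (D 0) (h 0)"
    "\<And>k. mone (b (Suc k)) - mmult n (b' (Suc k)) (\<psi> (Suc k)) (\<phi> (Suc k))
       = mmult n (b (Suc (Suc k))) (D (Suc k)) (h (Suc k)) + mmult n (b k) (h k) (D k)"
proof -
  define T where "T k = mone (b k) - mmult n (b' k) (\<psi> k) (\<phi> k)" for k
  have "T k \<in> mats n (b k) (b k)" for k
    unfolding T_def by (intro mats_diff mone_mats n mmult_mats[OF \<psi>(1) \<phi>(1)])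
  moreover have "killed n b D e 0 (T 0)"
  proof -
    have "(\<Sum>i<b 0. T 0 i j 1 * e i) = 0" for j
    proof -
      have "(\<Sum>i<b 0. mmult n (b' 0) (\<psi> 0) (\<phi> 0) i j 1 * e i)
          = (\<Sum>l<b' 0. (\<Sum>i<b 0. \<psi> 0 i l 1 * e i) * \<phi> 0 l j 1)"
        unfolding mmult_at_1[OF n] sum_distrib_right by (subst sum.swap) (simp add: ac_simps)
      also have "\<dots> = (\<Sum>l<b' 0. \<phi> 0 l j 1 * e' l)"
        by (intro sum.cong refl, subst \<psi>(2)) (simp add: mult.commute)
      also have "\<dots> = (if j < b 0 then e j else 0)" by (rule \<phi>(2))
      moreover have "(\<Sum>i<b 0. mone (b 0) i j 1 * e i) = (\<Sum>i<b 0. if i = j then e j else 0)"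
        by (intro sum.cong) (auto simp: mone_def dunit_def)
      ultimately show ?thesis by (simp add: T_def left_diff_distrib sum_subtractf)
    qed
    then show ?thesis by (simp add: killed_def)
  qed
  moreover have "mmult n (b (Suc k)) (D k) (T (Suc k)) = mmult n (b k) (T k) (D k)" for k
  proof -
    note D = mresolutionD(1)[OF F, of k]
    have "mmult n (b (Suc k)) (D k) (T (Suc k))
        = D k - mmult n (b' (Suc k)) (mmult n (b (Suc k)) (D k) (\<psi> (Suc k))) (\<phi> (Suc k))"
      by (simp only: T_def mmult_diff_right mmult_one_right[OF D] mmult_assoc)
    also have "\<dots> = D k - mmult n (b' k) (\<psi> k) (mmult n (b' (Suc k)) (D' k) (\<phi> (Suc k)))"
      by (simp only: \<psi>(3) mmult_assoc)
    also have "\<dots> = mmult n (b k) (T k) (D k)"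
      by (simp only: T_def mmult_diff_left mmult_one_left[OF D] mmult_assoc \<phi>(3))
    finally show ?thesis .
  qed
  ultimately show thesis
    using null_homotopy[OF n F, of T] that unfolding T_def by metis
qed

text \<open>\<open>P\<close> and \<open>Q\<close> are the reductions modulo the maximal ideal of comparison maps in both
  directions. Minimality of \<open>D'\<close> kills the homotopy on its side, so \<open>Q P\<close> is the identity.\<close>

lemma minimal_resolution_tor:
  fixes D D' :: "nat \<Rightarrow> 'k::field_char_0 mtx" and e e' :: "nat \<Rightarrow> 'k"
  assumes n: "1 \<le> n" and F: "mresolution n b D e" and G: "mresolution n b' D' e'"
    and minimal: "\<And>k i j. D' k i j 1 = 0"
  obtains P Q :: "nat \<Rightarrow> nat \<Rightarrow> 'k" where
    "\<And>k r c. i = Suc k \<Longrightarrow> (\<Sum>l<b i. D k r l 1 * P l c) = 0"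
    "\<And>c c'. c < b' i \<Longrightarrow> (\<Sum>l<b i. Q c l * P l c') = (if c = c' then 1 else 0)"
    "\<And>c s. (\<Sum>l<b i. Q c l * D i l s 1) = 0"
    "\<And>x. \<forall>k. i = Suc k \<longrightarrow> (\<forall>r<b k. (\<Sum>l<b i. D k r l 1 * x l) = 0) \<Longrightarrow>
       \<exists>y. \<forall>r<b i. x r - (\<Sum>c<b' i. P r c * (\<Sum>l<b i. Q c l * x l)) = (\<Sum>s<b (Suc i). D i r s 1 * y s)"
proof -
  obtain \<phi> where \<phi>: "\<And>k. \<phi> k \<in> mats n (b' k) (b k)"
    "\<And>j. (\<Sum>i<b' 0. \<phi> 0 i j 1 * e' i) = (if j < b 0 then e j else 0)"
    "\<And>k. mmult n (b' (Suc k)) (D' k) (\<phi> (Suc k)) = mmult n (b k) (\<phi> k) (D k)"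
    by (rule comparison_map[OF n F G], rule that, assumption+)
  obtain \<psi> where \<psi>: "\<And>k. \<psi> k \<in> mats n (b k) (b' k)"
    "\<And>j. (\<Sum>i<b 0. \<psi> 0 i j 1 * e i) = (if j < b' 0 then e' j else 0)"
    "\<And>k. mmult n (b (Suc k)) (D k) (\<psi> (Suc k)) = mmult n (b' k) (\<psi> k) (D' k)"
    by (rule comparison_map[OF n G F], rule that, assumption+)
  obtain h where h: "mone (b 0) - mmult n (b' 0) (\<psi> 0) (\<phi> 0) = mmult n (b 1) (D 0) (h 0)"
    "\<And>k. mone (b (Suc k)) - mmult n (b' (Suc k)) (\<psi> (Suc k)) (\<phi> (Suc k))
       = mmult n (b (Suc (Suc k))) (D (Suc k)) (h (Suc k)) + mmult n (b k) (h k) (D k)"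
    by (rule composite_map[OF n F G \<phi> \<psi>], rule that, assumption+)
  obtain h' where h': "mone (b' 0) - mmult n (b 0) (\<phi> 0) (\<psi> 0) = mmult n (b' 1) (D' 0) (h' 0)"
    "\<And>k. mone (b' (Suc k)) - mmult n (b (Suc k)) (\<phi> (Suc k)) (\<psi> (Suc k))
       = mmult n (b' (Suc (Suc k))) (D' (Suc k)) (h' (Suc k)) + mmult n (b' k) (h' k) (D' k)"
    by (rule composite_map[OF n G F \<psi> \<phi>], rule that, assumption+)
  have at1: "(\<Sum>l<c. X i l 1 * Y l j 1) = mmult n c X Y i j 1" for c i j and X Y :: "'k mtx"
    by (simp only: mmult_at_1[OF n])
  show thesis
  proof (rule that[of "\<lambda>l c. \<psi> i l c 1" "\<lambda>c l. \<phi> i c l 1"])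
    fix k r c assume i: "i = Suc k"
    show "(\<Sum>l<b i. D k r l 1 * \<psi> i l c 1) = 0"
      unfolding i at1 \<psi>(3) unfolding mmult_at_1[OF n] by (simp only: minimal mult_zero_right sum.neutral_const)
  next
    fix c c' assume c: "c < b' i"
    have "(mone (b' i) - mmult n (b i) (\<phi> i) (\<psi> i)) c c' 1 = 0"
    proof (cases i)
      case 0
      then show ?thesis
        using h'(1) by (simp only: mmult_at_1[OF n] minimal mult_zero_left sum.neutral_const)
    next
      case (Suc k)
      then show ?thesis
        by (simp only: h'(2) plus_fun_apply mmult_at_1[OF n] minimal mult_zero_left mult_zero_right sum.neutral_const add_0)
    qed
    then show "(\<Sum>l<b i. \<phi> i c l 1 * \<psi> i l c' 1) = (if c = c' then 1 else 0)"
      unfolding at1 using c by (auto simp: mone_def dunit_def)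
  next
    fix c s
    show "(\<Sum>l<b i. \<phi> i c l 1 * D i l s 1) = 0"
      unfolding at1 \<phi>(3)[symmetric] unfolding mmult_at_1[OF n]
      by (simp only: minimal mult_zero_left sum.neutral_const)
  next
    fix x :: "nat \<Rightarrow> 'k"
    assume "\<forall>k. i = Suc k \<longrightarrow> (\<forall>r<b k. (\<Sum>l<b i. D k r l 1 * x l) = 0)"
    then have cycs: "\<And>k r. i = Suc k \<Longrightarrow> r < b k \<Longrightarrow> (\<Sum>l<b i. D k r l 1 * x l) = 0"
      by blast
    show "\<exists>y. \<forall>r<b i. x r - (\<Sum>c<b' i. \<psi> i r c 1 * (\<Sum>l<b i. \<phi> i c l 1 * x l))
        = (\<Sum>s<b (Suc i). D i r s 1 * y s)"
    \<comment> \<open>The witness is the homotopy applied to x. The second homotopy term factors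
      through the differential of x, which is 0 for a cycle.\<close>
    proof (intro exI[of _ "\<lambda>s. \<Sum>l<b i. h i s l 1 * x l"] allI impI)
      fix r assume r: "r < b i"
      have mv: "(\<Sum>c<q. X r c 1 * (\<Sum>l<p. Y c l 1 * x l)) = (\<Sum>l<p. mmult n q X Y r l 1 * x l)"
        for p q and X Y :: "'k mtx"
        unfolding mmult_at_1[OF n] sum_distrib_left sum_distrib_right
        by (subst sum.swap) (simp only: mult.assoc)
      have "x r = (\<Sum>l<b i. if r = l then x l else 0)"
        using r by simp
      also have "\<dots> = (\<Sum>l<b i. mone (b i) r l 1 * x l)"
        using r by (intro sum.cong) (auto simp: mone_def dunit_def)
      finally have "x r - (\<Sum>c<b' i. \<psi> i r c 1 * (\<Sum>l<b i. \<phi> i c l 1 * x l))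
          = (\<Sum>l<b i. (mone (b i) - mmult n (b' i) (\<psi> i) (\<phi> i)) r l 1 * x l)"
        by (simp only: mv fun_diff_def left_diff_distrib sum_subtractf)
      also have "\<dots> = (\<Sum>l<b i. mmult n (b (Suc i)) (D i) (h i) r l 1 * x l)"
      proof (cases i)
        case 0
        then show ?thesis
          using h(1) by simp
      next
        case (Suc k)
        have "(\<Sum>l<b i. mmult n (b k) (h k) (D k) r l 1 * x l) = (\<Sum>c<b k. h k r c 1 * (\<Sum>l<b i. D k c l 1 * x l))"
          by (rule mv[symmetric])
        also have "\<dots> = 0"
          using cycs[OF Suc] by (intro sum.neutral) auto
        finally have "(\<Sum>l<b i. mmult n (b k) (h k) (D k) r l 1 * x l) = 0" .
        then show ?thesis
          unfolding Suc h(2) by (simp only: plus_fun_apply distrib_right sum.distrib add_0_right Suc)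
      qed
      also have "\<dots> = (\<Sum>s<b (Suc i). D i r s 1 * (\<Sum>l<b i. h i s l 1 * x l))"
        by (rule mv[symmetric])
      finally show "x r - (\<Sum>c<b' i. \<psi> i r c 1 * (\<Sum>l<b i. \<phi> i c l 1 * x l))
          = (\<Sum>s<b (Suc i). D i r s 1 * (\<Sum>l<b i. h i s l 1 * x l))" .
    qed
  qed
qed


section \<open>Modules and resolutions\<close>

lemma restrict_eq_iff: "restrict f A = restrict g A \<longleftrightarrow> (\<forall>i\<in>A. f i = g i)"
proof
  assume eq: "restrict f A = restrict g A"
  show "\<forall>i\<in>A. f i = g i"
    using eq by (metis restrict_apply')
qed (auto intro: restrict_ext)

text \<open>Homology is only a record, without module axioms. They are transported along f from a
  known space instead of being checked on cosets.\<close>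

lemma vectorspace_transfer:
  assumes V: "vectorspace K V" and f: "bij_betw f (carrier V) (carrier Q)"
    and add: "\<And>x y. x \<in> carrier V \<Longrightarrow> y \<in> carrier V \<Longrightarrow> f (x \<oplus>\<^bsub>V\<^esub> y) = f x \<oplus>\<^bsub>Q\<^esub> f y"
    and smult: "\<And>c x. c \<in> carrier K \<Longrightarrow> x \<in> carrier V \<Longrightarrow> f (c \<odot>\<^bsub>V\<^esub> x) = c \<odot>\<^bsub>Q\<^esub> f x"
    and zero: "f \<zero>\<^bsub>V\<^esub> = \<zero>\<^bsub>Q\<^esub>"
  shows "vectorspace K Q" "vectorspace.fin_dim K V \<Longrightarrow> vectorspace.dim K Q = vectorspace.dim K V"
proof -
  interpret V: vectorspace K V by (rule V)
  have surj: "\<exists>u \<in> carrier V. x = f u" if "x \<in> carrier Q" for x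
    using that f by (auto simp: bij_betw_def)
  have f_in: "f u \<in> carrier Q" if "u \<in> carrier V" for u
    using that f by (auto simp: bij_betw_def)
  have grp: "abelian_group Q"
  proof (rule abelian_groupI)
    fix x y z assume "x \<in> carrier Q" "y \<in> carrier Q" "z \<in> carrier Q"
    then obtain u v w where "u \<in> carrier V" "v \<in> carrier V" "w \<in> carrier V" "x = f u" "y = f v" "z = f w"
      using surj by metis
    then show "x \<oplus>\<^bsub>Q\<^esub> y \<oplus>\<^bsub>Q\<^esub> z = x \<oplus>\<^bsub>Q\<^esub> (y \<oplus>\<^bsub>Q\<^esub> z)"
      by (simp add: V.a_assoc flip: add)
  next
    fix x y assume "x \<in> carrier Q" "y \<in> carrier Q"
    then obtain u v where "u \<in> carrier V" "v \<in> carrier V" "x = f u" "y = f v"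
      using surj by metis
    then show "x \<oplus>\<^bsub>Q\<^esub> y \<in> carrier Q" "x \<oplus>\<^bsub>Q\<^esub> y = y \<oplus>\<^bsub>Q\<^esub> x"
      by (simp_all add: V.a_comm f_in flip: add)
  next
    fix x assume "x \<in> carrier Q"
    then obtain u where u: "u \<in> carrier V" "x = f u"
      using surj by metis
    then show "\<zero>\<^bsub>Q\<^esub> \<oplus>\<^bsub>Q\<^esub> x = x" by (simp flip: add zero)
    show "\<exists>y\<in>carrier Q. y \<oplus>\<^bsub>Q\<^esub> x = \<zero>\<^bsub>Q\<^esub>"
      using u by (intro bexI[of _ "f (\<ominus>\<^bsub>V\<^esub> u)"]) (simp_all add: V.l_neg f_in flip: add zero)
  qed (use f_in in \<open>auto simp flip: zero\<close>)
  have mod: "module K Q"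
  proof (rule moduleI[OF V.R.is_cring grp])
    fix a b x y assume *: "a \<in> carrier K" "b \<in> carrier K" "x \<in> carrier Q" "y \<in> carrier Q"
    then obtain u v where u: "u \<in> carrier V" "v \<in> carrier V" "x = f u" "y = f v"
      using surj by metis
    show "(a \<oplus>\<^bsub>K\<^esub> b) \<odot>\<^bsub>Q\<^esub> x = a \<odot>\<^bsub>Q\<^esub> x \<oplus>\<^bsub>Q\<^esub> b \<odot>\<^bsub>Q\<^esub> x"
      using u * by (simp add: V.smult_l_distr flip: add smult)
    show "a \<odot>\<^bsub>Q\<^esub> (x \<oplus>\<^bsub>Q\<^esub> y) = a \<odot>\<^bsub>Q\<^esub> x \<oplus>\<^bsub>Q\<^esub> a \<odot>\<^bsub>Q\<^esub> y"
      using u * by (simp add: V.smult_r_distr flip: add smult)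
    show "(a \<otimes>\<^bsub>K\<^esub> b) \<odot>\<^bsub>Q\<^esub> x = a \<odot>\<^bsub>Q\<^esub> (b \<odot>\<^bsub>Q\<^esub> x)"
      using u * by (simp add: V.smult_assoc1 flip: smult)
  next
    fix a x assume *: "a \<in> carrier K" "x \<in> carrier Q"
    then obtain u where u: "u \<in> carrier V" "x = f u"
      using surj by metis
    show "a \<odot>\<^bsub>Q\<^esub> x \<in> carrier Q"
      using u * by (simp add: f_in flip: smult)
  next
    fix x assume *: "x \<in> carrier Q"
    then obtain u where u: "u \<in> carrier V" "x = f u"
      using surj by metis
    then show "\<one>\<^bsub>K\<^esub> \<odot>\<^bsub>Q\<^esub> x = x" by (simp flip: smult)
  qed
  then show Q: "vectorspace K Q"
    using V by (simp add: vectorspace_def)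
  interpret Q: vectorspace K Q by (rule Q)
  interpret f: linear_map K V Q f by unfold_locales (auto simp: module_hom_def add smult f_in)
  show "vectorspace.dim K Q = vectorspace.dim K V" if "vectorspace.fin_dim K V"
    using f.dim_eq[OF that] f by (simp add: bij_betw_def)
qed

section \<open>Module records and plain sums\<close>

lemma residue_module_simps [simp]:
  "carrier residue_module = UNIV" "add residue_module = (+)" "zero residue_module = 0"
  "module.smult residue_module = (\<lambda>f c. f 1 * c)" by (auto simp: residue_module_def)

lemma residue_module_finsum:
  fixes f :: "'a \<Rightarrow> 'b::field"
  assumes fin: "finite A"
  shows "finsum residue_module f A = sum f A"
proof -
  interpret abelian_monoid "residue_module :: (nat \<Rightarrow> 'b::field, 'b) module"
    by (rule abelian_monoidI) (auto simp: add.commute add.left_commute)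
  show "finsum residue_module f A = sum f A"
    using fin by (induction A) auto
qed

lemma dirichlet_ring_simps [simp]:
  "carrier (dirichlet_ring n) = dring n" "mult (dirichlet_ring n) = dconv n"
  "add (dirichlet_ring n) = (+)" "zero (dirichlet_ring n) = 0"
  by (auto simp: dirichlet_ring_def dring_def dconv_def fun_eq_iff)

lemma regular_module_simps [simp]:
  "carrier (regular_module R) = carrier R" "add (regular_module R) = add R"
  "zero (regular_module R) = zero R" "module.smult (regular_module R) = mult R"
  by (auto simp: regular_module_def)

lemma regular_module_finsum:
  fixes f :: "'a \<Rightarrow> nat \<Rightarrow> 'b::field_char_0"
  assumes "finite A" "\<And>i. i \<in> A \<Longrightarrow> f i \<in> dring n"
  shows "finsum (regular_module (dirichlet_ring n)) f A = sum f A"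
proof -
  interpret abelian_monoid "regular_module (dirichlet_ring n) :: (nat \<Rightarrow> 'b, nat \<Rightarrow> 'b) module"
    by (rule abelian_monoidI) (simp_all add: dring_add add.assoc add.commute fun_eq_iff)
  show ?thesis
    using assms
  proof (induction A)
    case (insert x A)
    have "finsum (regular_module (dirichlet_ring n)) f (insert x A)
        = f x \<oplus>\<^bsub>regular_module (dirichlet_ring n)\<^esub> finsum (regular_module (dirichlet_ring n)) f A"
      by (rule finsum_insert) (use insert in auto)
    also have "\<dots> = f x + sum f A"
      using insert by simp
    also have "\<dots> = sum f (insert x A)"
      using insert(1,2) by (rule sum.insert[symmetric])
    finally show ?case .
  qed simp
qed

lemma power_module_simps [simp]:
  "carrier (power_module N b) = {..<b} \<rightarrow>\<^sub>E carrier N"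
  "zero (power_module N b) = (\<lambda>i\<in>{..<b}. \<zero>\<^bsub>N\<^esub>)"
  "add (power_module N b) = (\<lambda>v w. \<lambda>i\<in>{..<b}. v i \<oplus>\<^bsub>N\<^esub> w i)"
  "module.smult (power_module N b) = (\<lambda>a v. \<lambda>i\<in>{..<b}. a \<odot>\<^bsub>N\<^esub> v i)"
  by (auto simp: power_module_def)

definition mapply :: "nat \<Rightarrow> (nat \<Rightarrow> nat) \<Rightarrow> (nat \<Rightarrow> 'k::field_char_0 mtx) \<Rightarrow> nat \<Rightarrow> (nat \<Rightarrow> nat \<Rightarrow> 'k) \<Rightarrow> nat \<Rightarrow> nat \<Rightarrow> 'k" where
  "mapply n b D k v = (\<lambda>i\<in>{..<b k}. \<Sum>j<b (Suc k). dconv n (D k i j) (v j))"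

text \<open>The case \<open>0\<close> is the kernel of the augmentation, so that exactness has the
  same form in every degree.\<close>

definition cycs :: "nat \<Rightarrow> (nat \<Rightarrow> nat) \<Rightarrow> (nat \<Rightarrow> 'k::field_char_0 mtx) \<Rightarrow> (nat \<Rightarrow> 'k) \<Rightarrow> nat \<Rightarrow> (nat \<Rightarrow> nat \<Rightarrow> 'k) set" where
  "cycs n b D e k = {v \<in> {..<b k} \<rightarrow>\<^sub>E dring n.
     case k of 0 \<Rightarrow> (\<Sum>i<b 0. v i 1 * e i) = 0 | Suc k' \<Rightarrow> \<forall>i<b k'. (\<Sum>j<b k. dconv n (D k' i j) (v j)) = 0}"

lemma differential_regular:
  "differential (regular_module (dirichlet_ring n)) b D k v = mapply n b D k v"
  unfolding differential_def mapply_def by (intro restrict_ext) (simp add: regular_module_finsum)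

lemma differential_residue:
  "differential residue_module b D k v = (\<lambda>i\<in>{..<b k}. \<Sum>j<b (Suc k). D k i j 1 * v j)"
  unfolding differential_def by (intro restrict_ext) (simp add: residue_module_finsum)

lemma augmentation_residue: "augmentation residue_module b e v = (\<Sum>j<b 0. v j 1 * e j)"
  by (simp add: augmentation_def residue_module_finsum)

lemma augmentation_surj_iff:
  assumes "1 \<le> n"
  shows "augmentation residue_module b e ` ({..<b 0} \<rightarrow>\<^sub>E dring n) = UNIV \<longleftrightarrow> (\<exists>j<b 0. e j \<noteq> 0)"
proof
  assume "augmentation residue_module b e ` ({..<b 0} \<rightarrow>\<^sub>E dring n) = UNIV"
  then obtain v where "1 = augmentation residue_module b e v" by (metis UNIV_I imageE)
  then have "(\<Sum>j<b 0. v j 1 * e j) \<noteq> 0" by (simp add: augmentation_residue)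
  then obtain j where "j \<in> {..<b 0}" "v j 1 * e j \<noteq> 0"
    by (rule sum.not_neutral_contains_not_neutral)
  then show "\<exists>j<b 0. e j \<noteq> 0" by auto
next
  assume "\<exists>j<b 0. e j \<noteq> 0"
  then obtain j where j: "j < b 0" "e j \<noteq> 0" by blast
  have "c \<in> augmentation residue_module b e ` ({..<b 0} \<rightarrow>\<^sub>E dring n)" for c
  proof (rule image_eqI)
    let ?v = "\<lambda>i\<in>{..<b 0}. \<lambda>m. if i = j \<and> m = 1 then c / e j else 0"
    show "?v \<in> {..<b 0} \<rightarrow>\<^sub>E dring n"
      using assms by (auto simp: dring_def)
    have "(\<Sum>i<b 0. ?v i 1 * e i) = (\<Sum>i<b 0. if i = j then c else 0)"
      using j by (intro sum.cong) auto
    then show "c = augmentation residue_module b e ?v"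
      using j by (simp add: augmentation_residue)
  qed
  then show "augmentation residue_module b e ` ({..<b 0} \<rightarrow>\<^sub>E dring n) = UNIV"
    by blast
qed

lemma is_free_resolution_iff:
  assumes "1 \<le> n"
  shows "is_free_resolution (dirichlet_ring n) residue_module b D e \<longleftrightarrow>
    (\<forall>k. \<forall>i<b k. \<forall>j<b (Suc k). D k i j \<in> dring n) \<and> (\<exists>j<b 0. e j \<noteq> 0) \<and>
    (\<forall>k. cycs n b D e k = mapply n b D k ` ({..<b (Suc k)} \<rightarrow>\<^sub>E dring n))"
proof -
  have 0: "{v \<in> {..<b 0} \<rightarrow>\<^sub>E dring n. augmentation residue_module b e v = 0} = cycs n b D e 0"
    by (simp add: cycs_def augmentation_residue)
  have "mapply n b D k v = (\<lambda>i\<in>{..<b k}. 0) \<longleftrightarrow> (\<forall>i<b k. (\<Sum>j<b (Suc k). dconv n (D k i j) (v j)) = 0)" for k v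
    unfolding mapply_def by (simp only: restrict_eq_iff lessThan_iff Ball_def)
  then have Suc: "cycles (regular_module (dirichlet_ring n)) b D (Suc k) = cycs n b D e (Suc k)" for k
    by (simp add: cycles_def cycs_def differential_regular)
  have bd: "boundaries (regular_module (dirichlet_ring n)) b D k
      = mapply n b D k ` ({..<b (Suc k)} \<rightarrow>\<^sub>E dring n)" for k
    by (simp add: boundaries_def differential_regular)
  have all: "(\<forall>k. P k) \<longleftrightarrow> P 0 \<and> (\<forall>k. P (Suc k))" for P :: "nat \<Rightarrow> bool"
    by (metis not0_implies_Suc)
  have "(\<forall>k. cycs n b D e k = mapply n b D k ` ({..<b (Suc k)} \<rightarrow>\<^sub>E dring n)) \<longleftrightarrow>
      cycs n b D e 0 = mapply n b D 0 ` ({..<b (Suc 0)} \<rightarrow>\<^sub>E dring n) \<and>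
      (\<forall>k. cycs n b D e (Suc k) = mapply n b D (Suc k) ` ({..<b (Suc (Suc k))} \<rightarrow>\<^sub>E dring n))"
    by (rule all)
  then show ?thesis
    unfolding is_free_resolution_def Suc bd
    using 0 augmentation_surj_iff[OF assms, of b e] by simp
qed

text \<open>\<open>is_free_resolution\<close> leaves matrix entries outside the ranks arbitrary,
  while \<open>mats\<close> wants them to be 0. Clearing them changes neither cycles nor
  images.\<close>

definition trunc :: "(nat \<Rightarrow> nat) \<Rightarrow> (nat \<Rightarrow> 'k::field_char_0 mtx) \<Rightarrow> nat \<Rightarrow> 'k mtx" where
  "trunc b D k i j = (if i < b k \<and> j < b (Suc k) then D k i j else 0)"

lemma mapply_trunc: "mapply n b (trunc b D) = mapply n b D"
  by (intro ext) (simp add: mapply_def trunc_def restrict_def)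

lemma cycs_trunc: "cycs n b (trunc b D) = cycs n b D"
  by (intro ext) (auto simp: cycs_def trunc_def split: nat.splits)

lemma killed_iff_cycs:
  assumes D: "\<And>k. D k \<in> mats n (b k) (b (Suc k))" and X: "X \<in> mats n (b k) c"
  shows "killed n b D e k X \<longleftrightarrow> (\<forall>j<c. (\<lambda>i\<in>{..<b k}. X i j) \<in> cycs n b D e k)"
proof (cases k)
  case 0
  have "(\<Sum>i<b 0. X i j 1 * e i) = 0" if "\<not> j < c" for j
    using matsD(2)[OF X, of _ j] that by simp
  then show ?thesis
    using 0 matsD(1)[OF X] by (auto simp: killed_def cycs_def)
next
  case (Suc k')
  have "mmult n (b k) (D k') X = 0 \<longleftrightarrow> (\<forall>i j. (\<Sum>l<b k. dconv n (D k' i l) (X l j)) = 0)"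
    by (simp add: mmult_def fun_eq_iff)
  also have "\<dots> \<longleftrightarrow> (\<forall>j<c. \<forall>i<b k'. (\<Sum>l<b k. dconv n (D k' i l) (X l j)) = 0)"
  proof -
    have "(\<Sum>l<b k. dconv n (D k' i l) (X l j)) = 0" if "\<not> (j < c \<and> i < b k')" for i j
    proof (rule sum.neutral, rule ballI)
      fix l
      have "D k' i l = 0 \<or> X l j = 0"
        using matsD(2)[OF X, of l j] matsD(2)[OF D, of i k' l] that by blast
      then show "dconv n (D k' i l) (X l j) = 0" by (metis dconv_zero(1,2))
    qed
    then show ?thesis by blast
  qed
  finally show ?thesis
    using Suc matsD(1)[OF X] by (simp add: killed_def cycs_def)
qed

lemma column_matrix:
  assumes "v \<in> {..<r} \<rightarrow>\<^sub>E dring n"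
  shows "(\<lambda>i j. if i < r \<and> j = 0 then v i else 0) \<in> mats n r 1"
    "(\<lambda>i\<in>{..<r}. if i < r \<and> (0::nat) = 0 then v i else 0) = v"
  using assms by (auto simp: mats_def fun_eq_iff PiE_def extensional_def)

text \<open>A matrix is a tuple of columns: exactness on vectors is the case of one column, and
  conversely preimages are chosen column by column.\<close>

lemma mresolution_iff_cycs:
  assumes n: "1 \<le> n" and D: "\<And>k. D k \<in> mats n (b k) (b (Suc k))"
  shows "mresolution n b D e \<longleftrightarrow> (\<exists>j<b 0. e j \<noteq> 0) \<and>
    (\<forall>k. cycs n b D e k = mapply n b D k ` ({..<b (Suc k)} \<rightarrow>\<^sub>E dring n))"
proof
  assume M: "mresolution n b D e"
  have "cycs n b D e k = mapply n b D k ` ({..<b (Suc k)} \<rightarrow>\<^sub>E dring n)" for k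
  proof (intro equalityI subsetI)
    fix v assume v: "v \<in> cycs n b D e k"
    define X where "X = (\<lambda>i j. if i < b k \<and> j = (0::nat) then v i else 0)"
    have vE: "v \<in> {..<b k} \<rightarrow>\<^sub>E dring n"
      using v by (simp add: cycs_def)
    note X = column_matrix[OF vE, folded X_def]
    have X0: "(\<lambda>i\<in>{..<b k}. X i 0) = v"
      using X(2) by (simp add: X_def)
    then have "killed n b D e k X"
      using v by (subst killed_iff_cycs[OF D X(1)]) simp
    then obtain Y where Y: "Y \<in> mats n (b (Suc k)) 1" "X = mmult n (b (Suc k)) (D k) Y"
      using mresolutionD(4)[OF M X(1)] by blast
    show "v \<in> mapply n b D k ` ({..<b (Suc k)} \<rightarrow>\<^sub>E dring n)"
    proof (rule image_eqI)
      show "(\<lambda>i\<in>{..<b (Suc k)}. Y i 0) \<in> {..<b (Suc k)} \<rightarrow>\<^sub>E dring n"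
        using matsD(1)[OF Y(1)] by auto
      show "v = mapply n b D k (\<lambda>i\<in>{..<b (Suc k)}. Y i 0)"
        unfolding X0[symmetric] Y(2) mapply_def mmult_def by (intro restrict_ext) simp
    qed
  next
    fix v assume "v \<in> mapply n b D k ` ({..<b (Suc k)} \<rightarrow>\<^sub>E dring n)"
    then obtain w where w: "w \<in> {..<b (Suc k)} \<rightarrow>\<^sub>E dring n" "v = mapply n b D k w"
      by blast
    define Y where "Y = (\<lambda>i j. if i < b (Suc k) \<and> j = (0::nat) then w i else 0)"
    note Y = column_matrix(1)[OF w(1), folded Y_def]
    have "killed n b D e k (mmult n (b (Suc k)) (D k) Y)"
      by (intro killed_mmult n mresolutionD(2)[OF M])
    then have "(\<lambda>i\<in>{..<b k}. mmult n (b (Suc k)) (D k) Y i 0) \<in> cycs n b D e k"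
      by (subst (asm) killed_iff_cycs[OF D mmult_mats[OF D Y]]) simp
    also have "(\<lambda>i\<in>{..<b k}. mmult n (b (Suc k)) (D k) Y i 0) = v"
      unfolding w(2) mapply_def mmult_def Y_def by (intro restrict_ext) simp
    finally show "v \<in> cycs n b D e k" .
  qed
  then show "(\<exists>j<b 0. e j \<noteq> 0) \<and>
    (\<forall>k. cycs n b D e k = mapply n b D k ` ({..<b (Suc k)} \<rightarrow>\<^sub>E dring n))"
    using mresolutionD(3)[OF M] by blast
next
  assume R: "(\<exists>j<b 0. e j \<noteq> 0) \<and>
    (\<forall>k. cycs n b D e k = mapply n b D k ` ({..<b (Suc k)} \<rightarrow>\<^sub>E dring n))"
  have "killed n b D e k (D k)" for k
  proof (subst killed_iff_cycs[where D = D and b = b, OF D D], intro allI impI)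
    fix j assume j: "j < b (Suc k)"
    \<comment> \<open>Each column of D is the image of a standard basis vector, hence a boundary,
      hence a cycle.\<close>
    have "(\<lambda>i\<in>{..<b k}. D k i j) = mapply n b D k (\<lambda>l\<in>{..<b (Suc k)}. if l = j then dunit else 0)"
      unfolding mapply_def
    proof (intro restrict_ext)
      fix i assume "i \<in> {..<b k}"
      have "(\<Sum>l<b (Suc k). dconv n (D k i l) (restrict (\<lambda>l. if l = j then dunit else 0) {..<b (Suc k)} l))
          = (\<Sum>l<b (Suc k). if l = j then D k i j else 0)"
        using dconv_one[OF matsD(1)[OF D]] by (intro sum.cong) (auto simp: dconv_comm[of n _ dunit])
      then show "D k i j = (\<Sum>l<b (Suc k). dconv n (D k i l) (restrict (\<lambda>l. if l = j then dunit else 0) {..<b (Suc k)} l))"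
        using j by simp
    qed
    also have "\<dots> \<in> cycs n b D e k"
      using R n by (auto intro!: imageI)
    finally show "(\<lambda>i\<in>{..<b k}. D k i j) \<in> cycs n b D e k" .
  qed
  moreover have "\<exists>Y \<in> mats n (b (Suc k)) c. X = mmult n (b (Suc k)) (D k) Y"
    if X: "X \<in> mats n (b k) c" and kX: "killed n b D e k X" for k c X
  proof -
    have "\<exists>w. j < c \<longrightarrow> w \<in> {..<b (Suc k)} \<rightarrow>\<^sub>E dring n \<and> (\<lambda>i\<in>{..<b k}. X i j) = mapply n b D k w" for j
      using kX R unfolding killed_iff_cycs[OF D X] by blast
    then obtain w where w: "\<And>j. j < c \<Longrightarrow> w j \<in> {..<b (Suc k)} \<rightarrow>\<^sub>E dring n"
      "\<And>j. j < c \<Longrightarrow> (\<lambda>i\<in>{..<b k}. X i j) = mapply n b D k (w j)"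
      by metis
    define Y where "Y = (\<lambda>i j. if i < b (Suc k) \<and> j < c then w j i else 0)"
    have Y: "Y \<in> mats n (b (Suc k)) c"
      using w(1) by (auto simp: mats_def Y_def)
    have "X i j = mmult n (b (Suc k)) (D k) Y i j" for i j
    proof (cases "i < b k \<and> j < c")
      case True
      then have "X i j = mapply n b D k (w j) i"
        using w(2)[of j] by (metis lessThan_iff restrict_apply')
      then show ?thesis
        using True by (simp add: mapply_def mmult_def Y_def)
    next
      case False
      then show ?thesis
        using matsD(2)[OF X False] matsD(2)[OF mmult_mats[OF D Y] False] by simp
    qed
    then show ?thesis
      using Y by blast
  qed
  ultimately show "mresolution n b D e"
    unfolding mresolution_def using D R by blast
qed

lemma mresolution_trunc:
  assumes "1 \<le> n" "is_free_resolution (dirichlet_ring n) residue_module b D e"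
  shows "mresolution n b (trunc b D) e"
proof -
  note R = assms(2)[unfolded is_free_resolution_iff[OF assms(1)]]
  have "trunc b D k \<in> mats n (b k) (b (Suc k))" for k
    using R by (auto simp: mats_def trunc_def)
  then show ?thesis
    using R by (subst mresolution_iff_cycs[OF assms(1)]) (simp_all add: mapply_trunc cycs_trunc)
qed

lemma mresolution_is_free_resolution:
  assumes "1 \<le> n" "mresolution n b D e"
  shows "is_free_resolution (dirichlet_ring n) residue_module b D e"
proof -
  note D = mresolutionD(1)[OF assms(2)]
  show ?thesis
    unfolding is_free_resolution_iff[OF assms(1)]
    using mresolution_iff_cycs[where D = D and b = b and e = e, OF assms(1) D] assms(2) matsD(1)[OF D]
    by blast
qed

section \<open>The dimension of Tor\<close>

text \<open>Modulo the maximal ideal the comparison maps give P from K^(b' i) into the cycles and S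
  back. S kills boundaries, S P is the identity, and P S is the identity modulo boundaries, so P
  induces an isomorphism onto homology.\<close>

lemma dim_homology_residue:
  fixes D D' :: "nat \<Rightarrow> 'k::field_char_0 mtx" and e e' :: "nat \<Rightarrow> 'k" and R :: "(nat \<Rightarrow> 'k, 'm) ring_scheme"
  assumes n: "1 \<le> n" and F: "mresolution n b (trunc b D) e" and G: "mresolution n b' D' e'"
    and minimal: "\<And>k i j. D' k i j 1 = 0"
  shows "vectorspace.dim (class_ring :: 'k ring)
     (restrict_scalars scalar (homology_module R residue_module b D i)) = b' i"
proof -
  define m where "m = b i"
  define E where "E = {..<m} \<rightarrow>\<^sub>E (UNIV :: 'k set)"
  define Z where "Z = cycles residue_module b D i"
  define B where "B = boundaries residue_module b D i"
  define M where "M = (power_module (residue_module :: (nat \<Rightarrow> 'k, 'k) module) m)\<lparr>carrier := Z\<rparr>"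
  define Q where "Q = restrict_scalars (scalar :: 'k \<Rightarrow> _) (homology_module R residue_module b D i)"
  obtain P S :: "nat \<Rightarrow> nat \<Rightarrow> 'k" where
    PS: "\<And>k r c. i = Suc k \<Longrightarrow> (\<Sum>l<b i. trunc b D k r l 1 * P l c) = 0"
    "\<And>c c'. c < b' i \<Longrightarrow> (\<Sum>l<b i. S c l * P l c') = (if c = c' then 1 else 0)"
    "\<And>c s. (\<Sum>l<b i. S c l * trunc b D i l s 1) = 0"
    "\<And>x. \<forall>k. i = Suc k \<longrightarrow> (\<forall>r<b k. (\<Sum>l<b i. trunc b D k r l 1 * x l) = 0) \<Longrightarrow>
       \<exists>y. \<forall>r<b i. x r - (\<Sum>c<b' i. P r c * (\<Sum>l<b i. S c l * x l)) = (\<Sum>s<b (Suc i). trunc b D i r s 1 * y s)"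
    by (rule minimal_resolution_tor[OF n F G minimal, of i], rule that, assumption+)
  have Z_iff: "x \<in> Z \<longleftrightarrow> x \<in> E \<and> (\<forall>k. i = Suc k \<longrightarrow> (\<forall>r<b k. (\<Sum>l<m. D k r l 1 * x l) = 0))" for x
    unfolding Z_def cycles_def m_def
    by (cases i) (auto simp: E_def m_def differential_residue restrict_eq_iff)
  have B_iff: "x \<in> B \<longleftrightarrow> x \<in> E \<and> (\<exists>y. \<forall>r<m. x r = (\<Sum>s<b (Suc i). D i r s 1 * y s))" for x
  proof
    assume "x \<in> B"
    then obtain y where y: "x = (\<lambda>r\<in>{..<m}. \<Sum>s<b (Suc i). D i r s 1 * y s)"
      unfolding B_def boundaries_def differential_residue m_def by blast
    show "x \<in> E \<and> (\<exists>y. \<forall>r<m. x r = (\<Sum>s<b (Suc i). D i r s 1 * y s))"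
      unfolding y by (intro conjI exI[of _ y]) (simp_all add: E_def)
  next
    assume *: "x \<in> E \<and> (\<exists>y. \<forall>r<m. x r = (\<Sum>s<b (Suc i). D i r s 1 * y s))"
    then obtain y where y: "\<forall>r<m. x r = (\<Sum>s<b (Suc i). D i r s 1 * y s)" by blast
    have "x = (\<lambda>r\<in>{..<m}. \<Sum>s<b (Suc i). D i r s 1 * (restrict y {..<b (Suc i)}) s)"
    proof
      fix r
      show "x r = (\<lambda>r\<in>{..<m}. \<Sum>s<b (Suc i). D i r s 1 * (restrict y {..<b (Suc i)}) s) r"
        using * y by (cases "r < m") (auto simp: E_def PiE_def extensional_def)
    qed
    then show "x \<in> B"
      unfolding B_def boundaries_def differential_residue m_def
      by (intro image_eqI[of _ _ "restrict y {..<b (Suc i)}"]) simp_all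
  qed
  have B_add: "(\<lambda>r\<in>{..<m}. x r + y r) \<in> B" if "x \<in> B" "y \<in> B" for x y
  proof -
    from that obtain u v where "\<forall>r<m. x r = (\<Sum>s<b (Suc i). D i r s 1 * u s)"
      "\<forall>r<m. y r = (\<Sum>s<b (Suc i). D i r s 1 * v s)"
      unfolding B_iff by blast
    then show ?thesis
      unfolding B_iff by (intro conjI exI[of _ "\<lambda>s. u s + v s"]) (auto simp: E_def distrib_left sum.distrib)
  qed
  have B_smult: "(\<lambda>r\<in>{..<m}. c * x r) \<in> B" if "x \<in> B" for x c
  proof -
    from that obtain u where "\<forall>r<m. x r = (\<Sum>s<b (Suc i). D i r s 1 * u s)"
      unfolding B_iff by blast
    then show ?thesis
      unfolding B_iff
      by (intro conjI exI[of _ "\<lambda>s. c * u s"]) (auto simp: E_def sum_distrib_left ac_simps)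
  qed
  have B_zero: "(\<lambda>r\<in>{..<m}. 0) \<in> B"
    unfolding B_iff by (intro conjI exI[of _ "\<lambda>s. 0"]) (auto simp: E_def)
  \<comment> \<open>The coset of x, described by differences; its arithmetic follows pointwise from
    the closure of B under addition and scalars.\<close>
  define q where "q x = {z \<in> E. (\<lambda>r\<in>{..<m}. z r - x r) \<in> B}" for x
  have M_add: "add M = (\<lambda>v w. \<lambda>i\<in>{..<m}. v i + w i)" by (simp add: M_def)
  have coset: "B +>\<^bsub>M\<^esub> x = q x" if x: "x \<in> E" for x
  proof (intro equalityI subsetI)
    fix z assume "z \<in> B +>\<^bsub>M\<^esub> x"
    then obtain \<beta> where \<beta>: "\<beta> \<in> B" "z = (\<lambda>r\<in>{..<m}. \<beta> r + x r)"
      by (auto simp: a_r_coset_def' M_def)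
    have "(\<lambda>r\<in>{..<m}. z r - x r) = (\<lambda>r\<in>{..<m}. 1 * \<beta> r)"
      by (intro restrict_ext) (simp add: \<beta>(2))
    then show "z \<in> q x"
      using B_smult[OF \<beta>(1), of 1] \<beta>(2) by (simp add: q_def E_def)
  next
    fix z assume z: "z \<in> q x"
    have "z r = (\<lambda>r\<in>{..<m}. (\<lambda>r\<in>{..<m}. z r - x r) r + x r) r" for r
      using z by (cases "r < m") (auto simp: q_def E_def PiE_def extensional_def)
    then have "z = (\<lambda>r\<in>{..<m}. (\<lambda>r\<in>{..<m}. z r - x r) r + x r)" by blast
    then have "z \<in> {(\<lambda>r\<in>{..<m}. z r - x r) \<oplus>\<^bsub>M\<^esub> x}"
      unfolding M_add by blast
    then show "z \<in> B +>\<^bsub>M\<^esub> x"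
      unfolding a_r_coset_def' using z by (intro UN_I[of "\<lambda>r\<in>{..<m}. z r - x r"]) (simp_all only: q_def mem_Collect_eq)
  qed
  have q_self: "x \<in> q x" if "x \<in> E" for x
    using that B_zero by (simp add: q_def)
  have q_eq: "q x = q y" if "(\<lambda>r\<in>{..<m}. x r - y r) \<in> B" for x y
  proof (intro equalityI subsetI)
    fix z assume z: "z \<in> q x"
    have "(\<lambda>r\<in>{..<m}. z r - y r) = (\<lambda>r\<in>{..<m}. (\<lambda>r\<in>{..<m}. z r - x r) r + (\<lambda>r\<in>{..<m}. x r - y r) r)"
      by (intro restrict_ext) simp
    then show "z \<in> q y"
      using B_add[OF _ that, of "\<lambda>r\<in>{..<m}. z r - x r"] z by (simp add: q_def)
  next
    fix z assume z: "z \<in> q y"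
    have "(\<lambda>r\<in>{..<m}. z r - x r) = (\<lambda>r\<in>{..<m}. (\<lambda>r\<in>{..<m}. z r - y r) r +
        (\<lambda>r\<in>{..<m}. (- 1) * (\<lambda>r\<in>{..<m}. x r - y r) r) r)"
      by (intro restrict_ext) simp
    then show "z \<in> q x"
      using B_add[OF _ B_smult[OF that, of "- 1"], of "\<lambda>r\<in>{..<m}. z r - y r"] z by (simp only: q_def mem_Collect_eq)
  qed
  have q_add: "q x <+>\<^bsub>M\<^esub> q y = q (\<lambda>r\<in>{..<m}. x r + y r)" if "x \<in> E" "y \<in> E" for x y
  proof (intro equalityI subsetI)
    fix z assume "z \<in> q x <+>\<^bsub>M\<^esub> q y"
    then obtain h k where hk: "h \<in> q x" "k \<in> q y" "z = (\<lambda>r\<in>{..<m}. h r + k r)"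
      unfolding set_add_def' M_add by blast
    have "(\<lambda>r\<in>{..<m}. z r - (\<lambda>r\<in>{..<m}. x r + y r) r)
        = (\<lambda>r\<in>{..<m}. (\<lambda>r\<in>{..<m}. h r - x r) r + (\<lambda>r\<in>{..<m}. k r - y r) r)"
      by (intro restrict_ext) (simp add: hk(3))
    then show "z \<in> q (\<lambda>r\<in>{..<m}. x r + y r)"
      using B_add[of "\<lambda>r\<in>{..<m}. h r - x r" "\<lambda>r\<in>{..<m}. k r - y r"] hk
      by (simp only: q_def mem_Collect_eq) (simp add: E_def)
  next
    fix z assume z: "z \<in> q (\<lambda>r\<in>{..<m}. x r + y r)"
    let ?h = "\<lambda>r\<in>{..<m}. z r - y r"
    have "(\<lambda>r\<in>{..<m}. ?h r - x r) = (\<lambda>r\<in>{..<m}. z r - (\<lambda>r\<in>{..<m}. x r + y r) r)"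
      by (intro restrict_ext) simp
    then have "?h \<in> q x"
      using z by (simp only: q_def mem_Collect_eq) (simp add: E_def)
    moreover have "y \<in> q y"
      using that by (intro q_self)
    moreover have "z = (\<lambda>r\<in>{..<m}. ?h r + y r)"
    proof
      fix r show "z r = (\<lambda>r\<in>{..<m}. ?h r + y r) r"
        using z by (cases "r < m") (auto simp: q_def E_def PiE_def extensional_def)
    qed
    ultimately show "z \<in> q x <+>\<^bsub>M\<^esub> q y"
      unfolding set_add_def' M_add by blast
  qed
  have q_smult: "(\<Union>h\<in>q x. B +>\<^bsub>M\<^esub> (\<lambda>r\<in>{..<m}. c * h r)) = q (\<lambda>r\<in>{..<m}. c * x r)" if "x \<in> E" for x c
  proof -
    have "B +>\<^bsub>M\<^esub> (\<lambda>r\<in>{..<m}. c * h r) = q (\<lambda>r\<in>{..<m}. c * x r)" if "h \<in> q x" for h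
    proof -
      have "(\<lambda>r\<in>{..<m}. (\<lambda>r\<in>{..<m}. c * h r) r - (\<lambda>r\<in>{..<m}. c * x r) r)
          = (\<lambda>r\<in>{..<m}. c * (\<lambda>r\<in>{..<m}. h r - x r) r)"
        by (intro restrict_ext) (simp add: right_diff_distrib)
      then have "(\<lambda>r\<in>{..<m}. (\<lambda>r\<in>{..<m}. c * h r) r - (\<lambda>r\<in>{..<m}. c * x r) r) \<in> B"
        using B_smult[of "\<lambda>r\<in>{..<m}. h r - x r" c] that by (simp only: q_def mem_Collect_eq)
      then show ?thesis by (subst coset) (auto simp: E_def intro!: q_eq)
    qed
    then show ?thesis
      using q_self[OF that] by blast
  qed
  have Q_carrier: "carrier Q = q ` Z"
  proof -
    have "carrier Q = (\<lambda>x. B +>\<^bsub>M\<^esub> x) ` Z"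
      unfolding Q_def restrict_scalars_def homology_module_def quotient_module_def Z_def[symmetric]
        B_def[symmetric] m_def[symmetric] M_def[symmetric] by (auto simp: A_RCOSETS_def' M_def)
    also have "\<dots> = q ` Z"
      using coset Z_iff by (intro image_cong) auto
    finally show ?thesis .
  qed
  have Q_zero: "zero Q = B"
    by (simp add: Q_def restrict_scalars_def homology_module_def quotient_module_def B_def)
  have Q_add: "add Q = set_add M"
    by (simp add: Q_def restrict_scalars_def homology_module_def quotient_module_def M_def m_def Z_def)
  have Q_smult: "module.smult Q c X = (\<Union>x\<in>X. B +>\<^bsub>M\<^esub> (\<lambda>r\<in>{..<m}. c * x r))" for c X
    by (simp add: Q_def restrict_scalars_def homology_module_def quotient_module_def M_def m_def Z_def B_def scalar_def)
  define pv where "pv u = (\<lambda>r\<in>{..<m}. \<Sum>c<b' i. P r c * u $ c)" for u :: "'k vec"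
  have pv_E: "pv u \<in> E" for u by (simp add: pv_def E_def)
  have Z_trunc: "(\<Sum>l<b i. trunc b D k r l 1 * x l) = (\<Sum>l<m. D k r l 1 * x l)" if "i = Suc k" "r < b k" for k r x
    using that by (intro sum.cong) (auto simp: trunc_def m_def)
  have pv_Z: "pv u \<in> Z" for u
  proof -
    have "(\<Sum>l<m. D k r l 1 * pv u l) = 0" if "i = Suc k" "r < b k" for k r
    proof -
      have "(\<Sum>l<m. D k r l 1 * pv u l) = (\<Sum>l<b i. trunc b D k r l 1 * (\<Sum>c<b' i. P l c * u $ c))"
        unfolding Z_trunc[OF that] by (intro sum.cong) (auto simp: pv_def)
      also have "\<dots> = (\<Sum>c<b' i. (\<Sum>l<b i. trunc b D k r l 1 * P l c) * u $ c)"
        unfolding sum_distrib_left sum_distrib_right by (subst sum.swap) (simp add: mult.assoc)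
      also have "\<dots> = 0"
        using PS(1)[OF that(1)] by simp
      finally show ?thesis .
    qed
    then show ?thesis
      using pv_E by (simp add: Z_iff)
  qed
  have B_trunc: "(\<Sum>s<b (Suc i). trunc b D i r s 1 * y s) = (\<Sum>s<b (Suc i). D i r s 1 * y s)" if "r < m" for r y
    using that by (intro sum.cong) (auto simp: trunc_def m_def)
  define V where "V = (module_vec TYPE('k) (b' i))"
  have V: "vectorspace class_ring V"
    unfolding V_def by (rule vec_vs)
  let ?f = "\<lambda>u. q (pv u)"
  have "inj_on ?f (carrier V)"
  proof (rule inj_onI)
    fix u v assume uv: "u \<in> carrier V" "v \<in> carrier V" "q (pv u) = q (pv v)"
    then have "pv u \<in> q (pv v)"
      using q_self[OF pv_E] by blast
    then obtain y where y: "\<And>r. r < m \<Longrightarrow> pv u r - pv v r = (\<Sum>s<b (Suc i). D i r s 1 * y s)"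
      unfolding q_def B_iff by auto
    have dims: "dim_vec u = b' i" "dim_vec v = b' i"
      using uv by (auto simp: V_def module_vec_def)
    show "u = v"
    proof (rule eq_vecI)
      fix c assume "c < dim_vec v"
      then have c: "c < b' i"
        using dims by simp
      have P_sum: "(\<Sum>l<m. S c l * pv w l) = w $ c" for w
      proof -
        have "(\<Sum>l<m. S c l * pv w l) = (\<Sum>l<b i. S c l * (\<Sum>c'<b' i. P l c' * w $ c'))"
          unfolding m_def by (intro sum.cong) (auto simp: pv_def m_def)
        also have "\<dots> = (\<Sum>c'<b' i. (\<Sum>l<b i. S c l * P l c') * w $ c')"
          unfolding sum_distrib_left sum_distrib_right by (subst sum.swap) (simp add: mult.assoc)
        also have "\<dots> = (\<Sum>c'<b' i. if c = c' then w $ c' else 0)"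
          using PS(2)[OF c] by (intro sum.cong) auto
        finally show ?thesis
          using c by simp
      qed
      \<comment> \<open>Applying S to the boundary \<open>pv u - pv v\<close> gives u - v on one
        side and 0 on the other.\<close>
      have "u $ c - v $ c = (\<Sum>l<m. S c l * (pv u l - pv v l))"
        by (simp add: right_diff_distrib sum_subtractf P_sum)
      also have "\<dots> = (\<Sum>l<b i. S c l * (\<Sum>s<b (Suc i). trunc b D i l s 1 * y s))"
        unfolding m_def[symmetric] using y B_trunc by (intro sum.cong) auto
      also have "\<dots> = (\<Sum>s<b (Suc i). (\<Sum>l<b i. S c l * trunc b D i l s 1) * y s)"
        unfolding sum_distrib_left sum_distrib_right by (subst sum.swap) (simp add: mult.assoc)
      also have "\<dots> = 0"
        using PS(3) by simp
      finally show "u $ c = v $ c" by simp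
    qed (simp add: dims)
  qed
  moreover have "?f ` carrier V = carrier Q"
  proof (intro equalityI subsetI)
    fix X assume "X \<in> carrier Q"
    then obtain x where x: "x \<in> Z" "X = q x" by (auto simp: Q_carrier)
    have "\<exists>y. \<forall>r<b i. x r - (\<Sum>c<b' i. P r c * (\<Sum>l<b i. S c l * x l)) = (\<Sum>s<b (Suc i). trunc b D i r s 1 * y s)"
      by (rule PS(4)) (use x(1) Z_trunc in \<open>simp add: Z_iff\<close>)
    then obtain y where y': "\<forall>r<b i. x r - (\<Sum>c<b' i. P r c * (\<Sum>l<b i. S c l * x l))
        = (\<Sum>s<b (Suc i). trunc b D i r s 1 * y s)" by blast
    have y: "x r - (\<Sum>c<b' i. P r c * (\<Sum>l<m. S c l * x l)) = (\<Sum>s<b (Suc i). D i r s 1 * y s)"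
      if "r < m" for r
      using y' that B_trunc[OF that, of y] by (simp only: m_def)
    \<comment> \<open>The preimage is S x, since x - P S x is a boundary.\<close>
    let ?u = "vec (b' i) (\<lambda>c. \<Sum>l<m. S c l * x l)"
    have "(\<lambda>r\<in>{..<m}. x r - pv ?u r) \<in> B"
      unfolding B_iff using y by (auto simp: E_def pv_def)
    then have "X = ?f ?u"
      unfolding x(2) by (rule q_eq)
    then show "X \<in> ?f ` carrier V" by (auto simp: V_def module_vec_def)
  qed (auto simp: Q_carrier pv_Z)
  ultimately have bij: "bij_betw ?f (carrier V) (carrier Q)" by (simp add: bij_betw_def)
  have "vectorspace.dim class_ring Q = vectorspace.dim class_ring V"
  proof (rule vectorspace_transfer(2)[OF V bij])
    fix u v assume uv: "u \<in> carrier V" "v \<in> carrier V"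
    then have "pv (u \<oplus>\<^bsub>V\<^esub> v) = (\<lambda>r\<in>{..<m}. pv u r + pv v r)"
      by (auto simp: pv_def V_def module_vec_def restrict_eq_iff distrib_left sum.distrib)
    then show "?f (u \<oplus>\<^bsub>V\<^esub> v) = ?f u \<oplus>\<^bsub>Q\<^esub> ?f v"
      by (simp add: Q_add q_add pv_E)
  next
    fix c u assume u: "u \<in> carrier V"
    then have "pv (c \<odot>\<^bsub>V\<^esub> u) = (\<lambda>r\<in>{..<m}. c * pv u r)"
      by (auto simp: pv_def V_def module_vec_def restrict_eq_iff sum_distrib_left ac_simps)
    then show "?f (c \<odot>\<^bsub>V\<^esub> u) = c \<odot>\<^bsub>Q\<^esub> ?f u"
      by (simp add: Q_smult q_smult pv_E)
  next
    have "pv \<zero>\<^bsub>V\<^esub> = (\<lambda>r\<in>{..<m}. 0)"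
      by (auto simp: pv_def V_def module_vec_def restrict_eq_iff)
    moreover have "q (\<lambda>r\<in>{..<m}. 0) = B"
    proof -
      have "(\<lambda>r\<in>{..<m}. z r - (\<lambda>r\<in>{..<m}. 0) r) = z" if "z \<in> E" for z
        using that by (auto simp: E_def fun_eq_iff PiE_def extensional_def)
      then show ?thesis
        unfolding q_def using B_iff by auto
    qed
    ultimately show "?f \<zero>\<^bsub>V\<^esub> = \<zero>\<^bsub>Q\<^esub>" by (simp add: Q_zero)
  next
    interpret vec_space "TYPE('k)" "b' i" .
    show "vectorspace.fin_dim class_ring V"
      unfolding V_def by (rule fin_dim)
  qed
  also have "\<dots> = b' i"
  proof -
    interpret vec_space "TYPE('k)" "b' i" .
    show ?thesis
      unfolding V_def by (rule dim_is_n)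
  qed
  finally show ?thesis by (simp add: Q_def)
qed

text \<open>\<open>(b', D')\<close> shows that the choice inside \<open>tor\<close> has a candidate;
  whichever resolution is chosen, comparison with the minimal one yields the rank
  \<open>b' i\<close>.\<close>

lemma tor_dim_eq:
  fixes D' :: "nat \<Rightarrow> 'k::field_char_0 mtx"
  assumes n: "1 \<le> n" and G: "mresolution n b' D' e'" and minimal: "\<And>k i j. D' k i j 1 = 0"
  shows "tor_dim TYPE('k) n i = b' i"
proof -
  let ?p = "\<lambda>(b, D). \<exists>e. is_free_resolution (dirichlet_ring n) (residue_module :: (nat \<Rightarrow> 'k, 'k) module) b D e"
  obtain b D where bD: "(b, D) = (SOME x. ?p x)" by (metis surj_pair)
  have "?p (b', D')"
    using mresolution_is_free_resolution[OF n G] by auto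
  then have "?p (b, D)"
    unfolding bD by (rule someI)
  then obtain e where "mresolution n b (trunc b D) e"
    using mresolution_trunc[OF n] by auto
  then have "vectorspace.dim (class_ring :: 'k ring)
     (restrict_scalars scalar (homology_module (dirichlet_ring n) residue_module b D i)) = b' i"
    by (rule dim_homology_residue[OF n _ G minimal])
  then show ?thesis by (simp add: tor_dim_def tor_def flip: bD)
qed


section \<open>The Golod resolution\<close>

definition ddelta :: "nat \<Rightarrow> nat \<Rightarrow> 'k::field_char_0" where
  "ddelta p m = (if m = p then 1 else 0)"

lemma dconv_ddelta:
  assumes "p > 0"
  shows "dconv n (ddelta p) f a = (if a \<in> {1..n} \<and> p dvd a then f (a div p) else 0)"
proof (cases "a \<in> {1..n}")
  case True
  then have "(\<Sum>d | d dvd a. ddelta p d * f (a div d)) = (\<Sum>d \<in> {d. d dvd a}. if d = p then f (a div p) else 0)"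
    by (intro sum.cong) (auto simp: ddelta_def)
  also have "\<dots> = (if p dvd a then f (a div p) else 0)"
    using True by (subst sum.delta) auto
  finally show ?thesis
    using True by (simp add: dconv_def)
qed (auto simp: dconv_def)

lemma dconv_scale_left: "dconv n (\<lambda>a. c * f a) g = (\<lambda>a. c * dconv n f g a)"
  by (auto simp: fun_eq_iff dconv_def sum_distrib_left mult.assoc)

lemma dconv_scale_right: "dconv n f (\<lambda>a. c * g a) = (\<lambda>a. c * dconv n f g a)"
  by (subst (1 2) dconv_comm) (rule dconv_scale_left)

lemma dconv_left_commute: "dconv n f (dconv n g h) = dconv n g (dconv n f h)"
  by (metis dconv_assoc dconv_comm)

context
  fixes n :: nat
begin

section \<open>Linearity of the differential over the convolution ring\<close>

lemma ksupp_zero: "ksupp n f \<Longrightarrow> f S 0 = 0"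
  unfolding ksupp_def by fastforce

lemma ksupp_dring: "ksupp n f \<Longrightarrow> f S \<in> dring n"
  unfolding ksupp_def dring_def by blast

text \<open>Multiplication by a prime becomes convolution with its indicator
  \<open>ddelta p\<close>, so compatibility with scalars from A is reduced to commutativity of
  \<open>dconv\<close>.\<close>

lemma koszul_d_as_dconv:
  assumes "ksupp n f"
  shows "koszul_d n f S = (\<Sum>p\<in>primes_le n - S. (\<lambda>a. sgn_in p S * dconv n (ddelta p) (f (insert p S)) a))"
proof
  fix a
  have *: "dconv n (ddelta p) (f (insert p S)) a = (if a \<le> n \<and> p dvd a then f (insert p S) (a div p) else 0)"
    if "p \<in> primes_le n" for p
  proof -
    have "p > 0"
      using that by (auto simp: primes_le_def prime_gt_0_nat)
    then show ?thesis
      using ksupp_zero[OF assms] by (cases "a = 0") (auto simp: dconv_ddelta)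
  qed
  have "koszul_d n f S a = (\<Sum>p\<in>{p \<in> primes_le n - S. a \<le> n \<and> p dvd a}. sgn_in p S * f (insert p S) (a div p))"
    by (cases "a \<le> n") (auto simp: koszul_d_def intro!: sum.cong)
  also have "\<dots> = (\<Sum>p\<in>primes_le n - S. if a \<le> n \<and> p dvd a then sgn_in p S * f (insert p S) (a div p) else 0)"
    by (rule sum.inter_filter) auto
  also have "\<dots> = (\<Sum>p\<in>primes_le n - S. sgn_in p S * dconv n (ddelta p) (f (insert p S)) a)"
    using * by (intro sum.cong) auto
  finally show "koszul_d n f S a = (\<Sum>p\<in>primes_le n - S. (\<lambda>a. sgn_in p S * dconv n (ddelta p) (f (insert p S)) a)) a"
    by (simp add: sum_fun_apply)
qed

lemma cycle_mult_as_dconv: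
  assumes "ksupp n f" "fst w > 0"
  shows "cycle_mult n w f S = (if snd w \<subseteq> S
    then (\<lambda>a. shuffle_sgn (S - snd w) (snd w) * dconv n (ddelta (fst w)) (f (S - snd w)) a) else 0)"
proof
  fix a
  show "cycle_mult n w f S a = (if snd w \<subseteq> S
    then (\<lambda>a. shuffle_sgn (S - snd w) (snd w) * dconv n (ddelta (fst w)) (f (S - snd w)) a) else 0) a"
    using assms ksupp_zero[OF assms(1)] by (cases "a = 0") (auto simp: cycle_mult_def dconv_ddelta)
qed

lemma ksupp_dconv: "ksupp n f \<Longrightarrow> ksupp n (\<lambda>S. dconv n u (f S))"
  unfolding ksupp_def
proof (intro allI impI)
  fix S a
  assume f: "\<forall>S a. f S a \<noteq> 0 \<longrightarrow> S \<subseteq> primes_le n \<and> a \<in> {1..n}" and nz: "dconv n u (f S) a \<noteq> 0"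
  have "f S \<noteq> 0"
    using nz by (metis dconv_zero(2) zero_fun_apply)
  then obtain a' where "f S a' \<noteq> 0" by (auto simp: fun_eq_iff)
  then show "S \<subseteq> primes_le n \<and> a \<in> {1..n}"
    using f nz by (auto simp: dconv_def split: if_splits)
qed

lemma koszul_d_dconv: 
  assumes "ksupp n f" 
  shows "koszul_d n (\<lambda>S. dconv n u (f S)) = (\<lambda>S. dconv n u (koszul_d n f S))"
proof
  fix S
  have "koszul_d n (\<lambda>S. dconv n u (f S)) S
      = (\<Sum>p\<in>primes_le n - S. dconv n u (\<lambda>a. sgn_in p S * dconv n (ddelta p) (f (insert p S)) a))"
    unfolding koszul_d_as_dconv[OF ksupp_dconv[OF assms]]
    by (simp add: dconv_scale_right dconv_left_commute[of n _ u])
  then show "koszul_d n (\<lambda>S. dconv n u (f S)) S = dconv n u (koszul_d n f S)"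
    by (simp only: koszul_d_as_dconv[OF assms] dconv_sum_right)
qed

lemma cycle_mult_dconv:
  assumes "ksupp n f" "w \<in> golod_gens n"
  shows "cycle_mult n w (\<lambda>S. dconv n u (f S)) = (\<lambda>S. dconv n u (cycle_mult n w f S))"
proof
  fix S
  have w: "fst w > 0"
    using assms(2) by (auto simp: golod_gens_def)
  show "cycle_mult n w (\<lambda>S. dconv n u (f S)) S = dconv n u (cycle_mult n w f S)"
    unfolding cycle_mult_as_dconv[OF ksupp_dconv[OF assms(1)] w] cycle_mult_as_dconv[OF assms(1) w]
    by (auto simp: dconv_scale_right dconv_left_commute[of n _ u])
qed

lemma golod_d_dconv:
  assumes "\<And>ws. ksupp n (g ws)"
  shows "golod_d n (\<lambda>ws S. dconv n u (g ws S)) ws S = dconv n u (golod_d n g ws S)"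
proof -
  have "golod_d n (\<lambda>ws S. dconv n u (g ws S)) ws S
      = dconv n u (koszul_d n (g ws) S) + (\<Sum>w\<in>golod_gens n. dconv n u (cycle_mult n w (g (ws @ [w])) S))"
    unfolding golod_d_def by (simp add: koszul_d_dconv[OF assms] cycle_mult_dconv[OF assms] sum_fun_apply fun_eq_iff)
  also have "\<dots> = dconv n u (golod_d n g ws S)"
    unfolding golod_d_def by (simp only: dconv_add_right dconv_sum_right plus_fun_apply sum_fun_apply[of _ _ S])
  finally show ?thesis .
qed

lemma golod_d_sum: "golod_d n (\<Sum>i\<in>A. g i) = (\<Sum>i\<in>A. golod_d n (g i))"
proof (induction A rule: infinite_finite_induct)
  case (insert x A)
  show ?case
    unfolding sum.insert[OF insert(1,2)] golod_d_add insert(3) ..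
qed (simp_all only: sum.infinite sum.empty golod_d_zero not_False_eq_True)

lemma cells_0: "cells n 0 = {([], {})}"
proof (intro equalityI subsetI)
  fix c assume c: "c \<in> cells n 0"
  obtain ws S where ws: "c = (ws, S)" by (metis surj_pair)
  have "S \<subseteq> primes_le n" "card S + sum_list (map gen_degree ws) = 0"
    using c unfolding ws cells_def by (simp_all only: mem_Collect_eq prod.case)
  moreover from this have "finite S"
    using finite_primes_le_subset by blast
  ultimately show "c \<in> {([], {})}"
    using ws by (cases ws) (simp_all add: gen_degree_def)
qed (simp add: cells_def)

text \<open>The only cell of degree 0 is the unit cell, while every term of the differential needs a
  nonempty word or a nonempty set. \<open>gchain_golod_d\<close> starts in degree 1, so this case is
  separate.\<close>

lemma golod_d_gchain_0:
  assumes "gchain n 0 g"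
  shows "golod_d n g = 0"
proof -
  have c0: "(ws, S) \<in> cells n 0 \<Longrightarrow> ws = [] \<and> S = {}" for ws S
    by (simp add: cells_0)
  have "golod_d n g ws S a = 0" for ws S a
  proof -
    have "cycle_mult n w (g (ws @ [w])) S a = 0" for w
    proof -
      have "g (ws @ [w]) = 0"
        using gchainD[OF assms, of "ws @ [w]"] c0 by (fastforce simp: fun_eq_iff)
      then show ?thesis by simp
    qed
    moreover have "koszul_d n (g ws) S a = 0"
    proof (rule ccontr)
      assume "koszul_d n (g ws) S a \<noteq> 0"
      then obtain p where "g ws (insert p S) (a div p) \<noteq> 0" by (rule koszul_d_nonzeroE)
      then show False
        using gchainD[OF assms] c0 by blast
    qed
    ultimately show ?thesis by (simp add: golod_d_def sum_fun_apply)
  qed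
  then show ?thesis by (simp add: fun_eq_iff)
qed

section \<open>Chains as coordinate vectors\<close>

lemma finite_cells: "finite (cells n e)"
proof (rule finite_subset)
  show "cells n e \<subseteq> {ws. set ws \<subseteq> golod_gens n \<and> length ws \<le> e} \<times> Pow (primes_le n)"
  proof
    fix c assume "c \<in> cells n e"
    moreover obtain ws S where c: "c = (ws, S)" by (metis surj_pair)
    ultimately have ws: "set ws \<subseteq> golod_gens n" "S \<subseteq> primes_le n" "sum_list (map gen_degree ws) \<le> e"
      by (auto simp: cells_def)
    have "length ws \<le> sum_list (map gen_degree ws)"
      by (induction ws) (auto simp: gen_degree_def)
    then show "c \<in> {ws. set ws \<subseteq> golod_gens n \<and> length ws \<le> e} \<times> Pow (primes_le n)"
      using ws c by auto
  qed
  show "finite ({ws. set ws \<subseteq> golod_gens n \<and> length ws \<le> e} \<times> Pow (primes_le n))"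
    by (intro finite_cartesian_product finite_lists_length_le) auto
qed

definition golod_rank :: "nat \<Rightarrow> nat" where
  "golod_rank e = card (cells n e)"

text \<open>Any numbering of the cells will do; it only turns the A-basis into matrix
  indices.\<close>

definition golod_cell :: "nat \<Rightarrow> nat \<Rightarrow> (nat \<times> nat set) list \<times> nat set" where
  "golod_cell e = (SOME h. bij_betw h {..<golod_rank e} (cells n e))"

lemma bij_cell: "bij_betw (golod_cell e) {..<golod_rank e} (cells n e)"
proof -
  have "\<exists>h. bij_betw h {..<golod_rank e} (cells n e)"
    using ex_bij_betw_nat_finite[OF finite_cells] by (auto simp: golod_rank_def atLeast0LessThan)
  then show ?thesis
    unfolding golod_cell_def by (rule someI_ex)
qed

lemma cell_in: "i < golod_rank e \<Longrightarrow> golod_cell e i \<in> cells n e"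
  using bij_cell bij_betwE by blast

lemma cell_surj: "c \<in> cells n e \<Longrightarrow> \<exists>i<golod_rank e. c = golod_cell e i"
  using bij_cell[of e] by (auto simp: bij_betw_def)

lemma cell_inj: "i < golod_rank e \<Longrightarrow> j < golod_rank e \<Longrightarrow> golod_cell e i = golod_cell e j \<longleftrightarrow> i = j"
  using bij_cell[of e] by (auto simp: bij_betw_def inj_on_def)

definition unit_cell :: "(nat \<times> nat set) list \<times> nat set \<Rightarrow> (nat \<times> nat set) list \<Rightarrow> nat set \<Rightarrow> nat \<Rightarrow> 'k::field_char_0" where
  "unit_cell c ws S = (if (ws, S) = c then dunit else 0)"

definition golod_matrix :: "nat \<Rightarrow> 'k::field_char_0 mtx" where
  "golod_matrix e i j = (if i < golod_rank e \<and> j < golod_rank (Suc e)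
     then golod_d n (unit_cell (golod_cell (Suc e) j)) (fst (golod_cell e i)) (snd (golod_cell e i)) else 0)"

definition to_chain :: "nat \<Rightarrow> (nat \<Rightarrow> nat \<Rightarrow> 'k::field_char_0) \<Rightarrow> (nat \<times> nat set) list \<Rightarrow> nat set \<Rightarrow> nat \<Rightarrow> 'k" where
  "to_chain e v = (\<Sum>j<golod_rank e. (\<lambda>ws S. dconv n (v j) (unit_cell (golod_cell e j) ws S)))"

definition of_chain :: "nat \<Rightarrow> ((nat \<times> nat set) list \<Rightarrow> nat set \<Rightarrow> nat \<Rightarrow> 'k::field_char_0) \<Rightarrow> nat \<Rightarrow> nat \<Rightarrow> 'k" where
  "of_chain e g = (\<lambda>j\<in>{..<golod_rank e}. g (fst (golod_cell e j)) (snd (golod_cell e j)))"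

lemma to_chain_apply:
  "to_chain e v ws S = (\<Sum>j<golod_rank e. dconv n (v j) (unit_cell (golod_cell e j) ws S))"
  by (simp add: to_chain_def sum_fun_apply fun_eq_iff)

lemma to_chain_cell:
  assumes v: "v \<in> {..<golod_rank e} \<rightarrow>\<^sub>E dring n" and i: "i < golod_rank e"
  shows "to_chain e v (fst (golod_cell e i)) (snd (golod_cell e i)) = v i"
proof -
  have "to_chain e v (fst (golod_cell e i)) (snd (golod_cell e i)) = (\<Sum>j<golod_rank e. if j = i then v i else 0)"
    unfolding to_chain_apply
  proof (rule sum.cong[OF refl])
    fix j assume "j \<in> {..<golod_rank e}"
    moreover have "dconv n (v j) dunit = v j" if "j < golod_rank e"
      using v that dconv_one[of "v j" n] by (auto simp: dconv_comm[of n _ dunit])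
    ultimately show "dconv n (v j) (unit_cell (golod_cell e j) (fst (golod_cell e i)) (snd (golod_cell e i))) = (if j = i then v i else 0)"
      using i cell_inj[of i e j] by (auto simp: unit_cell_def)
  qed
  then show ?thesis
    using i by simp
qed

lemma to_chain_outside:
  assumes "(ws, S) \<notin> cells n e"
  shows "to_chain e v ws S = 0"
  unfolding to_chain_apply
proof (rule sum.neutral, rule ballI)
  fix j assume "j \<in> {..<golod_rank e}"
  then have "golod_cell e j \<noteq> (ws, S)"
    using cell_in[of j e] assms by auto
  then show "dconv n (v j) (unit_cell (golod_cell e j) ws S) = 0" by (auto simp: unit_cell_def)
qed

lemma gchain_to_chain:
  assumes v: "v \<in> {..<golod_rank e} \<rightarrow>\<^sub>E dring n"
  shows "gchain n e (to_chain e v)"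
  unfolding gchain_def
proof (intro allI impI)
  fix ws S a assume nz: "to_chain e v ws S a \<noteq> 0"
  then have c: "(ws, S) \<in> cells n e"
    using to_chain_outside[of ws S e v] by (metis zero_fun_apply)
  then obtain i where i: "i < golod_rank e" "(ws, S) = golod_cell e i"
    using cell_surj by blast
  then have "to_chain e v ws S = v i"
    using to_chain_cell[OF v i(1)] by (metis fst_conv snd_conv)
  moreover have "v i \<in> dring n"
    using v i by auto
  ultimately show "(ws, S) \<in> cells n e \<and> a \<in> {1..n}"
    using nz c by (auto simp: dring_def)
qed

lemma of_chain_PiE: "gchain n e g \<Longrightarrow> of_chain e g \<in> {..<golod_rank e} \<rightarrow>\<^sub>E dring n"
  by (auto simp: of_chain_def ksupp_dring gchain_ksupp)

lemma of_chain_to_chain: "v \<in> {..<golod_rank e} \<rightarrow>\<^sub>E dring n \<Longrightarrow> of_chain e (to_chain e v) = v"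
  by (rule ext) (auto simp: of_chain_def restrict_def to_chain_cell PiE_def extensional_def)

lemma chain_eqI:
  assumes g: "gchain n e g" and h: "gchain n e h" and eq: "of_chain e g = of_chain e h"
  shows "g = h"
proof (intro ext)
  fix ws S a
  show "g ws S a = h ws S a"
  proof (cases "(ws, S) \<in> cells n e")
    case True
    then obtain i where i: "i < golod_rank e" "(ws, S) = golod_cell e i"
      using cell_surj by blast
    then have "g (fst (golod_cell e i)) (snd (golod_cell e i)) = h (fst (golod_cell e i)) (snd (golod_cell e i))"
      using fun_cong[OF eq, of i] by (simp add: of_chain_def)
    then show ?thesis
      using i(2) by (metis fst_conv snd_conv)
  next
    case False
    then show ?thesis
      using gchainD[OF g, of ws S a] gchainD[OF h, of ws S a] by metis
  qed
qed

lemma gchain_unit_cell: "1 \<le> n \<Longrightarrow> c \<in> cells n e \<Longrightarrow> gchain n e (unit_cell c)"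
  by (auto simp: gchain_def unit_cell_def dunit_def split: if_splits)

lemma mapply_golod_matrix:
  assumes n: "1 \<le> n" and v: "v \<in> {..<golod_rank (Suc e)} \<rightarrow>\<^sub>E dring n"
  shows "mapply n golod_rank golod_matrix e v = of_chain e (golod_d n (to_chain (Suc e) v))"
  unfolding mapply_def of_chain_def
proof (intro restrict_ext)
  fix i assume i: "i \<in> {..<golod_rank e}"
  let ?w = "fst (golod_cell e i)" and ?S = "snd (golod_cell e i)"
  have "golod_d n (to_chain (Suc e) v) ?w ?S = (\<Sum>j<golod_rank (Suc e). golod_d n (\<lambda>ws S. dconv n (v j) (unit_cell (golod_cell (Suc e) j) ws S)) ?w ?S)"
    unfolding to_chain_def golod_d_sum by (simp only: sum_fun_apply)
  also have "\<dots> = (\<Sum>j<golod_rank (Suc e). dconv n (golod_matrix e i j) (v j))"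
  proof (rule sum.cong[OF refl])
    fix j assume j: "j \<in> {..<golod_rank (Suc e)}"
    have "golod_d n (\<lambda>ws S. dconv n (v j) (unit_cell (golod_cell (Suc e) j) ws S)) ?w ?S
        = dconv n (v j) (golod_d n (unit_cell (golod_cell (Suc e) j)) ?w ?S)"
      by (rule golod_d_dconv, rule gchain_ksupp, rule gchain_unit_cell[OF n cell_in]) (use j in auto)
    then show "golod_d n (\<lambda>ws S. dconv n (v j) (unit_cell (golod_cell (Suc e) j) ws S)) ?w ?S = dconv n (golod_matrix e i j) (v j)"
      using i j by (simp add: golod_matrix_def dconv_comm[of n "v j"])
  qed
  finally show "(\<Sum>j<golod_rank (Suc e). dconv n (golod_matrix e i j) (v j)) = golod_d n (to_chain (Suc e) v) ?w ?S" ..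
qed

lemma of_chain_zero_iff: 
  assumes "gchain n e g"
  shows "g = 0 \<longleftrightarrow> (\<forall>i<golod_rank e. of_chain e g i = 0)"
proof
  assume "\<forall>i<golod_rank e. of_chain e g i = 0"
  moreover have "gchain n e 0" by (simp add: gchain_def)
  ultimately show "g = 0" by (intro chain_eqI[OF assms]) (auto simp: of_chain_def restrict_eq_iff)
qed (simp add: of_chain_def)

text \<open>In degree 0 the first condition is automatic and the coefficient of 1 at the unit cell
  is the augmentation. In positive degree that cell is absent, so the second condition is automatic.
  Together they are the premises of \<open>golod_d_exact\<close>.\<close>

lemma cycs_golod_matrix_iff:
  assumes n: "1 \<le> n" and v: "v \<in> {..<golod_rank e} \<rightarrow>\<^sub>E dring n"
  shows "v \<in> cycs n golod_rank golod_matrix (\<lambda>_. 1) e \<longleftrightarrow> golod_d n (to_chain e v) = 0 \<and> to_chain e v [] {} 1 = 0"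
proof (cases e)
  case 0
  have r: "golod_rank 0 = 1" by (simp add: golod_rank_def cells_0)
  then have "golod_cell 0 0 = ([], {})"
    using cell_in[of 0 0] by (simp add: cells_0)
  then have "to_chain 0 v [] {} = v 0"
    using to_chain_cell[of v 0 0] v 0 r by simp
  moreover have "golod_d n (to_chain 0 v) = 0"
    using gchain_to_chain[OF v] 0 by (simp add: golod_d_gchain_0)
  ultimately show ?thesis
    using v 0 r by (simp add: cycs_def)
next
  case (Suc k)
  have "([], {}) \<notin> cells n e"
    using Suc by (simp add: cells_def)
  then have 1: "to_chain e v [] {} 1 = 0"
    using to_chain_outside by (metis zero_fun_apply)
  have "gchain n k (golod_d n (to_chain e v))"
    using gchain_to_chain[OF v] Suc by (intro gchain_golod_d) simp
  then have "golod_d n (to_chain e v) = 0 \<longleftrightarrow> (\<forall>i<golod_rank k. of_chain k (golod_d n (to_chain e v)) i = 0)"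
    by (rule of_chain_zero_iff)
  also have "of_chain k (golod_d n (to_chain e v)) = mapply n golod_rank golod_matrix k v"
    using mapply_golod_matrix[OF n, of v k] v Suc by simp
  finally have "golod_d n (to_chain e v) = 0 \<longleftrightarrow> (\<forall>i<golod_rank k. (\<Sum>j<golod_rank e. dconv n (golod_matrix k i j) (v j)) = 0)"
    by (simp only: mapply_def restrict_apply' lessThan_iff Suc cong: conj_cong imp_cong)
  then show ?thesis
    using v 1 Suc by (simp only: cycs_def mem_Collect_eq nat.case) blast
qed

lemma mresolution_golod_matrix:
  assumes n: "1 \<le> n"
  shows "mresolution n golod_rank (golod_matrix :: nat \<Rightarrow> 'k::field_char_0 mtx) (\<lambda>_. 1)"
proof -
  have "golod_matrix k \<in> mats n (golod_rank k) (golod_rank (Suc k))" for k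
  proof -
    have "golod_d n (unit_cell (golod_cell (Suc k) j)) ws S \<in> dring n" if "j < golod_rank (Suc k)" for j ws S
      using gchain_golod_d[OF gchain_unit_cell[OF n cell_in[OF that]]] by (intro ksupp_dring gchain_ksupp)
    then show ?thesis by (auto simp: mats_def golod_matrix_def)
  qed
  moreover have "\<exists>j<golod_rank 0. (1 :: 'k) \<noteq> 0"
    by (auto simp: golod_rank_def cells_0)
  moreover have "cycs n golod_rank (golod_matrix :: nat \<Rightarrow> 'k mtx) (\<lambda>_. 1) k = mapply n golod_rank golod_matrix k ` ({..<golod_rank (Suc k)} \<rightarrow>\<^sub>E dring n)" for k
  proof (intro equalityI subsetI)
    fix v :: "nat \<Rightarrow> nat \<Rightarrow> 'k" assume "v \<in> cycs n golod_rank golod_matrix (\<lambda>_. 1) k"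
    moreover from this have v: "v \<in> {..<golod_rank k} \<rightarrow>\<^sub>E dring n"
      by (simp add: cycs_def)
    ultimately have "golod_d n (to_chain k v) = 0 \<and> to_chain k v [] {} 1 = 0"
      by (simp only: cycs_golod_matrix_iff[OF n v])
    then obtain h where h: "gchain n (Suc k) h" "golod_d n h = to_chain k v"
      using golod_d_exact[OF gchain_to_chain[OF v]] by blast
    define w where "w = of_chain (Suc k) h"
    have w: "w \<in> {..<golod_rank (Suc k)} \<rightarrow>\<^sub>E dring n"
      unfolding w_def by (rule of_chain_PiE[OF h(1)])
    have "to_chain (Suc k) w = h"
      by (rule chain_eqI[OF gchain_to_chain[OF w] h(1)]) (simp add: of_chain_to_chain[OF w], simp add: w_def)
    then have "mapply n golod_rank golod_matrix k w = v"
      by (simp add: mapply_golod_matrix[OF n w] h(2) of_chain_to_chain[OF v])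
    then show "v \<in> mapply n golod_rank golod_matrix k ` ({..<golod_rank (Suc k)} \<rightarrow>\<^sub>E dring n)"
      using w by blast
  next
    fix v :: "nat \<Rightarrow> nat \<Rightarrow> 'k" assume "v \<in> mapply n golod_rank golod_matrix k ` ({..<golod_rank (Suc k)} \<rightarrow>\<^sub>E dring n)"
    then obtain w where w: "w \<in> {..<golod_rank (Suc k)} \<rightarrow>\<^sub>E dring n" "v = mapply n golod_rank golod_matrix k w"
      by blast
    define h where "h = to_chain (Suc k) w"
    have h: "gchain n (Suc k) h"
      unfolding h_def by (rule gchain_to_chain[OF w(1)])
    have v: "v = of_chain k (golod_d n h)"
      unfolding w(2) h_def by (rule mapply_golod_matrix[OF n w(1)])
    then have vP: "v \<in> {..<golod_rank k} \<rightarrow>\<^sub>E dring n"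
      using of_chain_PiE[OF gchain_golod_d[OF h]] by simp
    have "to_chain k v = golod_d n h"
      by (rule chain_eqI[OF gchain_to_chain[OF vP] gchain_golod_d[OF h]]) (simp add: of_chain_to_chain[OF vP], simp add: v)
    then show "v \<in> cycs n golod_rank golod_matrix (\<lambda>_. 1) k"
      unfolding cycs_golod_matrix_iff[OF n vP] using golod_d_golod_d[OF h] by (auto simp: golod_d_at_1 simp del: One_nat_def)
  qed
  ultimately show ?thesis by (subst mresolution_iff_cycs[OF n]) blast+
qed

lemma tor_dim_eq_card_cells:
  assumes n: "1 \<le> n"
  shows "tor_dim TYPE('k::field_char_0) n i = card (cells n i)"
proof -
  have "(golod_matrix k i j 1 :: 'k) = 0" for k i j
    unfolding golod_matrix_def by (cases "i < golod_rank k \<and> j < golod_rank (Suc k)") (simp_all add: golod_d_at_1 del: One_nat_def)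
  then show ?thesis
    using tor_dim_eq[OF n mresolution_golod_matrix[OF n, where 'k = 'k]] by (simp add: golod_rank_def)
qed

end


section \<open>Counting cells\<close>

definition rough :: "nat \<Rightarrow> nat \<Rightarrow> nat set" where
  "rough n p = {m \<in> {1..n}. \<forall>q. prime q \<and> q dvd m \<longrightarrow> p < q}"

definition primes_gt :: "nat \<Rightarrow> nat \<Rightarrow> nat set" where
  "primes_gt n p = {q \<in> primes_le n. p < q}"

lemma finite_rough [simp, intro]: "finite (rough n p)"
  unfolding rough_def by (rule finite_subset[of _ "{1..n}"]) auto

lemma finite_primes_gt [simp, intro]: "finite (primes_gt n p)"
  unfolding primes_gt_def by (rule finite_subset[of _ "primes_le n"]) auto

text \<open>Every \<open>b \<in> rough n p\<close> has exactly one multiple \<open>b p\<^sup>k\<close> with \<open>b p\<^sup>k \<le> n < b p\<^sup>k\<^sup>+\<^sup>1\<close>.\<close>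

lemma card_golod_fibre:
  assumes p: "prime p"
  shows "card {m \<in> {1..n}. (\<forall>q. prime q \<and> q dvd m \<longrightarrow> p \<le> q) \<and> n < m * p} = card (rough n p)"
proof -
  let ?M = "{m \<in> {1..n}. (\<forall>q. prime q \<and> q dvd m \<longrightarrow> p \<le> q) \<and> n < m * p}"
  define k where "k m = multiplicity p m" for m :: nat
  define f where "f m = m div p ^ k m" for m
  have p1: "1 < p"
    using p prime_gt_1_nat by auto
  have dec: "m = p ^ k m * f m" "\<not> p dvd f m" if "m > 0" for m
  proof -
    show "m = p ^ k m * f m" by (simp add: f_def k_def multiplicity_dvd)
    show "\<not> p dvd f m"
      unfolding f_def k_def using that p1 by (intro multiplicity_decompose) auto
  qed
  have "inj_on f ?M"
  proof (rule inj_onI)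
    \<comment> \<open>If x had more factors p than y and the same part prime to p, then x \<ge> y p
      > n.\<close>
    have *: "k x \<le> k y" if "x \<in> ?M" "y \<in> ?M" "f x = f y" for x y
    proof (rule ccontr)
      assume "\<not> k x \<le> k y"
      then have "p ^ Suc (k y) \<le> p ^ k x"
        using p1 by (intro power_increasing) auto
      then have "p ^ Suc (k y) * f y \<le> p ^ k x * f x"
        using that(3) by simp
      moreover have "p ^ Suc (k y) * f y = y * p"
      proof -
        have "p ^ Suc (k y) * f y = p ^ k y * f y * p" by simp
        also have "p ^ k y * f y = y"
          using dec(1)[of y] that(2) by simp
        finally show ?thesis .
      qed
      moreover have "p ^ k x * f x = x"
        using dec(1)[of x] that(1) by simp
      ultimately have "y * p \<le> x" by metis
      then show False
        using that by auto
    qed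
    fix x y assume "x \<in> ?M" "y \<in> ?M" "f x = f y"
    then have "k x = k y" "x > 0" "y > 0"
      using *[of x y] *[of y x] by auto
    then show "x = y"
      using dec(1)[of x] dec(1)[of y] \<open>f x = f y\<close> by simp
  qed
  moreover have "f ` ?M = rough n p"
  proof (intro equalityI subsetI)
    fix b assume "b \<in> f ` ?M"
    then obtain m where m: "m \<in> ?M" "b = f m" by blast
    then have "m > 0" by auto
    have b: "m = p ^ k m * b" "\<not> p dvd b"
      using dec[OF \<open>m > 0\<close>] m by auto
    then have "b dvd m" by (metis dvd_triv_right)
    moreover have "b > 0"
      using b(2) by (cases b) auto
    ultimately have "b \<in> {1..n}"
      using m(1) dvd_imp_le[OF \<open>b dvd m\<close> \<open>m > 0\<close>] by auto
    moreover have "p < q" if "prime q" "q dvd b" for q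
    proof -
      have "p \<le> q"
        using m(1) that \<open>b dvd m\<close> dvd_trans by blast
      moreover have "p \<noteq> q"
        using b(2) that by auto
      ultimately show ?thesis by simp
    qed
    ultimately show "b \<in> rough n p" by (auto simp: rough_def)
  next
    fix b assume b: "b \<in> rough n p"
    then have b1: "1 \<le> b" "b \<le> n" and bq: "\<And>q. prime q \<Longrightarrow> q dvd b \<Longrightarrow> p < q"
      by (auto simp: rough_def)
    have npb: "\<not> p dvd b"
      using bq p by blast
    \<comment> \<open>The first exponent that overshoots n; it exists as p^n > n and is positive as
      b \<le> n. The preimage of b uses the exponent before it.\<close>
    define j where "j = (LEAST j. n < b * p ^ j)"
    have "n < p ^ n"
      using p1 by (simp add: power_gt_expt)
    also have "p ^ n \<le> b * p ^ n"
      using b1 by simp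
    finally have ex: "n < b * p ^ n" .
    have j: "n < b * p ^ j"
      unfolding j_def by (rule LeastI[of _ n]) (rule ex)
    have "j \<noteq> 0"
      using j b1 by (cases j) auto
    then obtain i where i: "j = Suc i" by (cases j) auto
    have "\<not> n < b * p ^ i"
      using not_less_Least[of i "\<lambda>j. n < b * p ^ j"] i by (simp add: j_def)
    then have le: "b * p ^ i \<le> n" by simp
    define m where "m = b * p ^ i"
    have "m \<in> ?M"
    proof -
      have "p \<le> q" if "prime q" "q dvd m" for q
      proof -
        have "q dvd b \<or> q dvd p ^ i"
          using that by (simp add: m_def prime_dvd_mult_iff)
        then show ?thesis
          using bq[OF that(1)] that(1) p prime_dvd_power primes_dvd_imp_eq by (metis less_imp_le_nat order_refl)
      qed
      then show ?thesis
        using le b1 j i p1 by (auto simp: m_def ac_simps)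
    qed
    moreover have "f m = b"
    proof -
      have "k m = i"
        unfolding k_def m_def by (rule multiplicity_decomposeI[of _ _ _ b]) (use npb p1 in \<open>auto simp: mult.commute\<close>)
      then show ?thesis
        using p1 by (simp add: f_def m_def)
    qed
    ultimately show "b \<in> f ` ?M" by blast
  qed
  ultimately show ?thesis
    using card_image by fastforce
qed

lemma sum_Pow_power_card:
  fixes x :: "'a::comm_semiring_1"
  assumes "finite A"
  shows "(\<Sum>U\<in>Pow A. x ^ card U) = (1 + x) ^ card A"
  using prod_add[OF assms, of "\<lambda>_. x" "\<lambda>_. 1"] by (simp add: add.commute)

text \<open>Split T into p = Min T and the set U of its larger primes. The degree is |U| + 2, which
  gives x^2, and U runs over all subsets, which gives the binomial power.\<close>

lemma sum_golod_gens:
  fixes x :: "'a::comm_semiring_1"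
  shows "(\<Sum>w\<in>golod_gens n. x ^ gen_degree w)
    = (\<Sum>p\<in>primes_le n. of_nat (card (rough n p)) * x\<^sup>2 * (1 + x) ^ card (primes_gt n p))"
proof -
  define M where "M p = {m \<in> {1..n}. (\<forall>q. prime q \<and> q dvd m \<longrightarrow> p \<le> q) \<and> n < m * p}" for p
  have finM: "finite (M p)" for p
    unfolding M_def by (rule finite_subset[of _ "{1..n}"]) auto
  have Min: "Min (insert p U) = p" "p \<notin> U" "finite U" if "U \<subseteq> primes_gt n p" for p U
  proof -
    show "finite U"
      using that finite_subset by blast
    then show "Min (insert p U) = p" "p \<notin> U"
      using that by (auto simp: primes_gt_def intro!: Min_eqI)
  qed
  have "(\<Sum>w\<in>golod_gens n. x ^ gen_degree w)
      = (\<Sum>(p, m, U)\<in>(SIGMA p:primes_le n. M p \<times> Pow (primes_gt n p)). x ^ Suc (Suc (card U)))"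
  proof (rule sum.reindex_bij_witness[of _ "\<lambda>(p, m, U). (m, insert p U)" "\<lambda>(m, T). (Min T, m, T - {Min T})"])
    fix w assume w: "w \<in> golod_gens n"
    obtain m T where mT: "w = (m, T)" by (metis surj_pair)
    note W = golod_gensD[OF w[unfolded mT]]
    show "(case case w of (m, T) \<Rightarrow> (Min T, m, T - {Min T}) of (p, m, U) \<Rightarrow> (m, insert p U)) = w"
      using W(2) by (simp add: mT insert_absorb)
    have "T - {Min T} \<subseteq> primes_gt n (Min T)"
    proof
      fix q assume q: "q \<in> T - {Min T}"
      then have "Min T \<le> q" "Min T \<noteq> q"
        using W(1) by auto
      then show "q \<in> primes_gt n (Min T)"
        using q W(3) by (auto simp: primes_gt_def)
    qed
    then show "(case w of (m, T) \<Rightarrow> (Min T, m, T - {Min T})) \<in> (SIGMA p:primes_le n. M p \<times> Pow (primes_gt n p))"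
      using W(2-5,7,8) by (auto simp: mT M_def)
    have "Suc (card (T - {Min T})) = card T"
      using W(1,2) by (rule card_Suc_Diff1)
    then show "(case case w of (m, T) \<Rightarrow> (Min T, m, T - {Min T}) of (p, m, U) \<Rightarrow> x ^ Suc (Suc (card U))) = x ^ gen_degree w"
      by (simp only: mT gen_degree_def snd_conv prod.case)
  next
    fix w assume "w \<in> (SIGMA p:primes_le n. M p \<times> Pow (primes_gt n p))"
    then obtain p m U where w: "w = (p, m, U)" "p \<in> primes_le n" "m \<in> M p" "U \<subseteq> primes_gt n p"
      by auto
    show "(case case w of (p, m, U) \<Rightarrow> (m, insert p U) of (m, T) \<Rightarrow> (Min T, m, T - {Min T})) = w"
      using Min[OF w(4)] by (simp add: w(1))
    show "(case w of (p, m, U) \<Rightarrow> (m, insert p U)) \<in> golod_gens n"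
      using Min[OF w(4)] w by (auto simp: golod_gens_def M_def primes_gt_def)
  qed
  also have "\<dots> = (\<Sum>p\<in>primes_le n. \<Sum>m\<in>M p. \<Sum>U\<in>Pow (primes_gt n p). x ^ Suc (Suc (card U)))"
    by (simp only: sum.cartesian_product, subst sum.Sigma) (auto simp: finM)
  also have "\<dots> = (\<Sum>p\<in>primes_le n. of_nat (card (rough n p)) * x\<^sup>2 * (1 + x) ^ card (primes_gt n p))"
  proof (rule sum.cong[OF refl])
    fix p assume "p \<in> primes_le n"
    then have "card (M p) = card (rough n p)"
      unfolding M_def by (intro card_golod_fibre) (simp add: primes_le_def)
    moreover have "(\<Sum>U\<in>Pow (primes_gt n p). x ^ Suc (Suc (card U))) = x\<^sup>2 * (1 + x) ^ card (primes_gt n p)"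
      by (simp add: power2_eq_square mult.assoc flip: sum_Pow_power_card sum_distrib_left)
    ultimately show "(\<Sum>m\<in>M p. \<Sum>U\<in>Pow (primes_gt n p). x ^ Suc (Suc (card U)))
        = of_nat (card (rough n p)) * x\<^sup>2 * (1 + x) ^ card (primes_gt n p)"
      by (simp add: mult.assoc)
  qed
  finally show ?thesis .
qed

lemma fps_one_plus_X_power_nth: "((1 + fps_X) ^ r :: rat fps) $ e = of_nat (r choose e)"
  by (simp add: binomial_gbinomial flip: fps_binomial_of_nat)

text \<open>Cut off the first letter; cells with the empty word are the e-element sets of
  primes.\<close>

lemma card_cells_rec:
  assumes "finite (cells n e)" "\<And>e'. e' < e \<Longrightarrow> finite (cells n e')"
  shows "card (cells n e) = (card (primes_le n) choose e) +
    (\<Sum>w\<in>golod_gens n. if gen_degree w \<le> e then card (cells n (e - gen_degree w)) else 0)"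
proof -
  let ?N = "(\<lambda>S. ([] :: (nat \<times> nat set) list, S)) ` {S. S \<subseteq> primes_le n \<and> card S = e}"
  let ?C = "(\<lambda>(w, ws, S). (w # ws, S)) ` (SIGMA w:{w \<in> golod_gens n. gen_degree w \<le> e}. cells n (e - gen_degree w))"
  have eq: "cells n e = ?N \<union> ?C"
  proof (intro equalityI subsetI)
    fix c assume c: "c \<in> cells n e"
    obtain ws S where ws: "c = (ws, S)" by (metis surj_pair)
    show "c \<in> ?N \<union> ?C"
    proof (cases ws)
      case Nil
      then show ?thesis
        using c ws by (auto simp: cells_def)
    next
      case (Cons w ws')
      then have "(w, ws', S) \<in> (SIGMA w:{w \<in> golod_gens n. gen_degree w \<le> e}. cells n (e - gen_degree w))"
        using c ws by (auto simp: cells_def)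
      then show ?thesis
        using ws Cons by (force intro: image_eqI)
    qed
  qed (auto simp: cells_def)
  have "card (cells n e) = card ?N + card ?C"
    using assms(1) unfolding eq by (intro card_Un_disjoint) auto
  also have "card ?N = card (primes_le n) choose e"
    by (subst card_image) (auto simp: inj_on_def n_subsets)
  also have "card ?C = card (SIGMA w:{w \<in> golod_gens n. gen_degree w \<le> e}. cells n (e - gen_degree w))"
    by (intro card_image) (auto simp: inj_on_def)
  also have "\<dots> = (\<Sum>w\<in>{w \<in> golod_gens n. gen_degree w \<le> e}. card (cells n (e - gen_degree w)))"
    by (rule card_SigmaI) (auto intro!: assms(2) simp: gen_degree_def)
  also have "\<dots> = (\<Sum>w\<in>golod_gens n. if gen_degree w \<le> e then card (cells n (e - gen_degree w)) else 0)"
    by (rule sum.inter_filter) auto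
  finally show ?thesis .
qed

lemma fps_cells:
  assumes fin: "\<And>e. finite (cells n e)"
  defines "D \<equiv> (1 - (\<Sum>p\<in>primes_le n.
       of_nat (card (rough n p)) * fps_X\<^sup>2 * (1 + fps_X) ^ card (primes_gt n p)) :: rat fps)"
  shows "D * Abs_fps (\<lambda>e. of_nat (card (cells n e))) = (1 + fps_X) ^ card (primes_le n)"
proof (rule fps_ext)
  fix e
  let ?B = "Abs_fps (\<lambda>e. of_nat (card (cells n e))) :: rat fps"
  have D: "D = 1 - (\<Sum>w\<in>golod_gens n. fps_X ^ gen_degree w)"
    unfolding D_def sum_golod_gens ..
  have "(D * ?B) $ e = ?B $ e - (\<Sum>w\<in>golod_gens n. (fps_X ^ gen_degree w * ?B) $ e)"
    by (simp add: D left_diff_distrib sum_distrib_right fps_sum_nth)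
  also have "(\<Sum>w\<in>golod_gens n. (fps_X ^ gen_degree w * ?B) $ e)
      = of_nat (\<Sum>w\<in>golod_gens n. if gen_degree w \<le> e then card (cells n (e - gen_degree w)) else 0)"
    unfolding of_nat_sum by (intro sum.cong) (auto simp: fps_X_power_mult_nth)
  also have "?B $ e - \<dots> = of_nat (card (primes_le n) choose e)"
    using card_cells_rec[OF fin fin, of e] by simp
  finally show "(D * ?B) $ e = ((1 + fps_X) ^ card (primes_le n)) $ e"
    by (simp add: fps_one_plus_X_power_nth)
qed


section \<open>The reduced denominator\<close>

text \<open>The differentiated geometric sum. For u = 1 + t it adds up the primes with c_p = k + 1,
  where k is the number of larger primes.\<close>

lemma sum_succ_powers:
  fixes u :: "'a::comm_ring_1"
  shows "(u - 1)\<^sup>2 * (\<Sum>k<M. of_nat (Suc k) * u ^ k) = 1 - of_nat (Suc M) * u ^ M + of_nat M * u ^ Suc M"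
  by (induction M) (simp_all add: algebra_simps power2_eq_square)

text \<open>An element other than 1 and the primes has two prime factors q, s > p with q s \<le> n,
  and the square of the smaller one is then at most n.\<close>

lemma rough_no_square:
  assumes p: "p \<in> primes_le n" and sq: "\<And>q. q \<in> primes_gt n p \<Longrightarrow> n < q\<^sup>2"
  shows "card (rough n p) = Suc (card (primes_gt n p))"
proof -
  have "rough n p = insert 1 (primes_gt n p)"
  proof (intro equalityI subsetI)
    fix m assume m: "m \<in> rough n p"
    then have m1: "1 \<le> m" "m \<le> n" and mq: "\<And>q. prime q \<Longrightarrow> q dvd m \<Longrightarrow> p < q"
      by (auto simp: rough_def)
    show "m \<in> insert 1 (primes_gt n p)"
    proof (cases "m = 1")
      case False
      then obtain q where q: "prime q" "q dvd m"
        using prime_factor_nat by blast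
      then obtain a where a: "m = q * a" by (elim dvdE)
      have a0: "a > 0"
        using a m1 by (cases a) auto
      have "q \<le> m"
        using q m1 by (intro dvd_imp_le) auto
      then have qL: "q \<in> primes_gt n p"
        using q mq m1 by (auto simp: primes_gt_def primes_le_def)
      have "a = 1"
      proof (rule ccontr)
        assume "a \<noteq> 1"
        then obtain s where s: "prime s" "s dvd a"
          using prime_factor_nat by blast
        have "s dvd m"
          using s a by simp
        have "s \<le> a"
          using s a0 by (intro dvd_imp_le) auto
        have "s \<le> m"
          using \<open>s dvd m\<close> m1 by (intro dvd_imp_le) auto
        then have sL: "s \<in> primes_gt n p"
          using s mq \<open>s dvd m\<close> m1 by (auto simp: primes_gt_def primes_le_def)
        have "min q s * min q s \<le> q * s" by (intro mult_le_mono) auto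
        also have "q * s \<le> m"
          using a \<open>s \<le> a\<close> by simp
        finally have "(min q s)\<^sup>2 \<le> n"
          using m1 by (simp add: power2_eq_square)
        moreover have "min q s \<in> primes_gt n p"
          using qL sL by (simp add: min_def)
        ultimately show False
          using sq by force
      qed
      then show ?thesis
        using a qL by simp
    qed simp
  next
    fix m assume "m \<in> insert 1 (primes_gt n p)"
    moreover have "1 \<le> n"
      using p by (auto simp: primes_le_def dest: prime_ge_1_nat)
    ultimately show "m \<in> rough n p"
      by (auto simp: rough_def primes_gt_def primes_le_def prime_gt_0_nat Suc_leI dest: primes_dvd_imp_eq)
  qed
  moreover have "1 \<notin> primes_gt n p" by (auto simp: primes_gt_def primes_le_def)
  ultimately show ?thesis by simp
qed

text \<open>Besides 1 and the primes above p, the square of q is counted.\<close>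

lemma rough_square:
  assumes q: "prime q" "p < q" "q\<^sup>2 \<le> n"
  shows "Suc (Suc (card (primes_gt n p))) \<le> card (rough n p)"
proof -
  have "q * q \<le> n"
    using q by (simp add: power2_eq_square)
  then have n: "1 \<le> n"
    using q prime_gt_0_nat[of q] by (metis less_one mult_pos_pos not_le order_trans)
  have sub: "insert (q * q) (insert 1 (primes_gt n p)) \<subseteq> rough n p"
    using q n \<open>q * q \<le> n\<close>
    by (auto simp: rough_def primes_gt_def primes_le_def prime_gt_0_nat Suc_leI prime_dvd_mult_iff
        dest: primes_dvd_imp_eq)
  have "q * q \<notin> insert 1 (primes_gt n p)"
    using q prime_product[of q q] by (auto simp: primes_gt_def primes_le_def)
  moreover have "1 \<notin> primes_gt n p" by (auto simp: primes_gt_def primes_le_def)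
  ultimately have "card (insert (q * q) (insert 1 (primes_gt n p))) = Suc (Suc (card (primes_gt n p)))"
    by simp
  then show ?thesis
    using card_mono[OF finite_rough sub] by simp
qed

text \<open>Ranking from the top: the minimum has rank \<open>card A - 1\<close>, and its removal
  does not affect the other ranks.\<close>

lemma bij_card_larger:
  fixes A :: "nat set"
  assumes "finite A"
  shows "bij_betw (\<lambda>p. card {q \<in> A. p < q}) A {..<card A}"
  using assms
proof (induction "card A" arbitrary: A)
  case 0
  then show ?case by (simp add: bij_betw_def)
next
  case (Suc k)
  let ?g = "\<lambda>A p. card {q \<in> A. p < q}"
  have "A \<noteq> {}"
    using Suc by auto
  define m where "m = Min A"
  have m: "m \<in> A" "\<And>x. x \<in> A \<Longrightarrow> m \<le> x"
    using Suc \<open>A \<noteq> {}\<close> by (auto simp: m_def)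
  define B where "B = A - {m}"
  have B: "finite B" "card B = k" "A = insert m B" "m \<notin> B"
    using Suc m by (auto simp: B_def)
  have lt: "m < x" if "x \<in> B" for x
    using m(2)[of x] that B by (cases "x = m") auto
  have "bij_betw (?g B) B {..<k}"
    using Suc(1)[of B] B by simp
  moreover have "?g A p = ?g B p" if "p \<in> B" for p
    using lt[OF that] B(3) by (intro arg_cong[of _ _ card]) auto
  ultimately have "bij_betw (?g A) B {..<k}" by (subst bij_betw_cong[of _ _ "?g B"])
  moreover have "?g A m = k"
  proof -
    have "{q \<in> A. m < q} = B"
      using B(3,4) lt by auto
    then show ?thesis
      using B(2) by simp
  qed
  ultimately have "bij_betw (?g A) (B \<union> {m}) ({..<k} \<union> {k})"
    by (intro bij_betw_combine) (auto simp: bij_betw_def)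
  moreover have "B \<union> {m} = A" "{..<k} \<union> {k} = {..<card A}"
    using B(3) Suc(2) by auto
  ultimately show ?case by simp
qed

lemma bij_primes_gt:
  "bij_betw (\<lambda>p. card (primes_gt n p)) (primes_le n) {..<card (primes_le n)}"
  unfolding primes_gt_def by (rule bij_card_larger) simp

definition odd_sqrt_primes :: "nat \<Rightarrow> nat set" where
  "odd_sqrt_primes n = {p. prime p \<and> odd p \<and> p\<^sup>2 \<le> n}"

text \<open>The primes \<open>p \<le> n\<close> other than the last \<open>\<pi>(n) - \<ell>\<^sub>1(n)\<close> ones: those with \<open>q\<^sup>2 \<le> n\<close> for the
  prime \<open>q\<close> following \<open>p\<close>.\<close>

definition low_primes :: "nat \<Rightarrow> nat set" where
  "low_primes n = {p. prime p \<and> (\<exists>q\<in>odd_sqrt_primes n. p < q)}"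

section \<open>Splitting the primes into low and high ones\<close>

lemma odd_sqrt_primes_subset: "odd_sqrt_primes n \<subseteq> primes_le n"
proof
  fix p assume p: "p \<in> odd_sqrt_primes n"
  have "p \<le> p\<^sup>2" by (simp add: power2_eq_square)
  then show "p \<in> primes_le n"
    using p by (auto simp: odd_sqrt_primes_def primes_le_def)
qed

lemma low_primes_subset: "low_primes n \<subseteq> primes_le n"
proof
  fix p assume "p \<in> low_primes n"
  then obtain q where "prime p" "p < q" "q \<in> odd_sqrt_primes n" by (auto simp: low_primes_def)
  moreover from this have "q \<le> n"
    using odd_sqrt_primes_subset[of n] by (auto simp: primes_le_def)
  ultimately show "p \<in> primes_le n" by (simp add: primes_le_def)
qed

text \<open>With m the largest element of \<open>odd_sqrt_primes n\<close>, the low primes are the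
  primes below m, that is, 2 together with the other elements of that set: m is traded for
  2.\<close>

lemma card_low_primes: "card (low_primes n) = ell1 n"
proof (cases "odd_sqrt_primes n = {}")
  case True
  then show ?thesis by (simp add: low_primes_def ell1_def flip: odd_sqrt_primes_def)
next
  case False
  have fin: "finite (odd_sqrt_primes n)"
    using odd_sqrt_primes_subset finite_primes_le_subset by blast
  define m where "m = Max (odd_sqrt_primes n)"
  have m: "m \<in> odd_sqrt_primes n" "\<And>q. q \<in> odd_sqrt_primes n \<Longrightarrow> q \<le> m"
    using fin False by (auto simp: m_def)
  have m3: "prime m" "odd m" "m\<^sup>2 \<le> n"
    using m(1) by (auto simp: odd_sqrt_primes_def)
  then have "2 < m"
    using prime_ge_2_nat[of m] by (cases "m = 2") auto
  have "low_primes n = insert 2 (odd_sqrt_primes n - {m})"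
  proof (intro equalityI subsetI)
    fix p assume "p \<in> low_primes n"
    then obtain q where q: "prime p" "q \<in> odd_sqrt_primes n" "p < q"
      by (auto simp: low_primes_def)
    then have "p < m"
      using m(2)[of q] by simp
    then have "p\<^sup>2 \<le> m\<^sup>2" by (intro power_mono) auto
    then have "p\<^sup>2 \<le> n"
      using m3(3) by (rule order_trans)
    then show "p \<in> insert 2 (odd_sqrt_primes n - {m})"
      using q \<open>p < m\<close> prime_odd_nat[of p] prime_ge_2_nat[of p] by (cases "p = 2") (auto simp: odd_sqrt_primes_def)
  next
    fix p assume "p \<in> insert 2 (odd_sqrt_primes n - {m})"
    then have "prime p" "p < m"
      using \<open>2 < m\<close> m(2)[of p] by (auto simp: odd_sqrt_primes_def le_less)
    then show "p \<in> low_primes n"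
      using m(1) by (auto simp: low_primes_def)
  qed
  moreover have "2 \<notin> odd_sqrt_primes n" by (simp add: odd_sqrt_primes_def)
  moreover have "Suc (card (odd_sqrt_primes n - {m})) = card (odd_sqrt_primes n)"
    using fin m(1) by (rule card_Suc_Diff1)
  ultimately show ?thesis
    using fin by (simp add: ell1_def flip: odd_sqrt_primes_def)
qed

text \<open>The low primes are an initial segment of the primes, and there are \<pi>(n) - \<ell>(n)
  high ones, with \<ell> = \<open>ell1\<close>. Above a high prime there are only high ones, without
  the prime itself; above a low prime there are all high ones.\<close>

lemma card_larger_low:
  shows "p \<in> primes_le n - low_primes n \<Longrightarrow> card (primes_gt n p) < card (primes_le n) - ell1 n"
    and "p \<in> low_primes n \<Longrightarrow> card (primes_le n) - ell1 n \<le> card (primes_gt n p)"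
proof -
  have fin: "finite (low_primes n)"
    using low_primes_subset finite_primes_le_subset by blast
  have R: "card (primes_le n - low_primes n) = card (primes_le n) - ell1 n"
    by (simp add: card_Diff_subset[OF fin low_primes_subset] card_low_primes)
  show "card (primes_gt n p) < card (primes_le n) - ell1 n" if p: "p \<in> primes_le n - low_primes n"
  proof -
    have "primes_gt n p \<subset> primes_le n - low_primes n"
    proof
      show "primes_gt n p \<subseteq> primes_le n - low_primes n"
      proof
        fix q assume q: "q \<in> primes_gt n p"
        have "q \<notin> low_primes n"
        proof
          assume "q \<in> low_primes n"
          then obtain s where "s \<in> odd_sqrt_primes n" "q < s" by (auto simp: low_primes_def)
          moreover have "p < q" "prime p"
            using q p by (auto simp: primes_gt_def primes_le_def)
          ultimately have "p \<in> low_primes n"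
            unfolding low_primes_def by (auto intro!: bexI[of _ s])
          then show False
            using p by simp
        qed
        then show "q \<in> primes_le n - low_primes n"
          using q by (simp add: primes_gt_def)
      qed
      have "p \<notin> primes_gt n p" by (simp add: primes_gt_def)
      then show "primes_gt n p \<noteq> primes_le n - low_primes n"
        using p by blast
    qed
    then show ?thesis
      unfolding R[symmetric] by (intro psubset_card_mono) auto
  qed
  show "card (primes_le n) - ell1 n \<le> card (primes_gt n p)" if p: "p \<in> low_primes n"
  proof -
    have "primes_le n - low_primes n \<subseteq> primes_gt n p"
    proof
      fix q assume q: "q \<in> primes_le n - low_primes n"
      obtain s where s: "s \<in> odd_sqrt_primes n" "p < s"
        using p by (auto simp: low_primes_def)
      have "p < q"
      proof (rule ccontr)
        assume "\<not> p < q"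
        then have "q < s"
          using s by simp
        then show False
          using q s by (auto simp: low_primes_def primes_le_def)
      qed
      then show "q \<in> primes_gt n p"
        using q by (simp add: primes_gt_def)
    qed
    then show ?thesis
      unfolding R[symmetric] by (intro card_mono) auto
  qed
qed

lemma bij_high: "bij_betw (\<lambda>p. card (primes_gt n p)) (primes_le n - low_primes n) {..<card (primes_le n) - ell1 n}"
proof (rule bij_betw_imageI)
  let ?g = "\<lambda>p. card (primes_gt n p)"
  note b = bij_primes_gt[of n]
  show "inj_on ?g (primes_le n - low_primes n)"
    using b by (auto simp: bij_betw_def intro: inj_on_subset)
  show "?g ` (primes_le n - low_primes n) = {..<card (primes_le n) - ell1 n}"
  proof (intro equalityI subsetI)
    fix k assume k: "k \<in> {..<card (primes_le n) - ell1 n}"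
    then have "k \<in> ?g ` primes_le n"
      using b by (auto simp: bij_betw_def)
    then obtain p where p: "p \<in> primes_le n" "k = ?g p" by blast
    then have "p \<notin> low_primes n"
      using card_larger_low(2)[of p n] k by auto
    then show "k \<in> ?g ` (primes_le n - low_primes n)"
      using p by blast
  next
    fix k assume "k \<in> ?g ` (primes_le n - low_primes n)"
    then show "k \<in> {..<card (primes_le n) - ell1 n}"
      using card_larger_low(1)[of _ n] by blast
  qed
qed

lemma rough_high:
  assumes "p \<in> primes_le n - low_primes n"
  shows "card (rough n p) = Suc (card (primes_gt n p))"
proof (rule rough_no_square)
  fix q assume q: "q \<in> primes_gt n p"
  show "n < q\<^sup>2"
  proof (rule ccontr)
    assume "\<not> n < q\<^sup>2"
    moreover have "prime q" "p < q" "prime p"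
      using q assms by (auto simp: primes_gt_def primes_le_def)
    moreover from this have "odd q"
      using prime_odd_nat[of q] prime_ge_2_nat[of p] by simp
    ultimately have "q \<in> odd_sqrt_primes n" by (simp add: odd_sqrt_primes_def)
    then show False
      using assms \<open>p < q\<close> \<open>prime p\<close> by (auto simp: low_primes_def)
  qed
qed (use assms in auto)

text \<open>M t - 1 is what the high primes leave after division by -(1 + t)^M. Low primes have at
  least M larger primes, so the subtraction in the exponent is not truncated.\<close>

definition red_denom :: "nat \<Rightarrow> rat poly" where
  "red_denom n = (let M = card (primes_le n) - ell1 n in
     [:-1, of_nat M:] + (\<Sum>p\<in>low_primes n.
       Polynomial.smult (of_nat (card (rough n p))) (monom 1 2 * [:1, 1:] ^ (card (primes_gt n p) - M))))"

lemma ell1_le: "ell1 n \<le> card (primes_le n)"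
  by (metis card_low_primes card_mono finite_primes_le low_primes_subset)

lemma denominator_factorization:
  "1 - (\<Sum>p\<in>primes_le n. of_nat (card (rough n p)) * fps_X\<^sup>2 * (1 + fps_X) ^ card (primes_gt n p))
    = - ((1 + fps_X :: rat fps) ^ (card (primes_le n) - ell1 n) * fps_of_poly (red_denom n))"
proof -
  define M where "M = card (primes_le n) - ell1 n"
  define u where "u = (1 + fps_X :: rat fps)"
  let ?t = "\<lambda>p. of_nat (card (rough n p)) * fps_X\<^sup>2 * u ^ card (primes_gt n p)"
  have X: "fps_X = u - 1" by (simp add: u_def)
  have "(\<Sum>p\<in>primes_le n. ?t p) = (\<Sum>p\<in>primes_le n - low_primes n. ?t p) + (\<Sum>p\<in>low_primes n. ?t p)"
    by (rule sum.subset_diff[OF low_primes_subset]) simp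
  also have "(\<Sum>p\<in>primes_le n - low_primes n. ?t p)
      = (\<Sum>p\<in>primes_le n - low_primes n. (\<lambda>k. of_nat (Suc k) * fps_X\<^sup>2 * u ^ k) (card (primes_gt n p)))"
    by (intro sum.cong) (simp_all only: rough_high)
  also have "\<dots> = (\<Sum>k<M. of_nat (Suc k) * fps_X\<^sup>2 * u ^ k)"
    unfolding M_def by (rule sum.reindex_bij_betw[OF bij_high])
  also have "\<dots> = (u - 1)\<^sup>2 * (\<Sum>k<M. of_nat (Suc k) * u ^ k)"
    unfolding X sum_distrib_left by (intro sum.cong) (simp_all only: ac_simps)
  also have "\<dots> = 1 - of_nat (Suc M) * u ^ M + of_nat M * u ^ Suc M" by (rule sum_succ_powers)
  also have "(\<Sum>p\<in>low_primes n. ?t p)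
      = u ^ M * (\<Sum>p\<in>low_primes n. of_nat (card (rough n p)) * (fps_X\<^sup>2 * u ^ (card (primes_gt n p) - M)))"
    unfolding sum_distrib_left
  proof (rule sum.cong[OF refl])
    fix p assume "p \<in> low_primes n"
    then have "u ^ card (primes_gt n p) = u ^ M * u ^ (card (primes_gt n p) - M)"
      using card_larger_low(2)[of p n] by (simp add: M_def flip: power_add)
    then show "?t p = u ^ M * (of_nat (card (rough n p)) * (fps_X\<^sup>2 * u ^ (card (primes_gt n p) - M)))"
      by (simp only: ac_simps)
  qed
  finally have "1 - (\<Sum>p\<in>primes_le n. ?t p) = - (u ^ M * (of_nat M * fps_X - 1 +
      (\<Sum>p\<in>low_primes n. of_nat (card (rough n p)) * (fps_X\<^sup>2 * u ^ (card (primes_gt n p) - M)))))"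
    unfolding X by (simp add: algebra_simps)
  moreover have "fps_of_poly (red_denom n) = of_nat M * fps_X - 1 +
      (\<Sum>p\<in>low_primes n. of_nat (card (rough n p)) * (fps_X\<^sup>2 * u ^ (card (primes_gt n p) - M)))"
    unfolding red_denom_def Let_def M_def[symmetric] u_def
    by (simp add: fps_of_poly_add fps_of_poly_sum fps_of_poly_smult fps_of_poly_mult fps_of_poly_monom
        fps_of_poly_power fps_of_poly_pCons fps_of_nat mult.commute add.commute flip: fps_const_neg)
  ultimately show ?thesis by (simp add: u_def M_def)
qed

section \<open>Coefficients, degree and the value at -1\<close>

lemma coeff_0_red_denom: "coeff (red_denom n) 0 = -1"
  by (simp add: red_denom_def Let_def coeff_sum coeff_monom_mult)

lemma coeff_1_red_denom: "coeff (red_denom n) 1 = of_nat (card (primes_le n)) - of_nat (ell1 n)"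
  using ell1_le[of n] by (simp add: red_denom_def Let_def coeff_sum coeff_monom_mult of_nat_diff)

lemma two_in_primes_le: "2 \<le> n \<Longrightarrow> 2 \<in> primes_le n"
  by (simp add: primes_le_def)

lemma card_larger_2:
  assumes "2 \<le> n"
  shows "card (primes_gt n 2) = card (primes_le n) - 1"
proof -
  have "primes_gt n 2 = primes_le n - {2}"
  proof (intro equalityI subsetI)
    fix q assume "q \<in> primes_le n - {2}"
    then have "q \<in> primes_le n" "2 \<le> q" "q \<noteq> 2"
      using prime_ge_2_nat by (auto simp: primes_le_def)
    then show "q \<in> primes_gt n 2" by (simp add: primes_gt_def)
  qed (auto simp: primes_gt_def)
  then show ?thesis
    using two_in_primes_le[OF assms] by simp
qed

lemma larger_le_larger_2:
  assumes "p \<in> primes_le n"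
  shows "card (primes_gt n p) \<le> card (primes_gt n 2)"
  using assms prime_ge_2_nat[of p] by (intro card_mono) (auto simp: primes_gt_def primes_le_def)

lemma degree_linear_power_le: "degree ([:1, 1 :: rat:] ^ k) \<le> k"
  using degree_power_le[of "[:1, 1 :: rat:]" k] by simp

text \<open>The most larger primes, \<pi>(n) - 1 of them, belong to the prime 2; its summand has
  degree 2 + (\<pi>(n) - 1 - M), which is \<open>ell1 n + 1\<close>.\<close>

lemma degree_red_denom_le:
  assumes "2 \<le> n"
  shows "degree (red_denom n) \<le> Suc (ell1 n)"
  unfolding red_denom_def Let_def
proof (rule degree_add_le)
  let ?M = "card (primes_le n) - ell1 n"
  show "degree [:-1, of_nat ?M :: rat:] \<le> Suc (ell1 n)" by simp
  show "degree (\<Sum>p\<in>low_primes n. Polynomial.smult (of_nat (card (rough n p)))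
      (monom 1 2 * [:1, 1:] ^ (card (primes_gt n p) - ?M)) :: rat poly) \<le> Suc (ell1 n)"
  proof (rule degree_sum_le)
    show "finite (low_primes n)"
      using low_primes_subset finite_primes_le_subset by blast
    fix p assume p: "p \<in> low_primes n"
    let ?k = "card (primes_gt n p) - ?M"
    have pP: "p \<in> primes_le n"
      using p low_primes_subset by blast
    have "1 \<le> ell1 n"
      using p low_primes_subset[of n] finite_primes_le_subset[of "low_primes n" n]
      by (auto simp: Suc_le_eq card_gt_0_iff simp flip: card_low_primes)
    then have "2 + ?k \<le> Suc (ell1 n)"
      using larger_le_larger_2[OF pP] card_larger_2[OF assms] ell1_le[of n] by linarith
    moreover have "degree (Polynomial.smult (of_nat (card (rough n p))) (monom 1 2 * [:1, 1:] ^ ?k) :: rat poly) \<le> 2 + ?k"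
      by (rule order_trans[OF degree_smult_le], rule order_trans[OF degree_mult_le])
        (rule add_mono[OF degree_monom_le degree_linear_power_le])
    ultimately show "degree (Polynomial.smult (of_nat (card (rough n p))) (monom 1 2 * [:1, 1:] ^ ?k) :: rat poly) \<le> Suc (ell1 n)"
      by simp
  qed
qed

lemma coeff_top_red_denom:
  assumes n: "2 \<le> n"
  shows "coeff (red_denom n) (Suc (ell1 n)) = of_nat (card (rough n 2))"
proof -
  define M where "M = card (primes_le n) - ell1 n"
  have fin: "finite (low_primes n)"
    using low_primes_subset finite_primes_le_subset by blast
  have r: "1 \<le> card (primes_le n)"
    using two_in_primes_le[OF n] by (simp add: Suc_le_eq card_gt_0_iff) blast
  show ?thesis
  proof (cases "ell1 n")
    \<comment> \<open>Without low primes the top coefficient is that of t, namely M = \<pi>(n). As 2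
      is then a high prime, \<open>rough_high\<close> gives the same number.\<close>
    case 0
    then have low: "low_primes n = {}"
      using fin card_low_primes[of n] by simp
    then have "card (rough n 2) = Suc (card (primes_gt n 2))"
      using two_in_primes_le[OF n] by (intro rough_high) simp
    then have "card (rough n 2) = card (primes_le n)"
      using r by (simp add: card_larger_2[OF n])
    then show ?thesis
      using 0 low by (simp add: red_denom_def)
  next
    case (Suc l)
    let ?e = "\<lambda>p. card (primes_gt n p) - M"
    have e2: "?e 2 = l"
      using Suc r ell1_le[of n] by (simp add: card_larger_2[OF n] M_def)
    obtain p0 where "p0 \<in> low_primes n"
      using Suc card_low_primes[of n] by fastforce
    then have two: "2 \<in> low_primes n"
      unfolding low_primes_def using prime_ge_2_nat[of p0] by (auto intro: le_less_trans)
    \<comment> \<open>Ranks are distinct, so only p = 2 reaches the exponent l, and there the power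
      is monic.\<close>
    have "coeff ([:1, 1 :: rat:] ^ ?e p) l = (if p = 2 then 1 else 0)" if p: "p \<in> low_primes n" for p
    proof (cases "p = 2")
      case True
      have "lead_coeff ([:1, 1 :: rat:] ^ l) = 1" by (simp add: lead_coeff_power)
      moreover have "degree ([:1, 1 :: rat:] ^ l) = l" by (simp add: degree_power_eq)
      ultimately show ?thesis
        using True e2 by simp
    next
      case False
      have P: "p \<in> primes_le n"
        using p low_primes_subset by blast
      have "card (primes_gt n p) \<noteq> card (primes_gt n 2)"
        using bij_primes_gt[of n] False P two_in_primes_le[OF n]
        by (auto simp: bij_betw_def inj_on_def)
      then have "?e p < l"
        using larger_le_larger_2[OF P] e2 card_larger_low(2)[OF p] card_larger_low(2)[OF two]
        unfolding M_def by linarith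
      then show ?thesis
        using False degree_linear_power_le[of "?e p"] by (simp add: coeff_eq_0)
    qed
    then have "coeff (red_denom n) (Suc (ell1 n)) = (\<Sum>p\<in>low_primes n. if p = 2 then of_nat (card (rough n 2)) else 0)"
      unfolding red_denom_def Let_def M_def[symmetric]
      by (simp add: Suc coeff_sum coeff_monom_mult cong: if_cong) (intro sum.cong refl, simp)
    then show ?thesis
      using two fin by simp
  qed
qed

lemma card_rough_2_pos: "2 \<le> n \<Longrightarrow> 0 < card (rough n 2)"
proof -
  assume "2 \<le> n"
  then have "1 \<in> rough n 2" by (auto simp: rough_def)
  then show ?thesis
    using card_gt_0_iff finite_rough by blast
qed

lemma degree_red_denom: "2 \<le> n \<Longrightarrow> degree (red_denom n) = Suc (ell1 n)"
  using degree_red_denom_le[of n] coeff_top_red_denom[of n] card_rough_2_pos[of n]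
  by (intro antisym le_degree) auto

text \<open>Only exponents 0 survive at -1, leaving -1 - M and the count for the prime with exactly
  M larger primes. If that prime is low, \<open>rough_square\<close> makes its count at least M + 2
  and the value is positive; if there are no low primes, the value is -1 - M.\<close>

lemma red_denom_at_minus_1: "poly (red_denom n) (-1) \<noteq> 0"
proof -
  define M where "M = card (primes_le n) - ell1 n"
  have fin: "finite (low_primes n)"
    using low_primes_subset finite_primes_le_subset by blast
  have eq: "poly (red_denom n) (-1) = - 1 - of_nat M +
      (\<Sum>p\<in>low_primes n. if card (primes_gt n p) = M then of_nat (card (rough n p)) else 0)"
  proof -
    have "poly (Polynomial.smult c (monom 1 2 * [:1, 1:] ^ (k - M))) (-1) = (if k = M then c else 0)"
      if "M \<le> k" for k and c :: rat
      using that by (auto simp: poly_monom power_0_left)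
    then have "(\<Sum>p\<in>low_primes n. poly (Polynomial.smult (of_nat (card (rough n p)))
          (monom 1 2 * [:1, 1:] ^ (card (primes_gt n p) - M))) (-1)) =
        (\<Sum>p\<in>low_primes n. if card (primes_gt n p) = M then of_nat (card (rough n p)) else (0 :: rat))"
      using card_larger_low(2)[of _ n] by (intro sum.cong refl) (simp only: M_def)
    then show ?thesis
      unfolding red_denom_def Let_def M_def[symmetric] by (simp add: poly_sum)
  qed
  show ?thesis
  proof (cases "low_primes n = {}")
    case True
    then show ?thesis
      using eq by (simp add: eq_neg_iff_add_eq_0 algebra_simps)
  next
    case False
    then have l: "ell1 n \<noteq> 0"
      using fin card_low_primes[of n] by auto
    then have "M \<in> {..<card (primes_le n)}"
      using ell1_le[of n] by (simp add: M_def)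
    then obtain p where p: "p \<in> primes_le n" "card (primes_gt n p) = M"
      using bij_primes_gt[of n] by (metis (no_types, lifting) bij_betw_iff_bijections)
    then have pl: "p \<in> low_primes n"
      using card_larger_low(1)[of p n] by (auto simp: M_def)
    then obtain q where "q \<in> odd_sqrt_primes n" "p < q" by (auto simp: low_primes_def)
    then have "Suc (Suc M) \<le> card (rough n p)"
      using rough_square[of q p n] p(2) by (simp add: odd_sqrt_primes_def)
    then have "of_nat (Suc (Suc M)) \<le> (of_nat (card (rough n p)) :: rat)"
      by (simp only: of_nat_le_iff)
    moreover have "of_nat (card (rough n p)) \<le> (\<Sum>p\<in>low_primes n.
        if card (primes_gt n p) = M then of_nat (card (rough n p)) else 0 :: rat)"
      using member_le_sum[OF pl, of "\<lambda>p. if card (primes_gt n p) = M then of_nat (card (rough n p)) else 0 :: rat"] fin p(2)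
      by simp
    ultimately show ?thesis
      unfolding eq by simp
  qed
qed


section \<open>Minimal generators of the weight ideal\<close>

type_synonym 'k mpoly = "(nat \<Rightarrow>\<^sub>0 nat) \<Rightarrow>\<^sub>0 'k"

abbreviation keys :: "('a \<Rightarrow>\<^sub>0 'b::zero) \<Rightarrow> 'a set" where "keys \<equiv> Poly_Mapping.keys"

abbreviation lookup :: "('a \<Rightarrow>\<^sub>0 'b::zero) \<Rightarrow> 'a \<Rightarrow> 'b" where "lookup \<equiv> Poly_Mapping.lookup"

section \<open>Primes, weights and unique factorization\<close>

lemma infinite_primes: "infinite {p :: nat. prime p}"
  using primes_infinite by simp

lemma prime_nth_prime: "prime (nth_prime i)"
  using enumerate_in_set[OF infinite_primes, of "i - 1"] by (simp add: nth_prime_def)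

lemma nth_prime_1: "nth_prime 1 = 2"
proof -
  have "(LEAST p. p \<in> {p :: nat. prime p}) = 2"
    by (rule Least_equality) (auto intro: prime_ge_2_nat)
  then show ?thesis by (simp add: nth_prime_def enumerate_0)
qed

text \<open>Index 0 must be kept out: truncated subtraction makes \<open>nth_prime 0\<close> equal
  to \<open>nth_prime 1\<close>. The conditions \<open>0 \<notin> keys m\<close> further on have the
  same origin.\<close>

lemma nth_prime_inj: "1 \<le> i \<Longrightarrow> 1 \<le> j \<Longrightarrow> nth_prime i = nth_prime j \<longleftrightarrow> i = j"
  using strict_mono_enumerate[OF infinite_primes] by (auto simp: nth_prime_def strict_mono_eq)

lemma prime_eq_nth_prime:
  assumes "prime p" "p \<le> n"
  shows "\<exists>i\<in>{1..prime_count n}. nth_prime i = p"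
proof -
  let ?S = "{p :: nat. prime p}"
  obtain k where k: "enumerate ?S k = p"
    using enumerate_Ex[OF infinite_primes, of p] assms by auto
  have mono: "strict_mono (enumerate ?S)" by (rule strict_mono_enumerate[OF infinite_primes])
  \<comment> \<open>The index of p is bounded by counting: the first k + 1 primes are all at most p,
    hence at most n.\<close>
  have "enumerate ?S ` {..k} \<subseteq> {p. prime p \<and> p \<le> n}"
  proof
    fix q assume "q \<in> enumerate ?S ` {..k}"
    then obtain j where j: "j \<le> k" "q = enumerate ?S j" by auto
    then have "q \<le> p"
      using strict_mono_leD[OF mono j(1)] k by simp
    moreover have "prime q"
      using enumerate_in_set[OF infinite_primes, of j] j by simp
    ultimately show "q \<in> {p. prime p \<and> p \<le> n}"
      using assms by simp
  qed
  moreover have "finite {p :: nat. prime p \<and> p \<le> n}"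
    by (rule finite_subset[of _ "{..n}"]) auto
  ultimately have "card (enumerate ?S ` {..k}) \<le> prime_count n"
    unfolding prime_count_def by (intro card_mono)
  moreover have "card (enumerate ?S ` {..k}) = Suc k"
    using mono by (subst card_image) (auto intro: strict_mono_imp_inj_on)
  ultimately show ?thesis
    using k by (intro bexI[of _ "Suc k"]) (simp_all add: nth_prime_def)
qed

lemma weight_superset:
  assumes "finite A" "keys m \<subseteq> A"
  shows "weight m = (\<Prod>i\<in>A. nth_prime i ^ lookup m i)"
  unfolding weight_def using assms by (intro prod.mono_neutral_left) (auto simp: in_keys_iff)

lemma weight_add: "weight (m + m') = weight m * weight m'"
proof -
  let ?A = "keys m \<union> keys m'"
  have "keys (m + m') \<subseteq> ?A" by (rule Poly_Mapping.keys_add)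
  then have "weight (m + m') = (\<Prod>i\<in>?A. nth_prime i ^ lookup (m + m') i)"
    by (intro weight_superset) auto
  also have "\<dots> = (\<Prod>i\<in>?A. nth_prime i ^ lookup m i) * (\<Prod>i\<in>?A. nth_prime i ^ lookup m' i)"
    by (simp add: Poly_Mapping.lookup_add power_add prod.distrib)
  also have "\<dots> = weight m * weight m'" by (simp flip: weight_superset)
  finally show ?thesis .
qed

lemma weight_pos: "weight m > 0"
  unfolding weight_def by (intro prod_pos) (simp add: prime_nth_prime prime_gt_0_nat)

lemma weight_zero [simp]: "weight 0 = 1" by (simp add: weight_def)

lemma weight_single: "weight (Poly_Mapping.single i 1) = nth_prime i" by (simp add: weight_def)

lemma keys_add_nat:
  fixes m m' :: "nat \<Rightarrow>\<^sub>0 nat"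
  shows "keys (m + m') = keys m \<union> keys m'"
  by (auto simp: in_keys_iff Poly_Mapping.lookup_add)

lemma split_off_variable:
  fixes m :: "nat \<Rightarrow>\<^sub>0 nat"
  assumes "i \<in> keys m"
  obtains m' where "m = Poly_Mapping.single i 1 + m'"
proof
  show "m = Poly_Mapping.single i 1 + (m - Poly_Mapping.single i 1)"
    using assms by (intro poly_mapping_eqI)
      (auto simp: Poly_Mapping.lookup_add Poly_Mapping.lookup_minus Poly_Mapping.lookup_single in_keys_iff when_def)
qed

lemma weight_ge_2:
  assumes "m \<noteq> 0"
  shows "2 \<le> weight m"
proof -
  obtain i where "i \<in> keys m"
    using assms by (metis Poly_Mapping.keys_eq_empty ex_in_conv)
  then obtain m' where "m = Poly_Mapping.single i 1 + m'" by (rule split_off_variable)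
  then have "weight m = nth_prime i * weight m'" by (simp only: weight_add weight_single)
  moreover have "2 * 1 \<le> nth_prime i * weight m'"
    using prime_ge_2_nat[OF prime_nth_prime[of i]] weight_pos[of m'] by (intro mult_le_mono) auto
  ultimately show ?thesis by simp
qed

lemma multiplicity_weight:
  assumes "0 \<notin> keys m" "1 \<le> i"
  shows "multiplicity (nth_prime i) (weight m) = lookup m i"
proof -
  let ?K = "keys m"
  have K1: "1 \<le> j" if "j \<in> ?K" for j
    using assms(1) that by (cases j) auto
  have inj: "inj_on nth_prime ?K"
    using K1 by (auto intro!: inj_onI simp: nth_prime_inj)
  define f where "f p = lookup m (inv_into ?K nth_prime p)" for p
  have "weight m = (\<Prod>p\<in>nth_prime ` ?K. p ^ f p)"
    unfolding weight_def by (subst prod.reindex[OF inj]) (simp add: f_def inv_into_f_f[OF inj])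
  also have "multiplicity (nth_prime i) \<dots> = (if nth_prime i \<in> nth_prime ` ?K then f (nth_prime i) else 0)"
    by (rule multiplicity_prod_prime_powers) (auto simp: prime_nth_prime)
  also have "\<dots> = lookup m i"
  proof (cases "i \<in> ?K")
    case True
    then show ?thesis by (simp add: f_def inv_into_f_f[OF inj])
  next
    case False
    then have "nth_prime i \<notin> nth_prime ` ?K"
      using K1 assms(2) by (auto simp: nth_prime_inj)
    then show ?thesis
      using False by (simp add: in_keys_iff)
  qed
  finally show ?thesis .
qed

lemma weight_inj:
  assumes "0 \<notin> keys m" "0 \<notin> keys m'" "weight m = weight m'"
  shows "m = m'"
proof (rule poly_mapping_eqI)
  fix i
  show "lookup m i = lookup m' i"
  proof (cases "i = 0")
    case True
    then show ?thesis
      using assms(1,2) by (simp add: in_keys_iff)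
  next
    case False
    then show ?thesis
      using multiplicity_weight[OF assms(1), of i] multiplicity_weight[OF assms(2), of i] assms(3) by simp
  qed
qed

lemma weight_surj:
  "1 \<le> a \<Longrightarrow> a \<le> n \<Longrightarrow> \<exists>m. keys m \<subseteq> {1..prime_count n} \<and> weight m = a"
proof (induction a rule: less_induct)
  case (less a)
  show ?case
  proof (cases "a = 1")
    case True
    then show ?thesis by (intro exI[of _ 0]) simp
  next
    case False
    then obtain p where p: "prime p" "p dvd a"
      using prime_factor_nat by blast
    then obtain b where b: "a = p * b" by (elim dvdE)
    have "1 \<le> b"
      using b less.prems by (cases b) auto
    moreover have "b < a"
      using b prime_gt_1_nat[OF p(1)] \<open>1 \<le> b\<close> by simp
    ultimately obtain m where m: "keys m \<subseteq> {1..prime_count n}" "weight m = b"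
      using less.IH[of b] less.prems by auto
    have "p \<le> n"
      using dvd_imp_le[OF p(2)] less.prems by simp
    then obtain i where "i \<in> {1..prime_count n}" "nth_prime i = p"
      using prime_eq_nth_prime[OF p(1)] by blast
    then show ?thesis
      using m b by (intro exI[of _ "Poly_Mapping.single i 1 + m"])
        (auto simp: keys_add_nat weight_add weight_single simp del: One_nat_def)
  qed
qed

section \<open>The weight ideal and its generators\<close>

lemma keys_mult_subset:
  fixes f g :: "'k::field mpoly"
  assumes "m \<in> keys (f * g)"
  obtains a b where "m = a + b" "a \<in> keys f" "b \<in> keys g"
  using Poly_Mapping.keys_mult[of f g] assms by blast

lemma polynomial_ring_simps:
  "carrier (polynomial_ring r) = {f :: 'k::field mpoly. \<forall>m\<in>keys f. keys m \<subseteq> {1..r}}"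
  "mult (polynomial_ring r) = ((*) :: 'k mpoly \<Rightarrow> _)"
  "add (polynomial_ring r) = ((+) :: 'k mpoly \<Rightarrow> _)"
  "zero (polynomial_ring r) = (0 :: 'k mpoly)"
  "one (polynomial_ring r) = (1 :: 'k mpoly)" by (simp_all add: polynomial_ring_def)

lemma ring_polynomial_ring: "ring (polynomial_ring r :: 'k::field mpoly ring)"
proof (rule ringI)
  let ?R = "polynomial_ring r :: 'k mpoly ring"
  have add: "f + g \<in> carrier ?R" if "f \<in> carrier ?R" "g \<in> carrier ?R" for f g
    unfolding polynomial_ring_simps
  proof (rule CollectI, rule ballI)
    fix m assume "m \<in> keys (f + g)"
    then have "m \<in> keys f \<or> m \<in> keys g"
      using Poly_Mapping.keys_add[of f g] by blast
    then show "keys m \<subseteq> {1..r}"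
      using that unfolding polynomial_ring_simps by blast
  qed
  have mult: "f * g \<in> carrier ?R" if "f \<in> carrier ?R" "g \<in> carrier ?R" for f g
    unfolding polynomial_ring_simps
  proof (rule CollectI, rule ballI)
    fix m assume "m \<in> keys (f * g)"
    then obtain a b where "m = a + b" "a \<in> keys f" "b \<in> keys g" by (rule keys_mult_subset)
    then show "keys m \<subseteq> {1..r}"
      using that unfolding polynomial_ring_simps by (auto simp: keys_add_nat)
  qed
  show "abelian_group ?R"
  proof (rule abelian_groupI)
    fix f assume "f \<in> carrier ?R"
    then show "\<exists>g\<in>carrier ?R. g \<oplus>\<^bsub>?R\<^esub> f = \<zero>\<^bsub>?R\<^esub>"
      by (intro bexI[of _ "- f"]) (simp_all add: polynomial_ring_simps)
  next
    show "\<zero>\<^bsub>?R\<^esub> \<in> carrier ?R" by (simp add: polynomial_ring_simps)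
  qed (simp_all add: add polynomial_ring_simps(3,4) ac_simps)
  show "monoid ?R"
  proof (rule monoidI)
    show "\<one>\<^bsub>?R\<^esub> \<in> carrier ?R" by (simp add: polynomial_ring_simps)
  qed (simp_all add: mult polynomial_ring_simps(2,5) ac_simps)
qed (simp_all add: polynomial_ring_simps(2,3) algebra_simps)

text \<open>An upper bound for \<open>weight_ideal\<close>, which is an intersection of ideals.
  Closure under products holds because weights are multiplicative and at least 1.\<close>

lemma ideal_heavy:
  "ideal {f :: 'k::field mpoly.
     \<forall>m\<in>keys f. keys m \<subseteq> {1..r} \<and> n < weight m} (polynomial_ring r)"
  (is "ideal ?J ?R")
proof (rule idealI)
  show R: "ring ?R" by (rule ring_polynomial_ring)
  interpret ring ?R by (rule R)
  have sub: "?J \<subseteq> carrier ?R" by (auto simp: polynomial_ring_simps)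
  show "subgroup ?J (add_monoid ?R)"
  proof (rule group.subgroupI)
    show "group (add_monoid ?R)" by (rule add.is_group)
    show "?J \<subseteq> carrier (add_monoid ?R)"
      using sub by simp
    show "?J \<noteq> {}" by (auto intro: exI[of _ 0])
  next
    fix f assume f: "f \<in> ?J"
    have "\<ominus>\<^bsub>?R\<^esub> f = - f"
    proof (rule minus_equality)
      show "- f \<oplus>\<^bsub>?R\<^esub> f = \<zero>\<^bsub>?R\<^esub>"
        by (simp add: polynomial_ring_simps)
    qed (use f in \<open>simp_all add: polynomial_ring_simps\<close>)
    then show "inv\<^bsub>add_monoid ?R\<^esub> f \<in> ?J"
      using f by (simp add: a_inv_def)
  next
    fix f g assume "f \<in> ?J" "g \<in> ?J"
    then have "f + g \<in> ?J"
      using Poly_Mapping.keys_add[of f g] by blast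
    then show "f \<otimes>\<^bsub>add_monoid ?R\<^esub> g \<in> ?J"
      by (simp add: polynomial_ring_simps)
  qed
  have J: "f * g \<in> ?J" if "f \<in> ?J" "g \<in> carrier ?R" for f g
  proof -
    have "keys m \<subseteq> {1..r} \<and> n < weight m" if m: "m \<in> keys (f * g)" for m
    proof -
      obtain a b where ab: "m = a + b" "a \<in> keys f" "b \<in> keys g"
        using m by (rule keys_mult_subset)
      then have "keys a \<subseteq> {1..r}" "n < weight a" "keys b \<subseteq> {1..r}"
        using \<open>f \<in> ?J\<close> \<open>g \<in> carrier ?R\<close> unfolding polynomial_ring_simps by blast+
      moreover have "weight a \<le> weight a * weight b"
        using weight_pos[of b] by simp
      ultimately have "n < weight a * weight b" by (metis less_le_trans)
      then show ?thesis
        using ab(1) \<open>keys a \<subseteq> {1..r}\<close> \<open>keys b \<subseteq> {1..r}\<close>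
        by (simp add: keys_add_nat weight_add)
    qed
    then show ?thesis by blast
  qed
  show "f \<otimes>\<^bsub>?R\<^esub> g \<in> ?J" "g \<otimes>\<^bsub>?R\<^esub> f \<in> ?J" if "f \<in> ?J" "g \<in> carrier ?R" for f g
    using J[OF that] unfolding polynomial_ring_simps(2) mult.commute[of g f] by this+
qed

lemma monomial_in_weight_ideal_iff:
  "(monomial m :: 'k::field mpoly) \<in> weight_ideal n \<longleftrightarrow>
     keys m \<subseteq> {1..prime_count n} \<and> n < weight m"
proof
  let ?R = "polynomial_ring (prime_count n) :: 'k mpoly ring"
  let ?J = "{f :: 'k mpoly.
     \<forall>m\<in>keys f. keys m \<subseteq> {1..prime_count n} \<and> n < weight m}"
  let ?S = "{monomial m :: 'k mpoly | m. keys m \<subseteq> {1..prime_count n} \<and> weight m > n}"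
  {
    assume "(monomial m :: 'k mpoly) \<in> weight_ideal n"
    moreover have "?S \<subseteq> ?J" by (auto simp: monomial_def)
    ultimately have "(monomial m :: 'k mpoly) \<in> ?J"
      unfolding weight_ideal_def genideal_def using ideal_heavy[where ?'k = 'k, of "prime_count n" n] by blast
    then show "keys m \<subseteq> {1..prime_count n} \<and> n < weight m"
      by (simp add: monomial_def)
  }
  show "(monomial m :: 'k mpoly) \<in> weight_ideal n"
    if "keys m \<subseteq> {1..prime_count n} \<and> n < weight m"
    unfolding weight_ideal_def genideal_def using that by blast
qed

text \<open>A minimal generator with least index 1 has x_1 as a factor; removing it leaves the
  ideal, so the weight is 2 a with a \<le> n < 2 a. Conversely, every proper divisor of a monomial
  of weight 2 a has weight at most a \<le> n.\<close>

lemma weight_min_gens: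
  assumes n: "2 \<le> n"
  shows "bij_betw weight {m \<in> min_monomial_gens (weight_ideal n :: 'k::field mpoly set). min_index m = 1}
     ((\<lambda>a. 2 * a) ` {a \<in> {1..n}. n < 2 * a})"
  (is "bij_betw weight ?T (_ ` ?A)")
proof (rule bij_betw_imageI)
  have T: "m \<in> ?T \<longleftrightarrow> keys m \<subseteq> {1..prime_count n} \<and> n < weight m \<and> min_index m = 1 \<and>
    (\<forall>m'. keys m' \<subseteq> {1..prime_count n} \<and> n < weight m' \<and> (\<exists>d. m = m' + d) \<longrightarrow> m' = m)" for m
    by (auto simp: min_monomial_gens_def monomial_in_weight_ideal_iff)
  show "inj_on weight ?T"
  proof (rule inj_onI)
    fix m m' assume "m \<in> ?T" "m' \<in> ?T" "weight m = weight m'"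
    then show "m = m'"
      unfolding T by (intro weight_inj) auto
  qed
  show "weight ` ?T = (\<lambda>a. 2 * a) ` ?A"
  proof (intro equalityI subsetI)
    fix x assume "x \<in> weight ` ?T"
    then obtain m where m: "m \<in> ?T" "x = weight m" by blast
    have "keys m \<noteq> {}"
      using m(1) n unfolding T by (auto simp: weight_def)
    then have "1 \<in> keys m"
      using m(1) Min_in[of "keys m"] unfolding T by (simp add: min_index_def)
    then obtain m' where m': "m = Poly_Mapping.single 1 1 + m'" by (rule split_off_variable)
    have w: "weight m = 2 * weight m'"
      unfolding m' by (simp only: weight_add weight_single nth_prime_1)
    have "weight m' \<le> n"
    proof (rule ccontr)
      assume "\<not> weight m' \<le> n"
      moreover have "m = m' + Poly_Mapping.single 1 1" by (simp only: m' add.commute)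
      moreover have "keys m' \<subseteq> {1..prime_count n}"
        using m(1) unfolding T m' by (simp add: keys_add_nat)
      ultimately have "m' = m"
        using m(1) unfolding T not_le by blast
      then show False
        using w weight_pos[of m] by simp
    qed
    then show "x \<in> (\<lambda>a. 2 * a) ` ?A"
      using m w weight_pos[of m'] unfolding T by (intro image_eqI[of _ _ "weight m'"]) auto
  next
    fix x assume "x \<in> (\<lambda>a. 2 * a) ` ?A"
    then obtain a where a: "1 \<le> a" "a \<le> n" "n < 2 * a" "x = 2 * a" by auto
    obtain m' where m': "keys m' \<subseteq> {1..prime_count n}" "weight m' = a"
      using weight_surj[OF a(1,2)] by blast
    define m where "m = Poly_Mapping.single 1 1 + m'"
    have w: "weight m = 2 * a"
      unfolding m_def by (simp only: weight_add weight_single nth_prime_1 m'(2))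
    have K: "keys m = insert 1 (keys m')"
      unfolding m_def by (simp add: keys_add_nat)
    have "1 \<le> prime_count n"
      using prime_eq_nth_prime[OF two_is_prime_nat n] by auto
    then have K1: "keys m \<subseteq> {1..prime_count n}"
      using m'(1) K by auto
    have "min_index m = 1"
      unfolding min_index_def using K K1 by (intro Min_eqI) auto
    moreover have "\<forall>m''. keys m'' \<subseteq> {1..prime_count n} \<and> n < weight m'' \<and> (\<exists>d. m = m'' + d) \<longrightarrow> m'' = m"
    proof (intro allI impI)
      fix m''
      assume *: "keys m'' \<subseteq> {1..prime_count n} \<and> n < weight m'' \<and> (\<exists>d. m = m'' + d)"
      then obtain d where that: "n < weight m''" "m = m'' + d" by blast
      show "m'' = m"
      proof (rule ccontr)
        assume "m'' \<noteq> m"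
        then have "d \<noteq> 0"
          using that by auto
        then have "weight m'' * 2 \<le> weight m'' * weight d"
          using weight_ge_2 by (intro mult_le_mono) auto
        also have "\<dots> = 2 * a"
          using w that(2) by (simp add: weight_add)
        finally show False
          using that(1) a(2) by simp
      qed
    qed
    moreover have "n < weight m"
      using w a(3) by simp
    ultimately have "m \<in> ?T"
      unfolding T using K1 by (intro conjI)
    then show "x \<in> weight ` ?T"
      using w a(4) by (intro image_eqI[of _ _ m]) simp_all
  qed
qed

lemma gen_count_1:
  assumes n: "2 \<le> n"
  shows "gen_count TYPE('k::field) n 1 = card {a \<in> {1..n}. n < 2 * a}"
proof -
  have "gen_count TYPE('k) n 1 = card ((\<lambda>a :: nat. 2 * a) ` {a \<in> {1..n}. n < 2 * a})"
    unfolding gen_count_def using weight_min_gens[OF n] by (rule bij_betw_same_card)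
  also have "\<dots> = card {a \<in> {1..n}. n < 2 * a}"
    by (rule card_image) (auto simp: inj_on_def)
  finally show ?thesis .
qed

lemma card_upper_half: "int (card {a \<in> {1..n}. n < 2 * a}) = \<lceil>real n / 2\<rceil>"
proof -
  have "{a \<in> {1..n}. n < 2 * a} = {n div 2 + 1..n}" by auto
  then have "int (card {a \<in> {1..n}. n < 2 * a}) = int n - int (n div 2)"
    by (simp add: of_nat_diff)
  also have "\<dots> = \<lceil>real n / 2\<rceil>"
    by (cases "even n") (auto elim!: evenE oddE intro!: ceiling_unique[symmetric])
  finally show ?thesis .
qed

text \<open>The case p = 2 of \<open>card_golod_fibre\<close>, where the condition on prime factors
  is automatic.\<close>

lemma card_rough_2: "card (rough n 2) = card {a \<in> {1..n}. n < 2 * a}"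
proof -
  have "{m \<in> {1..n}. (\<forall>q. prime q \<and> q dvd m \<longrightarrow> 2 \<le> q) \<and> n < m * 2} = {a \<in> {1..n}. n < 2 * a}"
    using prime_ge_2_nat by auto
  then show ?thesis
    using card_golod_fibre[of 2 n] by simp
qed


section \<open>The Poincare-Betti series\<close>

lemma poincare_betti_eq:
  assumes n: "2 \<le> n"
  shows "poincare_betti TYPE('k::field_char_0) n
    = - ((1 + fps_X) ^ ell1 n / fps_of_poly (red_denom n))"
proof -
  define B where "B = poincare_betti TYPE('k) n"
  define u where "u = (1 + fps_X :: rat fps)"
  define h where "h = fps_of_poly (red_denom n)"
  let ?r = "card (primes_le n)"
  have B: "B = Abs_fps (\<lambda>e. of_nat (card (cells n e)))"
    unfolding B_def poincare_betti_def using n by (simp add: tor_dim_eq_card_cells)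
  have "- (u ^ (?r - ell1 n) * h) * B = u ^ ?r"
    using fps_cells[OF finite_cells, of n]
    unfolding denominator_factorization B u_def h_def .
  also have "\<dots> = u ^ (?r - ell1 n) * u ^ ell1 n"
    using ell1_le[of n] by (simp flip: power_add)
  finally have eq: "- (u ^ (?r - ell1 n) * h) * B = u ^ (?r - ell1 n) * u ^ ell1 n" .
  have "u ^ (?r - ell1 n) * (h * B) = - (- (u ^ (?r - ell1 n) * h) * B)"
    by (simp only: mult_minus_left minus_minus mult.assoc)
  also have "\<dots> = u ^ (?r - ell1 n) * - (u ^ ell1 n)"
    unfolding eq by (simp only: mult_minus_right)
  finally have "u ^ (?r - ell1 n) * (h * B) = u ^ (?r - ell1 n) * - (u ^ ell1 n)" .
  \<comment> \<open>Cancellation of the common power of 1 + t takes place in the domain of power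
    series. The remaining denominator has constant term -1, so dividing by it is legitimate.\<close>
  moreover have "u $ 0 \<noteq> 0" by (simp add: u_def)
  then have "u ^ (?r - ell1 n) \<noteq> 0" by auto
  ultimately have hB: "h * B = - (u ^ ell1 n)" by (simp only: mult_cancel_left) simp
  have h0: "h $ 0 \<noteq> 0" by (simp add: h_def coeff_0_red_denom)
  then have "h \<noteq> 0" by auto
  then have "B = (h * B) / h" by simp
  also have "\<dots> = - (u ^ ell1 n / h)"
    unfolding hB using h0 by (simp add: fps_divide_unit)
  finally show ?thesis by (simp add: B_def u_def h_def)
qed

theorem theorem16:
  fixes n :: nat
  assumes "n \<ge> 2"
  shows "\<exists>q :: rat poly.
           poincare_betti TYPE('k::field_char_0) n = - ((1 + fps_X) ^ ell1 n / fps_of_poly q) \<and>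
           poly q (-1) \<noteq> 0 \<and>
           ell1 n = card {p::nat. prime p \<and> odd p \<and> p\<^sup>2 \<le> n} \<and>
           degree q = ell2 n \<and> ell2 n = ell1 n + 1 \<and>
           coeff q 0 = -1 \<and>
           coeff q 1 = of_nat (prime_count n) - of_nat (ell1 n) \<and>
           coeff q (ell2 n) = of_nat (gen_count TYPE('k) n 1) \<and>
           int (gen_count TYPE('k) n 1) = \<lceil>real n / 2\<rceil>"
proof (intro exI conjI)
  show "poincare_betti TYPE('k) n = - ((1 + fps_X) ^ ell1 n / fps_of_poly (red_denom n))"
    by (rule poincare_betti_eq[OF assms])
  show "poly (red_denom n) (-1) \<noteq> 0"
    by (rule red_denom_at_minus_1)
  show "ell1 n = card {p::nat. prime p \<and> odd p \<and> p\<^sup>2 \<le> n}"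
    by (rule ell1_def)
  show "degree (red_denom n) = ell2 n"
    using degree_red_denom[OF assms] by (simp add: ell2_def)
  show "ell2 n = ell1 n + 1"
    by (rule ell2_def)
  show "coeff (red_denom n) 0 = -1"
    by (rule coeff_0_red_denom)
  show "coeff (red_denom n) 1 = of_nat (prime_count n) - of_nat (ell1 n)"
    unfolding coeff_1_red_denom prime_count_def primes_le_def ..
  show "coeff (red_denom n) (ell2 n) = of_nat (gen_count TYPE('k) n 1)"
    using coeff_top_red_denom[OF assms] by (simp only: ell2_def gen_count_1[OF assms] card_rough_2 Suc_eq_plus1)
  show "int (gen_count TYPE('k) n 1) = \<lceil>real n / 2\<rceil>"
    by (simp only: gen_count_1[OF assms] card_upper_half)
qed

end
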